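(* Let $\mathbb S$ be a quasi-Banach space with a subsymmetric basis $(s_j)_{j=1}^\infty$, whose quasi-norm is a $p$-norm for some $0<p\le 1$ and is subsymmetric with respect to $(s_j)_{j=1}^\infty$. Let $\mathcal B$ be a subsymmetric basic sequence in $\mathbb S$. Then at least one of the following holds: (a) $\mathcal B$ is equivalent to a subsymmetric basic sequence generated by a seed $(f,\eta)$ with $E_\infty[f,\eta]=0$ and with $f$ a non-negative and non-increasing sequence; (b) $\mathcal B$ is equivalent to a block basic sequence with respect to $(s_j)_{j=1}^\infty$, and $\mathcal B$ dominates a semi-normalized uniformly null block basic sequence with respect to $(s_j)_{j=1}^\infty$.
   Context: Scalars: $\mathbb F=\mathbb R$ or $\mathbb C$; $\mathbb N=\{1,2,\dots\}$, $\mathbb N[n]=\{1,\dots,n\}$; $\mathcal O$ is the set of (strictly) increasing maps $\mathbb N\to\mathbb N$. A basic sequence in a quasi-Banach space is a sequence that is a Schauder basis of its closed linear span. Basic sequences $(x_j)$, $(y_j)$ (possibly in different spaces) are equivalent if $\sum a_jx_j$ converges iff $\sum a_jy_j$ does; $(x_j)$ dominates $(y_j)$ if there is a bounded linear operator from the closed span of $(x_j)$ to that of $(y_j)$ sending $x_j$ to $y_j$ for all $j$. A basic sequence $(x_j)$ is subsymmetric if it is unconditional (every permutation of it is a basic sequence) and $(x_{\phi(j)})_j$ is equivalent to $(x_j)_j$ for every $\phi\in\mathcal O$. It is semi-normalized if $0<\inf_j\|x_j\|\le\sup_j\|x_j\|<\infty$. Norm conventions: a $p$-norm ($0<p\le1$)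 is a quasi-norm with $\|x+y\|^p\le\|x\|^p+\|y\|^p$. With $s_j^*$ the coordinate functionals, the quasi-norm is subsymmetric with respect to $(s_j)$ if $\|x\|=\|\sum_j\varepsilon_j s_j^*(x)s_{\phi(j)}\|$ for all $x\in\mathbb S$, all scalars with $|\varepsilon_j|=1$, and all $\phi\in\mathcal O$. Blocks: a block basic sequence with respect to $(s_j)$ is a sequence of non-zero vectors $(y_k)$ such that every index in the support of $y_k$ is smaller than every index in the support of $y_{k+1}$, where $\operatorname{supp}(x)=\{j: s_j^*(x)\neq0\}$. A sequence $(x_k)$ in $\mathbb S$ is uniformly null if $\lim_k\sup_j|s_j^*(x_k)|=0$. A vector $y$ is a right-shift of $x=\sum_ja_js_j$ if $y=\sum_j a_js_{\phi(j)}$ for some $\phi\in\mathcal O$. Seeds: a positioning is a sequence $\eta=(d_n)_{n=1}^\infty$ with $d_n\in\mathbb N[n]$. It determines permutations $\pi_n$ of $\mathbb N[n]$ recursively (starting from the empty $\pi_0$): $\pi_n(n)=d_n$ and, for $j<n$, $\pi_n(j)=\pi_{n-1}(j)$ if $\pi_{n-1}(j)<d_n$, and $\pi_n(j)=1+\pi_{n-1}(j)$ if $\pi_{n-1}(j)\ge d_n$. A seed is a pair $(f,\eta)$ with $f=(a_j)_{j=1}^\infty\in\mathbb F^{\mathbb N}$ and $\eta$ a positioning. Put $u_{m,n}=\sum_{j=1}^m a_js_{\pi_n(j)}$ for $0\le m\le n$ (so $u_{0,n}=0$) and $u_n=u_{n,n}$. Define $E_m[f,\eta]=\sup_{n\ge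 m,\,n\ge1}\|u_n-u_{m,n}\|\in[0,\infty]$ for $m\ge0$, and $E_\infty[f,\eta]=\inf_m E_m[f,\eta]$ ($(E_m[f,\eta])_m$ is non-increasing). Generated sequences: for an unbounded sequence $\nu=(n_k)$ in $\mathbb N$, $\mathcal B[f,\eta,\nu]$ is the sequence whose $k$-th term is the translate of $u_{n_k}$ by $q_k=\sum_{i<k}n_i$, i.e. $\sum_{j=1}^{n_k}a_j s_{q_k+\pi_{n_k}(j)}$. If $E_\infty[f,\eta]=0$ (and $f\ne0$), then there are increasing $\nu$ for which $\mathcal B[f,\eta,\nu]$ is a subsymmetric basic sequence, and any two such are equivalent; a basic sequence in this equivalence class is called a subsymmetric basic sequence generated by $(f,\eta)$. *)

theory Defs
  imports "HOL-Analysis.Analysis"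
begin

text \<open>
  The library has no quasi-normed spaces, so the space is given by a scalar multiplication and a
  quasi-norm \<open>N\<close>, and convergence always means convergence with respect to \<open>N\<close>.
  The scalar field is a type variable: the real normed fields of finite dimension (class
  \<open>euclidean_space\<close>) are, up to isometric isomorphism, exactly \<open>real\<close> and \<open>complex\<close>.

  Sequences are indexed from \<open>0\<close>: the index \<open>j :: nat\<close> stands for the index \<open>j + 1\<close> of the
  convention in which the natural numbers start at \<open>1\<close>.
\<close>

locale quasi_banach_space = vector_space smul
  for smul :: "'f::real_normed_field \<Rightarrow> 'a::ab_group_add \<Rightarrow> 'a" +
  fixes N :: "'a \<Rightarrow> real"
  assumes qnorm_nonneg: "0 \<le> N x"
    and qnorm_eq_0_iff: "N x = 0 \<longleftrightarrow> x = 0"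
    and qnorm_scale: "N (smul c x) = norm c * N x"
    and qnorm_triangle: "\<exists>\<kappa>. \<forall>x y. N (x + y) \<le> \<kappa> * (N x + N y)"
    and qnorm_complete:
      "(\<forall>e>0. \<exists>M. \<forall>m\<ge>M. \<forall>n\<ge>M. N (X m - X n) < e) \<Longrightarrow>
        \<exists>l. (\<lambda>n. N (X n - l)) \<longlonglongrightarrow> 0"

definition is_p_norm :: "real \<Rightarrow> ('a::ab_group_add \<Rightarrow> real) \<Rightarrow> bool" where
  "is_p_norm p N \<longleftrightarrow> (\<forall>x y. N (x + y) powr p \<le> N x powr p + N y powr p)"

definition qsums ::
  "('f::real_normed_field \<Rightarrow> 'a::ab_group_add \<Rightarrow> 'a) \<Rightarrow> ('a \<Rightarrow> real) \<Rightarrow>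
    (nat \<Rightarrow> 'f) \<Rightarrow> (nat \<Rightarrow> 'a) \<Rightarrow> 'a \<Rightarrow> bool" where
  "qsums smul N a x v \<longleftrightarrow> (\<lambda>n. N ((\<Sum>j<n. smul (a j) (x j)) - v)) \<longlonglongrightarrow> 0"

definition closed_span ::
  "('f::real_normed_field \<Rightarrow> 'a::ab_group_add \<Rightarrow> 'a) \<Rightarrow> ('a \<Rightarrow> real) \<Rightarrow> (nat \<Rightarrow> 'a) \<Rightarrow> 'a set" where
  "closed_span smul N x = {v. \<forall>e>0. \<exists>w \<in> module.span smul (range x). N (v - w) < e}"

definition schauder_basis_of ::
  "('f::real_normed_field \<Rightarrow> 'a::ab_group_add \<Rightarrow> 'a) \<Rightarrow> ('a \<Rightarrow> real) \<Rightarrow>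
    (nat \<Rightarrow> 'a) \<Rightarrow> 'a set \<Rightarrow> bool" where
  "schauder_basis_of smul N x Y \<longleftrightarrow> range x \<subseteq> Y \<and> (\<forall>v\<in>Y. \<exists>!a. qsums smul N a x v)"

definition basic_sequence ::
  "('f::real_normed_field \<Rightarrow> 'a::ab_group_add \<Rightarrow> 'a) \<Rightarrow> ('a \<Rightarrow> real) \<Rightarrow> (nat \<Rightarrow> 'a) \<Rightarrow> bool" where
  "basic_sequence smul N x \<longleftrightarrow> schauder_basis_of smul N x (closed_span smul N x)"

definition equivalent_seqs ::
  "('f::real_normed_field \<Rightarrow> 'a::ab_group_add \<Rightarrow> 'a) \<Rightarrow> ('a \<Rightarrow> real) \<Rightarrow>
    (nat \<Rightarrow> 'a) \<Rightarrow> (nat \<Rightarrow> 'a) \<Rightarrow> bool" where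
  "equivalent_seqs smul N x y \<longleftrightarrow>
    (\<forall>a. (\<exists>v. qsums smul N a x v) \<longleftrightarrow> (\<exists>w. qsums smul N a y w))"

definition dominates ::
  "('f::real_normed_field \<Rightarrow> 'a::ab_group_add \<Rightarrow> 'a) \<Rightarrow> ('a \<Rightarrow> real) \<Rightarrow>
    (nat \<Rightarrow> 'a) \<Rightarrow> (nat \<Rightarrow> 'a) \<Rightarrow> bool" where
  "dominates smul N x y \<longleftrightarrow>
    (\<exists>T. T ` closed_span smul N x \<subseteq> closed_span smul N y \<and>
      (\<forall>u \<in> closed_span smul N x. \<forall>v \<in> closed_span smul N x. T (u + v) = T u + T v) \<and>
      (\<forall>c. \<forall>u \<in> closed_span smul N x. T (smul c u) = smul c (T u)) \<and>
      (\<exists>C. \<forall>u \<in> closed_span smul N x. N (T u) \<le> C * N u) \<and>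
      (\<forall>j. T (x j) = y j))"

definition unconditional_seq ::
  "('f::real_normed_field \<Rightarrow> 'a::ab_group_add \<Rightarrow> 'a) \<Rightarrow> ('a \<Rightarrow> real) \<Rightarrow> (nat \<Rightarrow> 'a) \<Rightarrow> bool" where
  "unconditional_seq smul N x \<longleftrightarrow>
    (\<forall>\<sigma> :: nat \<Rightarrow> nat. bij \<sigma> \<longrightarrow> basic_sequence smul N (x \<circ> \<sigma>))"

definition subsymmetric_seq ::
  "('f::real_normed_field \<Rightarrow> 'a::ab_group_add \<Rightarrow> 'a) \<Rightarrow> ('a \<Rightarrow> real) \<Rightarrow> (nat \<Rightarrow> 'a) \<Rightarrow> bool" where
  "subsymmetric_seq smul N x \<longleftrightarrow>
    basic_sequence smul N x \<and> unconditional_seq smul N x \<and>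
    (\<forall>\<phi> :: nat \<Rightarrow> nat. strict_mono \<phi> \<longrightarrow> equivalent_seqs smul N (x \<circ> \<phi>) x)"

definition semi_normalized :: "('a \<Rightarrow> real) \<Rightarrow> (nat \<Rightarrow> 'a) \<Rightarrow> bool" where
  "semi_normalized N x \<longleftrightarrow> 0 < (INF j. N (x j)) \<and> bdd_above (range (\<lambda>j. N (x j)))"

text \<open>The coordinate \<open>s\<^sub>j\<^sup>*(v)\<close>; meaningful when \<open>s\<close> is a Schauder basis of the whole space.\<close>

definition coord ::
  "('f::real_normed_field \<Rightarrow> 'a::ab_group_add \<Rightarrow> 'a) \<Rightarrow> ('a \<Rightarrow> real) \<Rightarrow>
    (nat \<Rightarrow> 'a) \<Rightarrow> nat \<Rightarrow> 'a \<Rightarrow> 'f" where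
  "coord smul N s j v = (THE a. qsums smul N a s v) j"

definition subsymmetric_qnorm ::
  "('f::real_normed_field \<Rightarrow> 'a::ab_group_add \<Rightarrow> 'a) \<Rightarrow> ('a \<Rightarrow> real) \<Rightarrow> (nat \<Rightarrow> 'a) \<Rightarrow> bool" where
  "subsymmetric_qnorm smul N s \<longleftrightarrow>
    (\<forall>x. \<forall>\<epsilon> :: nat \<Rightarrow> 'f. \<forall>\<phi> :: nat \<Rightarrow> nat.
      (\<forall>j. norm (\<epsilon> j) = 1) \<longrightarrow> strict_mono \<phi> \<longrightarrow>
      (\<exists>y. qsums smul N (\<lambda>j. \<epsilon> j * coord smul N s j x) (s \<circ> \<phi>) y \<and> N x = N y))"

definition coord_supp ::
  "('f::real_normed_field \<Rightarrow> 'a::ab_group_add \<Rightarrow> 'a) \<Rightarrow> ('a \<Rightarrow> real) \<Rightarrow>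
    (nat \<Rightarrow> 'a) \<Rightarrow> 'a \<Rightarrow> nat set" where
  "coord_supp smul N s x = {j. coord smul N s j x \<noteq> 0}"

definition block_basic_sequence ::
  "('f::real_normed_field \<Rightarrow> 'a::ab_group_add \<Rightarrow> 'a) \<Rightarrow> ('a \<Rightarrow> real) \<Rightarrow>
    (nat \<Rightarrow> 'a) \<Rightarrow> (nat \<Rightarrow> 'a) \<Rightarrow> bool" where
  "block_basic_sequence smul N s y \<longleftrightarrow>
    (\<forall>k. y k \<noteq> 0) \<and>
    (\<forall>k. \<forall>i \<in> coord_supp smul N s (y k). \<forall>j \<in> coord_supp smul N s (y (Suc k)). i < j)"

definition uniformly_null ::
  "('f::real_normed_field \<Rightarrow> 'a::ab_group_add \<Rightarrow> 'a) \<Rightarrow> ('a \<Rightarrow> real) \<Rightarrow>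
    (nat \<Rightarrow> 'a) \<Rightarrow> (nat \<Rightarrow> 'a) \<Rightarrow> bool" where
  "uniformly_null smul N s x \<longleftrightarrow>
    (\<lambda>k. SUP j. ennreal (norm (coord smul N s j (x k)))) \<longlonglongrightarrow> 0"

text \<open>
  Positionings and their permutations, shifted to start at \<open>0\<close>: if \<open>d\<^sub>n \<in> {1..n}\<close> and \<open>\<pi>\<^sub>n\<close> are the
  objects indexed from \<open>1\<close>, then \<open>d n = d\<^sub>n\<^sub>+\<^sub>1 - 1 \<in> {0..n}\<close>, and \<open>position_perm d n j = \<pi>\<^sub>n(j + 1) - 1\<close>
  is a permutation of \<open>{..<n}\<close> (with irrelevant values for \<open>j \<ge> n\<close>).
\<close>

definition positioning :: "(nat \<Rightarrow> nat) \<Rightarrow> bool" where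
  "positioning d \<longleftrightarrow> (\<forall>n. d n \<le> n)"

fun position_perm :: "(nat \<Rightarrow> nat) \<Rightarrow> nat \<Rightarrow> nat \<Rightarrow> nat" where
  "position_perm d 0 j = j"
| "position_perm d (Suc n) j =
    (if j = n then d n
     else if position_perm d n j < d n then position_perm d n j
     else Suc (position_perm d n j))"

definition seed_vec ::
  "('f::real_normed_field \<Rightarrow> 'a::ab_group_add \<Rightarrow> 'a) \<Rightarrow> (nat \<Rightarrow> 'a) \<Rightarrow>
    (nat \<Rightarrow> 'f) \<Rightarrow> (nat \<Rightarrow> nat) \<Rightarrow> nat \<Rightarrow> nat \<Rightarrow> 'a" where
  "seed_vec smul s f d m n = (\<Sum>j<m. smul (f j) (s (position_perm d n j)))"

definition seed_E ::
  "('f::real_normed_field \<Rightarrow> 'a::ab_group_add \<Rightarrow> 'a) \<Rightarrow> ('a \<Rightarrow> real) \<Rightarrow> (nat \<Rightarrow> 'a) \<Rightarrow>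
    (nat \<Rightarrow> 'f) \<Rightarrow> (nat \<Rightarrow> nat) \<Rightarrow> nat \<Rightarrow> ennreal" where
  "seed_E smul N s f d m =
    (SUP n \<in> {n. m \<le> n \<and> 1 \<le> n}. ennreal (N (seed_vec smul s f d n n - seed_vec smul s f d m n)))"

definition seed_E_inf ::
  "('f::real_normed_field \<Rightarrow> 'a::ab_group_add \<Rightarrow> 'a) \<Rightarrow> ('a \<Rightarrow> real) \<Rightarrow> (nat \<Rightarrow> 'a) \<Rightarrow>
    (nat \<Rightarrow> 'f) \<Rightarrow> (nat \<Rightarrow> nat) \<Rightarrow> ennreal" where
  "seed_E_inf smul N s f d = (INF m. seed_E smul N s f d m)"

definition seed_seq ::
  "('f::real_normed_field \<Rightarrow> 'a::ab_group_add \<Rightarrow> 'a) \<Rightarrow> (nat \<Rightarrow> 'a) \<Rightarrow>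
    (nat \<Rightarrow> 'f) \<Rightarrow> (nat \<Rightarrow> nat) \<Rightarrow> (nat \<Rightarrow> nat) \<Rightarrow> nat \<Rightarrow> 'a" where
  "seed_seq smul s f d \<nu> k =
    (\<Sum>j<\<nu> k. smul (f j) (s ((\<Sum>i<k. \<nu> i) + position_perm d (\<nu> k) j)))"

text \<open>
  \<open>generated_by_seed smul N s f d B\<close>: \<open>B\<close> is a subsymmetric basic sequence generated by the seed
  \<open>(f, d)\<close>, where a seed generates only if \<open>f\<close> is nonzero and its \<open>E\<^sub>\<infinity>\<close> vanishes. All subsymmetric
  sequences of the form \<open>seed_seq smul s f d \<nu>\<close> with \<open>\<nu>\<close> increasing are then equivalent, so it does
  not matter that \<open>\<nu>\<close> is quantified existentially. The lengths \<open>\<nu> k\<close> are genuine lengths, not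
  shifted indices, hence the condition \<open>1 \<le> \<nu> k\<close>.
\<close>

definition generated_by_seed ::
  "('f::real_normed_field \<Rightarrow> 'a::ab_group_add \<Rightarrow> 'a) \<Rightarrow> ('a \<Rightarrow> real) \<Rightarrow> (nat \<Rightarrow> 'a) \<Rightarrow>
    (nat \<Rightarrow> 'f) \<Rightarrow> (nat \<Rightarrow> nat) \<Rightarrow> (nat \<Rightarrow> 'a) \<Rightarrow> bool" where
  "generated_by_seed smul N s f d B \<longleftrightarrow>
    positioning d \<and> f \<noteq> (\<lambda>_. 0) \<and> seed_E_inf smul N s f d = 0 \<and>
    basic_sequence smul N B \<and>
    (\<exists>\<nu>. strict_mono \<nu> \<and> (\<forall>k. 1 \<le> \<nu> k) \<and>
      subsymmetric_seq smul N (seed_seq smul s f d \<nu>) \<and>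
      equivalent_seqs smul N B (seed_seq smul s f d \<nu>))"

end

theory Submission
  imports Defs "HOL-Complex_Analysis.Great_Picard"
begin

text \<open>
  Passing to a subsequence along which all coordinates of \<open>B\<close> converge and taking differences gives, by
  unconditionality and subsymmetry, a sequence equivalent to \<open>B\<close> with coordinates tending to zero; this
  replaces weak convergence arguments, and a gliding hump makes \<open>B\<close> equivalent to a block basic
  sequence. The coefficients of each block are listed in decreasing absolute value. Along a further
  subsequence these lists converge to a sequence \<open>a\<close>, and the relative order of the positions of the
  first \<open>m\<close> of them stabilises for each \<open>m\<close>, which defines a positioning. If the tails of the blocks are
  uniformly small, truncated blocks are close to translates of the vectors of the seed, up to gaps, to
  which the norm is insensitive. Otherwise, if \<open>a\<close> tends to zero, large tails with small coefficients form the
  required uniformly null sequence; if \<open>a\<close> does not tend to zero, the basis is equivalent to that of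
  \<open>c\<^sub>0\<close>, so that \<open>B\<close> is equivalent to the basis itself.
\<close>

section \<open>Quasi-Banach spaces with a \<open>p\<close>-norm\<close>

text \<open>For \<open>p < 1\<close> neither duality nor convexity is at hand, and two devices
  replace them. Coordinates and partial sum projections are bounded directly: by a Baire argument
  for \<open>B\<close>, by averaging over sign changes for \<open>s\<close>. Replacing coefficients
  by smaller ones costs a fixed factor \<open>lattice_const\<close>. Equivalence only compares which
  series converge, so it follows from estimates on finite segments or from summable errors. The
  limit seed works because its quantities E_m are controlled by the tails of the blocks: for a fixed
  length, late blocks already show the limiting order, and a displacement that keeps the order is
  isometric. This needs block lengths tending to infinity, which the gliding hump enforces. Only the
  absolute values of the coefficients are made to converge; phases are removed by sign invariance.
  If \<open>a\<close> stays away from zero, its own E_infinity is positive, so another seed is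
  needed there, namely (1,0,0,...).\<close>

lemma strict_mono_choice:
  fixes P :: "nat \<Rightarrow> nat \<Rightarrow> bool"
  assumes "\<And>k M. \<exists>m>M. P k m"
  obtains \<phi> where "strict_mono \<phi>" "\<And>k. P k (\<phi> k)"
proof -
  have "\<exists>f. \<forall>n. P n (f n) \<and> f n < f (Suc n)"
  proof (rule dependent_nat_choice)
    show "\<exists>x. P 0 x" using assms[of 0 0] by blast
    show "\<exists>y. P (Suc n) y \<and> x < y" for x n using assms[of x "Suc n"] by blast
  qed
  then show ?thesis using that by (auto simp: strict_mono_Suc_iff)
qed

lemma tendsto_powr_zero:
  fixes f :: "'b \<Rightarrow> real"
  assumes "0 < p" "\<And>x. 0 \<le> f x" "(f \<longlongrightarrow> 0) F"
  shows "((\<lambda>x. f x powr p) \<longlongrightarrow> 0) F"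
proof -
  have "((\<lambda>x. f x powr p) \<longlongrightarrow> 0 powr p) F"
    by (rule tendsto_powr2[OF assms(3) tendsto_const]) (use assms in auto)
  then show ?thesis by simp
qed

locale p_banach_space = quasi_banach_space smul N
  for smul :: "'f::{real_normed_field, euclidean_space} \<Rightarrow> 'a::ab_group_add \<Rightarrow> 'a" and N +
  fixes p :: real
  assumes p_pos: "0 < p" and p_norm: "is_p_norm p N"
begin

text \<open>The p-th power is subadditive, so \<open>Np (x - y)\<close> is a translation-invariant
  metric with the same convergent sequences as \<open>N\<close>. All estimates are made for
  \<open>Np\<close>; scalars then act through \<open>norm c powr p\<close>.\<close>

definition Np :: "'a \<Rightarrow> real" where "Np x = N x powr p"

abbreviation psum :: "(nat \<Rightarrow> 'f) \<Rightarrow> (nat \<Rightarrow> 'a) \<Rightarrow> nat \<Rightarrow> 'a" where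
  "psum a x n \<equiv> (\<Sum>j<n. smul (a j) (x j))"

abbreviation conv :: "(nat \<Rightarrow> 'f) \<Rightarrow> (nat \<Rightarrow> 'a) \<Rightarrow> bool" where
  "conv a x \<equiv> \<exists>v. qsums smul N a x v"

lemma Np_nonneg [simp]: "0 \<le> Np x"
  by (simp add: Np_def)

lemma N_zero [simp]: "N 0 = 0"
  by (simp add: qnorm_eq_0_iff)

lemma Np_eq_0_iff [simp]: "Np x = 0 \<longleftrightarrow> x = 0"
  using p_pos by (simp add: Np_def qnorm_eq_0_iff)

lemma Np_zero [simp]: "Np 0 = 0"
  by simp

lemma Np_pos_iff: "0 < Np x \<longleftrightarrow> x \<noteq> 0"
  by (metis Np_eq_0_iff Np_nonneg less_eq_real_def less_irrefl)

lemma Np_scale: "Np (smul c x) = norm c powr p * Np x"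
  by (simp add: Np_def qnorm_scale powr_mult qnorm_nonneg)

lemma N_minus [simp]: "N (- x) = N x"
proof -
  have "- x = smul (-1) x" by (simp add: scale_minus_left)
  then show ?thesis by (simp only: qnorm_scale) simp
qed

lemma Np_minus [simp]: "Np (- x) = Np x"
  by (simp add: Np_def)

lemma Np_add: "Np (x + y) \<le> Np x + Np y"
  using p_norm by (simp add: Np_def is_p_norm_def)

lemma Np_diff: "Np (x - y) \<le> Np x + Np y"
  using Np_add[of x "- y"] by simp

lemma Np_minus_commute: "Np (x - y) = Np (y - x)"
  by (metis Np_minus minus_diff_eq)

lemma Np_triangle: "Np (x - z) \<le> Np (x - y) + Np (y - z)"
  using Np_add[of "x - y" "y - z"] by simp

lemma Np_le_diff: "Np x \<le> Np y + Np (x - y)"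
  using Np_add[of y "x - y"] by simp

lemma Np_sum: "Np (\<Sum>i\<in>F. x i) \<le> (\<Sum>i\<in>F. Np (x i))"
proof (induction F rule: infinite_finite_induct)
  case (insert i F)
  then show ?case using Np_add[of "x i" "sum x F"] by simp
qed auto

lemma Np_less_iff: "0 \<le> e \<Longrightarrow> Np x < e powr p \<longleftrightarrow> N x < e"
proof
  assume "0 \<le> e" "N x < e"
  then show "Np x < e powr p" unfolding Np_def using p_pos qnorm_nonneg by (intro powr_less_mono2) auto
next
  assume "0 \<le> e" "Np x < e powr p"
  then show "N x < e" unfolding Np_def using powr_mono2[of p e "N x"] p_pos by linarith
qed

lemma Np_le_iff: "0 \<le> e \<Longrightarrow> Np x \<le> e powr p \<longleftrightarrow> N x \<le> e"
proof
  assume "0 \<le> e" "N x \<le> e"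
  then show "Np x \<le> e powr p" unfolding Np_def using p_pos qnorm_nonneg by (intro powr_mono2) auto
next
  assume "0 \<le> e" "Np x \<le> e powr p"
  then show "N x \<le> e" unfolding Np_def using powr_less_mono2[of p e "N x"] p_pos by linarith
qed

lemma N_eq_Np: "N x = Np x powr (1 / p)"
  using p_pos by (simp add: Np_def powr_powr qnorm_nonneg)

lemma tendsto_N_iff: "((\<lambda>n. N (X n)) \<longlongrightarrow> 0) F \<longleftrightarrow> ((\<lambda>n. Np (X n)) \<longlongrightarrow> 0) F"
  using tendsto_powr_zero[of p "\<lambda>n. N (X n)" F] tendsto_powr_zero[of "1 / p" "\<lambda>n. Np (X n)" F]
    p_pos qnorm_nonneg by (auto simp: Np_def[symmetric] N_eq_Np[symmetric])

lemma Np_small_iff: "(\<forall>e>0. \<exists>w\<in>S. N (f w) < e) \<longleftrightarrow> (\<forall>e>0. \<exists>w\<in>S. Np (f w) < e)"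
proof safe
  fix e :: real assume H: "\<forall>e>0. \<exists>w\<in>S. N (f w) < e" and e: "e > 0"
  have "e powr (1 / p) > 0" using e by simp
  with H obtain w where w: "w \<in> S" "N (f w) < e powr (1 / p)" by blast
  then have "Np (f w) < (e powr (1 / p)) powr p" by (subst Np_less_iff) auto
  then show "\<exists>w\<in>S. Np (f w) < e" using p_pos e w by (auto simp: powr_powr)
next
  fix e :: real assume H: "\<forall>e>0. \<exists>w\<in>S. Np (f w) < e" and e: "e > 0"
  have "e powr p > 0" using e by simp
  with H obtain w where w: "w \<in> S" "Np (f w) < e powr p" by blast
  then have "N (f w) < e" using Np_less_iff[of e "f w"] e by simp
  then show "\<exists>w\<in>S. N (f w) < e" using w by blast
qed

lemma Np_complete:
  assumes "\<And>e. e > 0 \<Longrightarrow> \<exists>M. \<forall>m\<ge>M. \<forall>n\<ge>M. Np (X m - X n) < e"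
  shows "\<exists>l. (\<lambda>n. Np (X n - l)) \<longlonglongrightarrow> 0"
proof -
  have "\<exists>M. \<forall>m\<ge>M. \<forall>n\<ge>M. N (X m - X n) < e" if "e > 0" for e
    using assms[of "e powr p"] that by (simp only: Np_less_iff[OF less_imp_le[OF that]]) simp
  then obtain l where "(\<lambda>n. N (X n - l)) \<longlonglongrightarrow> 0" using qnorm_complete[of X] by blast
  then show ?thesis unfolding tendsto_N_iff by blast
qed

section \<open>Series: Cauchy criterion, perturbation, equivalence\<close>

lemma qsums_iff: "qsums smul N a x v \<longleftrightarrow> (\<lambda>n. Np (psum a x n - v)) \<longlonglongrightarrow> 0"
  by (simp add: qsums_def tendsto_N_iff)

lemma Np_limit_unique:
  assumes "(\<lambda>n. Np (X n - v)) \<longlonglongrightarrow> 0" "(\<lambda>n. Np (X n - w)) \<longlonglongrightarrow> 0"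
  shows "v = w"
proof -
  have "(\<lambda>n. Np (X n - v) + Np (X n - w)) \<longlonglongrightarrow> 0" using tendsto_add[OF assms] by simp
  moreover have "Np (v - w) \<le> Np (X n - v) + Np (X n - w)" for n
    using Np_triangle[of v w "X n"] Np_minus_commute[of v "X n"] by simp
  ultimately have "Np (v - w) \<le> 0" by (intro tendsto_lowerbound[where F=sequentially]) auto
  then show ?thesis by (metis Np_eq_0_iff Np_nonneg order_antisym right_minus_eq)
qed

lemma Np_limit_le:
  assumes "(\<lambda>n. Np (X n - v)) \<longlonglongrightarrow> 0" "\<forall>\<^sub>F n in sequentially. Np (X n) \<le> C"
  shows "Np v \<le> C"
proof -
  have "(\<lambda>n. C + Np (X n - v)) \<longlonglongrightarrow> C" using tendsto_add[OF tendsto_const assms(1)] by simp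
  moreover have "\<forall>\<^sub>F n in sequentially. Np v \<le> C + Np (X n - v)" using assms(2)
  proof eventually_elim
    case (elim n)
    then show ?case using Np_le_diff[of v "X n"] Np_minus_commute[of v "X n"] by simp
  qed
  ultimately show ?thesis by (intro tendsto_lowerbound[where F=sequentially]) auto
qed

lemma qsums_unique: "qsums smul N a x v \<Longrightarrow> qsums smul N a x w \<Longrightarrow> v = w"
  unfolding qsums_iff by (rule Np_limit_unique)

lemma qsums_add:
  assumes "qsums smul N a x v" "qsums smul N b x w"
  shows "qsums smul N (\<lambda>j. a j + b j) x (v + w)"
  unfolding qsums_iff
proof (rule tendsto_sandwich[OF _ _ tendsto_const])
  show "(\<lambda>n. Np (psum a x n - v) + Np (psum b x n - w)) \<longlonglongrightarrow> 0"
    using tendsto_add[OF assms[unfolded qsums_iff]] by simp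
  show "\<forall>\<^sub>F n in sequentially. Np (psum (\<lambda>j. a j + b j) x n - (v + w))
      \<le> Np (psum a x n - v) + Np (psum b x n - w)"
  proof (intro always_eventually allI)
    fix n
    have "psum (\<lambda>j. a j + b j) x n - (v + w) = (psum a x n - v) + (psum b x n - w)"
      by (simp add: scale_left_distrib sum.distrib algebra_simps)
    then show "Np (psum (\<lambda>j. a j + b j) x n - (v + w))
      \<le> Np (psum a x n - v) + Np (psum b x n - w)" by (simp only: Np_add)
  qed
qed auto

lemma qsums_scale:
  assumes "qsums smul N a x v"
  shows "qsums smul N (\<lambda>j. c * a j) x (smul c v)"
proof -
  have "psum (\<lambda>j. c * a j) x n - smul c v = smul c (psum a x n - v)" for n
    by (simp add: scale_right_diff_distrib scale_sum_right)
  then show ?thesis using tendsto_mult_left[OF assms[unfolded qsums_iff], of "norm c powr p"]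
    by (simp add: qsums_iff Np_scale)
qed

lemma qsums_diff:
  assumes "qsums smul N a x v" "qsums smul N b x w"
  shows "qsums smul N (\<lambda>j. a j - b j) x (v - w)"
  using qsums_add[OF assms(1) qsums_scale[OF assms(2), of "-1"]] by (simp add: scale_minus_left)

lemma qsums_finite:
  assumes "\<And>j. j \<ge> n \<Longrightarrow> a j = 0"
  shows "qsums smul N a x (psum a x n)"
proof -
  have "Np (psum a x m - psum a x n) = 0" if "m \<ge> n" for m
  proof -
    have "psum a x m = psum a x n"
      using that assms by (intro sum.mono_neutral_right) auto
    then show ?thesis by simp
  qed
  then have "\<forall>\<^sub>F m in sequentially. Np (psum a x m - psum a x n) = 0"
    by (rule eventually_sequentiallyI)
  then show ?thesis unfolding qsums_iff by (rule tendsto_eventually)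
qed

lemma psum_diff: "m \<le> n \<Longrightarrow> psum a x n - psum a x m = (\<Sum>j=m..<n. smul (a j) (x j))"
  by (metis atLeast0LessThan diff_add_eq sum_diff_nat_ivl le0 lessThan_atLeast0)

lemma Np_Cauchy_of_limit:
  assumes "(\<lambda>n. Np (X n - v)) \<longlonglongrightarrow> 0" "e > 0"
  shows "\<exists>M. \<forall>m\<ge>M. \<forall>n\<ge>M. Np (X n - X m) < e"
proof -
  obtain M where M: "\<forall>n\<ge>M. Np (X n - v) < e / 2"
    using assms order_tendstoD(2)[OF assms(1), of "e/2"] by (auto simp: eventually_sequentially)
  have "Np (X n - X m) < e" if "m \<ge> M" "n \<ge> M" for m n
  proof -
    have "Np (X n - X m) \<le> Np (X n - v) + Np (v - X m)" by (rule Np_triangle)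
    moreover have "Np (X n - v) < e / 2" "Np (X m - v) < e / 2" using M that by auto
    ultimately show ?thesis using Np_minus_commute[of v "X m"] by linarith
  qed
  then show ?thesis by blast
qed

lemma conv_iff_Cauchy:
  "conv a x \<longleftrightarrow> (\<forall>e>0. \<exists>M. \<forall>m\<ge>M. \<forall>n\<ge>m. Np (\<Sum>j=m..<n. smul (a j) (x j)) < e)"
proof (intro iffI allI impI)
  fix e :: real assume "conv a x" "e > 0"
  then obtain M where "\<forall>m\<ge>M. \<forall>n\<ge>M. Np (psum a x n - psum a x m) < e"
    using Np_Cauchy_of_limit[of "psum a x"] unfolding qsums_iff by blast
  then have "Np (\<Sum>j=m..<n. smul (a j) (x j)) < e" if "m \<ge> M" "n \<ge> m" for m n
    using that by (simp add: psum_diff[symmetric])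
  then show "\<exists>M. \<forall>m\<ge>M. \<forall>n\<ge>m. Np (\<Sum>j=m..<n. smul (a j) (x j)) < e" by blast
next
  assume H: "\<forall>e>0. \<exists>M. \<forall>m\<ge>M. \<forall>n\<ge>m. Np (\<Sum>j=m..<n. smul (a j) (x j)) < e"
  have "\<exists>l. (\<lambda>n. Np (psum a x n - l)) \<longlonglongrightarrow> 0"
  proof (rule Np_complete)
    fix e :: real assume "e > 0"
    with H obtain M where M: "\<forall>m\<ge>M. \<forall>n\<ge>m. Np (\<Sum>j=m..<n. smul (a j) (x j)) < e" by blast
    then have le: "Np (psum a x n - psum a x m) < e" if "m \<ge> M" "n \<ge> m" for m n
      using that by (simp add: psum_diff)
    have "Np (psum a x m - psum a x n) < e" if "m \<ge> M" "n \<ge> M" for m n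
      using le[of m n] le[of n m] that Np_minus_commute[of "psum a x m" "psum a x n"]
      by (cases "m \<le> n") auto
    then show "\<exists>M. \<forall>m\<ge>M. \<forall>n\<ge>M. Np (psum a x m - psum a x n) < e" by blast
  qed
  then show "conv a x" by (simp add: qsums_iff)
qed

text \<open>By the Cauchy criterion, uniform estimates on finite segments suffice; no operator
  between closed spans has to be built in order to compare two sequences.\<close>

lemma conv_transfer:
  assumes "conv a x"
    and le: "\<And>m n. Np (\<Sum>j=m..<n. smul (b j) (y j)) \<le> C * Np (\<Sum>j=m..<n. smul (a j) (x j))"
  shows "conv b y"
  unfolding conv_iff_Cauchy
proof (intro allI impI)
  fix e :: real assume e: "e > 0"
  have C: "0 < \<bar>C\<bar> + 1" by simp
  then obtain M where M: "\<forall>m\<ge>M. \<forall>n\<ge>m. Np (\<Sum>j=m..<n. smul (a j) (x j)) < e / (\<bar>C\<bar> + 1)"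
    using assms(1)[unfolded conv_iff_Cauchy] e by (meson divide_pos_pos)
  have "Np (\<Sum>j=m..<n. smul (b j) (y j)) < e" if "m \<ge> M" "n \<ge> m" for m n
  proof -
    have "Np (\<Sum>j=m..<n. smul (b j) (y j)) \<le> (\<bar>C\<bar> + 1) * Np (\<Sum>j=m..<n. smul (a j) (x j))"
      by (rule order_trans[OF le]) (intro mult_right_mono, auto)
    also have "\<dots> < (\<bar>C\<bar> + 1) * (e / (\<bar>C\<bar> + 1))"
      using M that C by (intro mult_strict_left_mono) auto
    finally show ?thesis using C by simp
  qed
  then show "\<exists>M. \<forall>m\<ge>M. \<forall>n\<ge>m. Np (\<Sum>j=m..<n. smul (b j) (y j)) < e" by blast
qed

lemma qsums_add_vectors:
  assumes "qsums smul N a x v" "qsums smul N a y w"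
  shows "qsums smul N a (\<lambda>j. x j + y j) (v + w)"
  unfolding qsums_iff
proof (rule tendsto_sandwich[OF _ _ tendsto_const])
  show "(\<lambda>n. Np (psum a x n - v) + Np (psum a y n - w)) \<longlonglongrightarrow> 0"
    using tendsto_add[OF assms[unfolded qsums_iff]] by simp
  show "\<forall>\<^sub>F n in sequentially. Np (psum a (\<lambda>j. x j + y j) n - (v + w))
      \<le> Np (psum a x n - v) + Np (psum a y n - w)"
  proof (intro always_eventually allI)
    fix n
    have "psum a (\<lambda>j. x j + y j) n - (v + w) = (psum a x n - v) + (psum a y n - w)"
      by (simp add: scale_right_distrib sum.distrib algebra_simps)
    then show "Np (psum a (\<lambda>j. x j + y j) n - (v + w))
      \<le> Np (psum a x n - v) + Np (psum a y n - w)" by (simp only: Np_add)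
  qed
qed auto

lemma conv_add_vectors:
  "conv a x \<Longrightarrow> conv a y \<Longrightarrow> conv a (\<lambda>j. x j + y j)"
  using qsums_add_vectors by blast

lemma conv_diff_vectors:
  assumes "conv a x" "conv a y" shows "conv a (\<lambda>j. x j - y j)"
proof -
  have "conv a (\<lambda>j. - y j)"
    by (rule conv_transfer[OF assms(2), where C=1]) (simp add: scale_minus_right sum_negf)
  then show ?thesis using conv_add_vectors[OF assms(1)] by fastforce
qed

lemma conv_of_summable:
  assumes "summable (\<lambda>j. Np (smul (a j) (x j)))"
  shows "conv a x"
  unfolding conv_iff_Cauchy
proof (intro allI impI)
  fix e :: real assume "e > 0"
  then obtain M where M: "\<forall>m\<ge>M. \<forall>n. norm (\<Sum>j=m..<n. Np (smul (a j) (x j))) < e"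
    using assms summable_Cauchy by blast
  have "Np (\<Sum>j=m..<n. smul (a j) (x j)) < e" if "m \<ge> M" for m n
  proof -
    have "Np (\<Sum>j=m..<n. smul (a j) (x j)) \<le> (\<Sum>j=m..<n. Np (smul (a j) (x j)))" by (rule Np_sum)
    also have "\<dots> < e" using M that by (auto simp: sum_nonneg)
    finally show ?thesis .
  qed
  then show "\<exists>M. \<forall>m\<ge>M. \<forall>n\<ge>m. Np (\<Sum>j=m..<n. smul (a j) (x j)) < e" by blast
qed

lemma conv_terms_null:
  assumes "conv a x" shows "(\<lambda>j. Np (smul (a j) (x j))) \<longlonglongrightarrow> 0"
proof (rule LIMSEQ_I)
  fix e :: real assume "e > 0"
  then obtain M where M: "\<forall>m\<ge>M. \<forall>n\<ge>m. Np (\<Sum>j=m..<n. smul (a j) (x j)) < e"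
    using assms unfolding conv_iff_Cauchy by blast
  have "Np (smul (a m) (x m)) < e" if "m \<ge> M" for m
    using M[rule_format, OF that, of "Suc m"] by simp
  then show "\<exists>M. \<forall>m\<ge>M. norm (Np (smul (a m) (x m)) - 0) < e" by auto
qed

lemma conv_coeff_bounded:
  assumes "conv a x" "\<delta> > 0" "\<forall>\<^sub>F j in sequentially. \<delta> \<le> Np (x j)"
  obtains K where "\<And>j. norm (a j) powr p \<le> K"
proof -
  have "\<forall>\<^sub>F j in sequentially. Np (smul (a j) (x j)) < 1"
    using conv_terms_null[OF assms(1)] by (rule order_tendstoD) simp
  then have "\<forall>\<^sub>F j in sequentially. norm (a j) powr p \<le> 1 / \<delta>" using assms(3)
  proof eventually_elim
    case (elim j)
    have "norm (a j) powr p * \<delta> \<le> norm (a j) powr p * Np (x j)"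
      using elim by (intro mult_left_mono) auto
    then show ?case using elim assms(2) by (simp add: Np_scale field_simps)
  qed
  then obtain J where J: "\<forall>j\<ge>J. norm (a j) powr p \<le> 1 / \<delta>" by (auto simp: eventually_sequentially)
  have "norm (a j) powr p \<le> 1 / \<delta> + (\<Sum>i<J. norm (a i) powr p)" for j
  proof (cases "j < J")
    case True
    then have "norm (a j) powr p \<le> (\<Sum>i<J. norm (a i) powr p)" by (intro member_le_sum) auto
    then show ?thesis using assms(2) by (simp add: add_increasing)
  next
    case False
    then show ?thesis using J by (auto intro!: add_increasing2 sum_nonneg)
  qed
  then show ?thesis using that by blast
qed

text \<open>The terms of a convergent series tend to zero and \<open>x\<close> is bounded away from
  zero, so the coefficients are bounded; the series of the differences \<open>x j - y j\<close> then
  converges absolutely with respect to \<open>Np\<close>.\<close>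

lemma conv_perturb:
  assumes "conv a x" "\<delta> > 0" "\<forall>\<^sub>F j in sequentially. \<delta> \<le> Np (x j)"
    and "summable (\<lambda>j. Np (x j - y j))"
  shows "conv a y"
proof -
  obtain K where K: "\<And>j. norm (a j) powr p \<le> K" using conv_coeff_bounded assms(1-3) by blast
  have "summable (\<lambda>j. Np (smul (a j) (x j - y j)))"
  proof (rule summable_comparison_test')
    show "summable (\<lambda>j. K * Np (x j - y j))" using assms(4) by (rule summable_mult)
    show "norm (Np (smul (a j) (x j - y j))) \<le> K * Np (x j - y j)" if "0 \<le> j" for j
      using K[of j] by (simp add: Np_scale mult_right_mono)
  qed
  then have "conv a (\<lambda>j. x j - y j)" by (rule conv_of_summable)
  then show ?thesis using conv_diff_vectors[OF assms(1)] by fastforce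
qed

text \<open>Small perturbation principle. Since equivalence only concerns convergence, the errors
  must be summable but their sum need not be small; \<open>y\<close> is bounded below from some
  index on, which makes \<open>conv_perturb\<close> usable in both directions.\<close>

lemma equivalent_perturb:
  assumes "\<delta> > 0" "\<And>j. \<delta> \<le> Np (x j)" "summable (\<lambda>j. Np (x j - y j))"
  shows "equivalent_seqs smul N x y"
proof -
  have ev: "\<forall>\<^sub>F j in sequentially. \<delta> / 2 \<le> Np (y j)"
  proof -
    have "\<forall>\<^sub>F j in sequentially. Np (x j - y j) < \<delta> / 2"
      using summable_LIMSEQ_zero[OF assms(3)] assms(1) by (intro order_tendstoD) auto
    then show ?thesis
    proof eventually_elim
      case (elim j)
      then show ?case using Np_le_diff[of "x j" "y j"] assms(2)[of j]
        by linarith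
    qed
  qed
  have "summable (\<lambda>j. Np (y j - x j))" using assms(3) by (simp add: Np_minus_commute)
  then show ?thesis unfolding equivalent_seqs_def
    using conv_perturb[of _ x \<delta> y] conv_perturb[of _ y "\<delta>/2" x] ev assms by (meson always_eventually half_gt_zero)
qed

lemma equivalent_sym: "equivalent_seqs smul N x y \<Longrightarrow> equivalent_seqs smul N y x"
  by (simp add: equivalent_seqs_def)

lemma equivalent_trans [trans]:
  "equivalent_seqs smul N x y \<Longrightarrow> equivalent_seqs smul N y z \<Longrightarrow> equivalent_seqs smul N x z"
  by (simp add: equivalent_seqs_def)

lemma equivalent_of_Np_eq:
  assumes "\<And>a m n. Np (\<Sum>j=m..<n. smul (a j) (x j)) = Np (\<Sum>j=m..<n. smul (a j) (y j))"
  shows "equivalent_seqs smul N x y"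
  unfolding equivalent_seqs_def
  using conv_transfer[of _ x _ y 1] conv_transfer[of _ y _ x 1] assms by fastforce

text \<open>Turns a series along a subsequence into a series over the whole sequence, see
  \<open>conv_spread\<close>. This is how equivalence passes to subsequences and how
  unconditionality of the whole sequence is applied to a part of it.\<close>

definition spread :: "(nat \<Rightarrow> nat) \<Rightarrow> (nat \<Rightarrow> 'f) \<Rightarrow> nat \<Rightarrow> 'f" where
  "spread \<phi> a j = (if j \<in> range \<phi> then a (inv \<phi> j) else 0)"

lemma spread_apply [simp]: "strict_mono \<phi> \<Longrightarrow> spread \<phi> a (\<phi> k) = a k"
  by (simp add: spread_def strict_mono_imp_inj_on)

lemma sum_spread:
  assumes "strict_mono \<phi>" "finite I"
  shows "(\<Sum>j\<in>I. smul (spread \<phi> a j) (x j)) = (\<Sum>k\<in>\<phi> -` I. smul (a k) (x (\<phi> k)))"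
proof -
  have inj: "inj \<phi>" using assms(1) by (rule strict_mono_imp_inj_on)
  have "(\<Sum>j\<in>I. smul (spread \<phi> a j) (x j)) = (\<Sum>j\<in>\<phi> ` (\<phi> -` I). smul (spread \<phi> a j) (x j))"
    using assms(2) by (intro sum.mono_neutral_right) (auto simp: spread_def)
  also have "\<dots> = (\<Sum>k\<in>\<phi> -` I. smul (a k) (x (\<phi> k)))"
    using assms(1) inj by (subst sum.reindex) (auto intro: inj_on_subset)
  finally show ?thesis .
qed

text \<open>\<open>k\<close> and \<open>l\<close> are the first indices whose images reach
  \<open>m\<close> and \<open>n\<close>. The second clause serves the Cauchy criterion: a segment
  starting at \<open>\<phi> M\<close> or later pulls back to one starting at \<open>M\<close> or
  later.\<close>

lemma vimage_strict_mono_ivl: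
  fixes \<phi> :: "nat \<Rightarrow> nat"
  assumes "strict_mono \<phi>"
  obtains k l where "\<phi> -` {m..<n} = {k..<l}" "k \<ge> M \<or> m < \<phi> M"
proof -
  define k where "k = (LEAST k. m \<le> \<phi> k)"
  define l where "l = (LEAST l. n \<le> \<phi> l)"
  have ex: "\<exists>k. i \<le> \<phi> k" for i using assms strict_mono_imp_increasing by blast
  have k: "m \<le> \<phi> i \<longleftrightarrow> k \<le> i" for i
    unfolding k_def using ex[of m] assms
    by (meson LeastI_ex Least_le le_trans strict_mono_less_eq)
  have l: "n \<le> \<phi> i \<longleftrightarrow> l \<le> i" for i
    unfolding l_def using ex[of n] assms
    by (meson LeastI_ex Least_le le_trans strict_mono_less_eq)
  show ?thesis
  proof (rule that)
    show "\<phi> -` {m..<n} = {k..<l}" using k l by (auto simp: not_le[symmetric])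
    show "k \<ge> M \<or> m < \<phi> M" using k[of k] assms by (metis linorder_not_le order_refl le_less_trans strict_mono_less)
  qed
qed

lemma conv_spread:
  assumes "strict_mono \<phi>"
  shows "conv (spread \<phi> a) x \<longleftrightarrow> conv a (x \<circ> \<phi>)"
proof
  assume c: "conv (spread \<phi> a) x"
  show "conv a (x \<circ> \<phi>)" unfolding conv_iff_Cauchy
  proof (intro allI impI)
    fix e :: real assume "e > 0"
    then obtain M where M: "\<forall>m\<ge>M. \<forall>n\<ge>m. Np (\<Sum>j=m..<n. smul (spread \<phi> a j) (x j)) < e"
      using c unfolding conv_iff_Cauchy by blast
    have "Np (\<Sum>j=m..<n. smul (a j) ((x \<circ> \<phi>) j)) < e" if "m \<ge> M" "n \<ge> m" for m n
    proof -
      have "\<phi> -` {\<phi> m..<\<phi> n} = {m..<n}"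
        using assms by (auto simp: strict_mono_less strict_mono_less_eq)
      then have "(\<Sum>j=m..<n. smul (a j) ((x \<circ> \<phi>) j)) = (\<Sum>j=\<phi> m..<\<phi> n. smul (spread \<phi> a j) (x j))"
        using sum_spread[OF assms, of "{\<phi> m..<\<phi> n}" a x] by simp
      moreover have "\<phi> m \<ge> M" using that strict_mono_imp_increasing[OF assms, of m] by simp
      ultimately show ?thesis using M assms that by (simp add: strict_mono_less_eq)
    qed
    then show "\<exists>M. \<forall>m\<ge>M. \<forall>n\<ge>m. Np (\<Sum>j=m..<n. smul (a j) ((x \<circ> \<phi>) j)) < e" by blast
  qed
next
  assume c: "conv a (x \<circ> \<phi>)"
  show "conv (spread \<phi> a) x" unfolding conv_iff_Cauchy
  proof (intro allI impI)
    fix e :: real assume e: "e > 0"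
    then obtain M where M: "\<forall>m\<ge>M. \<forall>n\<ge>m. Np (\<Sum>j=m..<n. smul (a j) ((x \<circ> \<phi>) j)) < e"
      using c unfolding conv_iff_Cauchy by blast
    have "Np (\<Sum>j=m..<n. smul (spread \<phi> a j) (x j)) < e" if "m \<ge> \<phi> M" for m n
    proof -
      obtain k l where kl: "\<phi> -` {m..<n} = {k..<l}" "k \<ge> M \<or> m < \<phi> M"
        by (rule vimage_strict_mono_ivl[OF assms])
      then have "k \<ge> M" using that by auto
      then show ?thesis using M e sum_spread[OF assms, of "{m..<n}" a x] kl
        by (cases "k \<le> l") auto
    qed
    then show "\<exists>M. \<forall>m\<ge>M. \<forall>n\<ge>m. Np (\<Sum>j=m..<n. smul (spread \<phi> a j) (x j)) < e" by blast
  qed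
qed

lemma equivalent_subseq:
  assumes "equivalent_seqs smul N x y" "strict_mono \<phi>"
  shows "equivalent_seqs smul N (x \<circ> \<phi>) (y \<circ> \<phi>)"
  using assms conv_spread[OF assms(2)] unfolding equivalent_seqs_def by metis

lemma qsums_psum_bounded:
  assumes "qsums smul N a x v"
  obtains K where "\<And>n. Np (psum a x n) \<le> K"
proof -
  have "Bseq (\<lambda>n. Np (psum a x n - v))"
    using assms unfolding qsums_iff by (intro convergent_imp_Bseq convergentI)
  then obtain K where K: "\<And>n. norm (Np (psum a x n - v)) \<le> K"
    unfolding Bseq_def by blast
  have "Np (psum a x n) \<le> Np v + K" for n
    using Np_le_diff[of "psum a x n" v] K[of n] by simp
  then show ?thesis using that by blast
qed

section \<open>Closed spans and expansions in basic sequences\<close>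

lemma closed_span_iff:
  "v \<in> closed_span smul N x \<longleftrightarrow> (\<forall>e>0. \<exists>w\<in>span (range x). Np (v - w) < e)"
  by (simp add: closed_span_def Np_small_iff)

lemma span_in_closed_span: "v \<in> span (range x) \<Longrightarrow> v \<in> closed_span smul N x"
  unfolding closed_span_iff by (intro allI impI bexI[of _ v]) auto

lemma closed_span_limit:
  assumes "\<And>n. X n \<in> closed_span smul N x" "(\<lambda>n. Np (X n - l)) \<longlonglongrightarrow> 0"
  shows "l \<in> closed_span smul N x"
  unfolding closed_span_iff
proof (intro allI impI)
  fix e :: real assume e: "e > 0"
  have "\<forall>\<^sub>F n in sequentially. Np (X n - l) < e / 2"
    using assms(2) e by (intro order_tendstoD) auto
  then obtain n where n: "Np (X n - l) < e / 2" by (auto simp: eventually_sequentially)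
  obtain w where w: "w \<in> span (range x)" "Np (X n - w) < e / 2"
    using assms(1)[of n] e unfolding closed_span_iff by (meson half_gt_zero)
  have "Np (l - w) \<le> Np (l - X n) + Np (X n - w)" by (rule Np_triangle)
  then have "Np (l - w) < e" using n w Np_minus_commute[of l "X n"] by linarith
  then show "\<exists>w\<in>span (range x). Np (l - w) < e" using w by blast
qed

lemma closed_span_add:
  assumes "u \<in> closed_span smul N x" "v \<in> closed_span smul N x"
  shows "u + v \<in> closed_span smul N x"
  unfolding closed_span_iff
proof (intro allI impI)
  fix e :: real assume e: "e > 0"
  obtain w where w: "w \<in> span (range x)" "Np (u - w) < e / 2"
    using assms(1) e unfolding closed_span_iff by (meson half_gt_zero)
  obtain w' where w': "w' \<in> span (range x)" "Np (v - w') < e / 2"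
    using assms(2) e unfolding closed_span_iff by (meson half_gt_zero)
  have "Np (u + v - (w + w')) < e"
    using Np_add[of "u - w" "v - w'"] w w' by (simp add: algebra_simps)
  then show "\<exists>w\<in>span (range x). Np (u + v - w) < e" using w w' span_add by blast
qed

lemma closed_span_scale:
  assumes "u \<in> closed_span smul N x"
  shows "smul c u \<in> closed_span smul N x"
  unfolding closed_span_iff
proof (intro allI impI)
  fix e :: real assume e: "e > 0"
  define C where "C = norm c powr p + 1"
  have C: "C > 0" by (simp add: C_def add_nonneg_pos)
  obtain w where w: "w \<in> span (range x)" "Np (u - w) < e / C"
    using assms e C unfolding closed_span_iff by (meson divide_pos_pos)
  have "Np (smul c u - smul c w) = norm c powr p * Np (u - w)"
    by (simp only: scale_right_diff_distrib[symmetric] Np_scale)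
  also have "\<dots> \<le> C * Np (u - w)" by (simp add: C_def mult_right_mono)
  also have "\<dots> < e" using w(2) C by (simp add: pos_less_divide_eq mult.commute)
  finally show "\<exists>w\<in>span (range x). Np (smul c u - w) < e" using w span_scale by blast
qed

lemma closed_span_diff:
  assumes "u \<in> closed_span smul N x" "v \<in> closed_span smul N x"
  shows "u - v \<in> closed_span smul N x"
  using closed_span_add[OF assms(1) closed_span_scale[OF assms(2), of "-1"]] by (simp add: scale_minus_left)

lemma psum_in_span: "psum a x n \<in> span (range x)"
  by (intro span_sum span_scale span_base) auto

lemma qsums_in_closed_span: "qsums smul N a x v \<Longrightarrow> v \<in> closed_span smul N x"
  unfolding qsums_iff by (rule closed_span_limit[OF span_in_closed_span[OF psum_in_span]])

lemma zero_in_closed_span: "0 \<in> closed_span smul N x"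
  by (intro span_in_closed_span span_zero)

lemma basic_sequence_qsums_exists:
  "basic_sequence smul N b \<Longrightarrow> v \<in> closed_span smul N b \<Longrightarrow> \<exists>a. qsums smul N a b v"
  unfolding basic_sequence_def schauder_basis_of_def by blast

lemma basic_sequence_coeffs_unique:
  assumes "basic_sequence smul N b" "qsums smul N a b v" "qsums smul N a' b v"
  shows "a = a'"
  using assms qsums_in_closed_span[OF assms(2)] unfolding basic_sequence_def schauder_basis_of_def by blast

lemma basic_sequence_nonzero:
  assumes "basic_sequence smul N b" shows "b k \<noteq> 0"
proof
  assume 0: "b k = 0"
  have "qsums smul N (\<lambda>_. 0) b 0" using qsums_finite[of 0 "\<lambda>_. 0" b] by simp
  moreover have "qsums smul N (\<lambda>j. if j = k then 1 else 0) b (\<Sum>j<Suc k. smul (if j = k then 1 else 0) (b j))"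
    by (rule qsums_finite) auto
  moreover have "(\<Sum>j<Suc k. smul (if j = k then 1 else 0) (b j)) = 0"
    using 0 by (intro sum.neutral) auto
  ultimately have "(\<lambda>_. 0) = (\<lambda>j. if j = k then 1 else (0::'f))"
    using basic_sequence_coeffs_unique[OF assms] by metis
  then show False by (metis zero_neq_one)
qed

section \<open>The open mapping argument and its consequences\<close>

lemma closed_span_complete: "Metric_space.mcomplete (closed_span smul N x) (\<lambda>u v. Np (u - v))"
proof -
  interpret Y: Metric_space "closed_span smul N x" "\<lambda>u v. Np (u - v)"
    by unfold_locales (auto simp: Np_minus_commute Np_triangle)
  show ?thesis unfolding Y.mcomplete_def
  proof (intro allI impI)
    fix \<sigma> assume c: "Y.MCauchy \<sigma>"
    have "\<exists>l. (\<lambda>n. Np (\<sigma> n - l)) \<longlonglongrightarrow> 0"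
    proof (rule Np_complete)
      fix e :: real assume "e > 0"
      then show "\<exists>M. \<forall>m\<ge>M. \<forall>n\<ge>M. Np (\<sigma> m - \<sigma> n) < e"
        using c unfolding Y.MCauchy_def by meson
    qed
    then obtain l where l: "(\<lambda>n. Np (\<sigma> n - l)) \<longlonglongrightarrow> 0" by blast
    have in_Y: "\<sigma> n \<in> closed_span smul N x" for n using c unfolding Y.MCauchy_def by blast
    have "l \<in> closed_span smul N x" using closed_span_limit in_Y l by blast
    moreover have "\<exists>M. \<forall>n\<ge>M. Np (\<sigma> n - l) < e" if "e > 0" for e
      using order_tendstoD(2)[OF l that] by (simp add: eventually_sequentially)
    ultimately have "limitin Y.mtopology \<sigma> l sequentially"
      using in_Y by (simp add: Y.limit_metric_sequentially)
    then show "\<exists>l. limitin Y.mtopology \<sigma> l sequentially" by blast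
  qed
qed

text \<open>The image in the closed span of a ball of the coefficient space whose norm is the
  supremum of the partial sums in \<open>b\<close> and \<open>z\<close> together. The open mapping
  argument is run with these images, so that the coefficient space itself is never
  introduced.\<close>

definition psum_ball :: "(nat \<Rightarrow> 'a) \<Rightarrow> (nat \<Rightarrow> 'a) \<Rightarrow> real \<Rightarrow> 'a set" where
  "psum_ball b z r =
    {v. \<exists>a. qsums smul N a b v \<and> (\<forall>n. Np (psum a b n) \<le> r \<and> Np (psum a z n) \<le> r)}"

lemma psum_ball_diff:
  assumes "u \<in> psum_ball b z r" "v \<in> psum_ball b z t"
  shows "u - v \<in> psum_ball b z (r + t)"
proof -
  obtain a c where a: "qsums smul N a b u" "\<And>n. Np (psum a b n) \<le> r" "\<And>n. Np (psum a z n) \<le> r"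
    and c: "qsums smul N c b v" "\<And>n. Np (psum c b n) \<le> t" "\<And>n. Np (psum c z n) \<le> t"
    using assms unfolding psum_ball_def by blast
  have "psum (\<lambda>j. a j - c j) x n = psum a x n - psum c x n" for x n
    by (simp add: scale_left_diff_distrib sum_subtractf)
  then have "Np (psum (\<lambda>j. a j - c j) b n) \<le> r + t" "Np (psum (\<lambda>j. a j - c j) z n) \<le> r + t" for n
    using Np_diff[of "psum a b n" "psum c b n"] Np_diff[of "psum a z n" "psum c z n"]
      a(2,3)[of n] c(2,3)[of n] by auto
  then show ?thesis using qsums_diff[OF a(1) c(1)] unfolding psum_ball_def by blast
qed

lemma psum_ball_scale:
  assumes "u \<in> psum_ball b z r"
  shows "smul c u \<in> psum_ball b z (norm c powr p * r)"
proof -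
  obtain a where a: "qsums smul N a b u" "\<And>n. Np (psum a b n) \<le> r" "\<And>n. Np (psum a z n) \<le> r"
    using assms unfolding psum_ball_def by blast
  have "psum (\<lambda>j. c * a j) x n = smul c (psum a x n)" for x n
    by (simp add: scale_sum_right)
  then have "Np (psum (\<lambda>j. c * a j) b n) \<le> norm c powr p * r"
    "Np (psum (\<lambda>j. c * a j) z n) \<le> norm c powr p * r" for n
    using a(2,3)[of n] by (auto simp: Np_scale mult_left_mono)
  then show ?thesis using qsums_scale[OF a(1)] unfolding psum_ball_def by blast
qed

lemma psum_ball_subset: "psum_ball b z r \<subseteq> closed_span smul N b"
  unfolding psum_ball_def using qsums_in_closed_span by blast

text \<open>The Baire half of the open mapping theorem. Convergent series have bounded partial sums,
  so the balls of integer radius cover the closed span and the closure of one of them has interior.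
  Differences move that interior to the origin, and scaling gives all radii.\<close>

lemma psum_ball_approx:
  assumes basic: "basic_sequence smul N b"
    and conv: "\<And>a. conv a b \<Longrightarrow> conv a z"
  obtains \<kappa> where "\<kappa> > 0" "\<And>u t e. u \<in> closed_span smul N b \<Longrightarrow> Np u < t \<Longrightarrow> e > 0 \<Longrightarrow>
    \<exists>x\<in>psum_ball b z (\<kappa> * t). Np (u - x) < e"
proof -
  let ?Y = "closed_span smul N b" and ?V = "psum_ball b z"
  interpret Y: Metric_space ?Y "\<lambda>u v. Np (u - v)"
    by unfold_locales (auto simp: Np_minus_commute Np_triangle)
  have cover: "v \<in> (\<Union>r::nat. Y.mtopology closure_of ?V (real r))" if v: "v \<in> ?Y" for v
  proof -
    obtain a where a: "qsums smul N a b v" using basic_sequence_qsums_exists[OF basic v] by blast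
    obtain w where w: "qsums smul N a z w" using conv a by blast
    obtain K where K: "\<And>n. Np (psum a b n) \<le> K" by (rule qsums_psum_bounded[OF a]) blast
    obtain L where L: "\<And>n. Np (psum a z n) \<le> L" by (rule qsums_psum_bounded[OF w]) blast
    obtain r :: nat where "max K L \<le> real r" using real_arch_simple by blast
    then have "v \<in> ?V (real r)"
      unfolding psum_ball_def using a K L by (auto intro: order_trans)
    moreover have "?V (real r) \<subseteq> Y.mtopology closure_of ?V (real r)"
      using psum_ball_subset by (intro closure_of_subset) simp
    ultimately show ?thesis by blast
  qed
  have "\<exists>r::nat. Y.mtopology interior_of (Y.mtopology closure_of ?V (real r)) \<noteq> {}"
  proof (rule ccontr)
    assume "\<not> ?thesis"
    then have "Y.mtopology interior_of (\<Union>(range (\<lambda>r::nat. Y.mtopology closure_of ?V (real r)))) = {}"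
      by (intro Y.metric_Baire_category_alt closed_span_complete) auto
    moreover have "(\<Union>(range (\<lambda>r::nat. Y.mtopology closure_of ?V (real r)))) = ?Y"
      using cover closure_of_subset_topspace[of Y.mtopology] by auto
    ultimately show False
      using zero_in_closed_span[of b] by (metis Y.topspace_mtopology empty_iff interior_of_topspace)
  qed
  then obtain r :: nat and v0 \<rho> where v0: "v0 \<in> ?Y" and \<rho>: "\<rho> > 0"
    and sub: "Y.mball v0 \<rho> \<subseteq> Y.mtopology closure_of ?V (real r)"
    unfolding Y.metric_interior_of by blast
  have near: "\<exists>x\<in>?V (real r). Np (v - x) < e" if "v \<in> ?Y" "Np (v0 - v) < \<rho>" "e > 0" for v e
  proof -
    have "v \<in> Y.mtopology closure_of ?V (real r)" using sub that v0 by auto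
    then show ?thesis unfolding Y.metric_closure_of using that(3) by auto
  qed
  have step: "\<exists>x\<in>?V (2 * real r). Np (u - x) < e" if u: "u \<in> ?Y" "Np u < \<rho>" and e: "e > 0" for u e
  proof -
    obtain x where x: "x \<in> ?V (real r)" "Np (v0 + u - x) < e / 2"
      using near[of "v0 + u" "e/2"] closed_span_add[OF v0 u(1)] u e by (auto simp: Np_minus_commute)
    obtain y where y: "y \<in> ?V (real r)" "Np (v0 - y) < e / 2"
      using near[of v0 "e/2"] v0 \<rho> e by auto
    have "x - y \<in> ?V (2 * real r)" using psum_ball_diff[OF x(1) y(1)] by simp
    moreover have "Np (u - (x - y)) < e"
      using Np_diff[of "v0 + u - x" "v0 - y"] x(2) y(2) by (simp add: algebra_simps)
    ultimately show ?thesis by blast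
  qed
  \<comment> \<open>The factor 2 comes from taking differences; \<open>+ 1\<close> keeps the
    constant positive when \<open>r\<close> is 0.\<close>
  show ?thesis
  proof (rule that[of "2 * (real r + 1) / \<rho>"])
    show "2 * (real r + 1) / \<rho> > 0" using \<rho> by simp
    fix u t e assume u: "u \<in> ?Y" "Np u < t" and e: "(e :: real) > 0"
    have t: "t > 0" using u(2) Np_nonneg[of u] by linarith
    \<comment> \<open>Dividing by \<open>c\<close> divides \<open>Np\<close> by
      \<open>t / \<rho>\<close>, which brings \<open>u\<close> within the radius \<rho> for which
      \<open>step\<close> holds.\<close>
    define c where "c = (t / \<rho>) powr (1 / p)"
    have c: "c > 0" "c powr p = t / \<rho>" using t \<rho> p_pos by (auto simp: c_def powr_powr)
    let ?c = "of_real c :: 'f"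
    have "norm (inverse ?c) powr p = inverse (t / \<rho>)"
      using c by (simp add: norm_inverse inverse_powr)
    then have "Np (smul (inverse ?c) u) = Np u / (t / \<rho>)"
      by (simp only: Np_scale) (simp add: field_simps)
    also have "\<dots> < \<rho>" using u(2) t \<rho> by (simp add: field_simps)
    finally obtain x where x: "x \<in> ?V (2 * real r)" "Np (smul (inverse ?c) u - x) < e / (t / \<rho>)"
      using step[of "smul (inverse ?c) u" "e / (t / \<rho>)"] closed_span_scale[OF u(1)] t \<rho> e by auto
    have "smul ?c x \<in> ?V (t / \<rho> * (2 * real r))"
      using psum_ball_scale[OF x(1), of ?c] c by simp
    moreover have "t / \<rho> * (2 * real r) \<le> 2 * (real r + 1) / \<rho> * t" using t \<rho> by (simp add: field_simps)
    ultimately have "smul ?c x \<in> ?V (2 * (real r + 1) / \<rho> * t)"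
      unfolding psum_ball_def by (blast intro: order_trans)
    moreover have "Np (u - smul ?c x) < e"
    proof -
      have "u - smul ?c x = smul ?c (smul (inverse ?c) u - x)"
        using c by (simp add: scale_right_diff_distrib)
      then have "Np (u - smul ?c x) = t / \<rho> * Np (smul (inverse ?c) u - x)"
        using c by (simp only: Np_scale) simp
      also have "\<dots> < e" using x(2) t \<rho> by (simp add: field_simps)
      finally show ?thesis .
    qed
    ultimately show "\<exists>x\<in>?V (2 * (real r + 1) / \<rho> * t). Np (u - x) < e" by blast
  qed
qed

lemma qsums_sum:
  assumes "\<And>i. i < (I::nat) \<Longrightarrow> qsums smul N (A i) x (w i)"
  shows "qsums smul N (\<lambda>j. \<Sum>i<I. A i j) x (\<Sum>i<I. w i)"
  using assms
proof (induction I)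
  case 0
  then show ?case using qsums_finite[of 0 "\<lambda>_. 0" x] by simp
next
  case (Suc I)
  then show ?case using qsums_add[of "\<lambda>j. \<Sum>i<I. A i j" x _ "A I"] by simp
qed

lemma sum_half_powers_le: "(\<Sum>i=I..<J. C / 2 ^ i) \<le> 2 * C / 2 ^ I" if "0 \<le> (C::real)"
proof (cases "I \<le> J")
  case True
  then have "(\<Sum>i=I..<J. C / 2 ^ i) = 2 * C / 2 ^ I - 2 * C / 2 ^ J"
  proof (induction J rule: dec_induct)
    case (step n)
    have "(\<Sum>i=I..<Suc n. C / 2 ^ i) = 2 * C / 2 ^ I - 2 * C / 2 ^ n + C / 2 ^ n"
      using step by simp
    then show ?case by simp
  qed simp
  then show ?thesis using that by simp
qed (use that in auto)

text \<open>The open mapping theorem for the space of coefficient sequences: applied with \<open>z = b\<close> it bounds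
  the partial sum projections of a basic sequence.\<close>

theorem basic_sequence_psum_bounded:
  assumes basic: "basic_sequence smul N b"
    and conv: "\<And>a. conv a b \<Longrightarrow> conv a z"
  obtains C where "C > 0" "\<And>a v n. qsums smul N a b v \<Longrightarrow> Np (psum a b n) \<le> C * Np v"
    "\<And>a v n. qsums smul N a b v \<Longrightarrow> Np (psum a z n) \<le> C * Np v"
proof -
  let ?Y = "closed_span smul N b" and ?V = "psum_ball b z"
  obtain \<kappa> where \<kappa>: "\<kappa> > 0" and approx: "\<And>u t e. u \<in> ?Y \<Longrightarrow> Np u < t \<Longrightarrow> e > 0 \<Longrightarrow>
    \<exists>x\<in>?V (\<kappa> * t). Np (u - x) < e"
    using psum_ball_approx[OF basic conv] by blast
  have bound: "Np (psum a b n) \<le> 2 * \<kappa> * \<tau> \<and> Np (psum a z n) \<le> 2 * \<kappa> * \<tau>"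
    if a: "qsums smul N a b v" and \<tau>: "Np v < \<tau>" for a v n \<tau>
  proof -
    have vY: "v \<in> ?Y" using a by (rule qsums_in_closed_span)
    have \<tau>0: "\<tau> > 0" using \<tau> Np_nonneg[of v] by linarith
    \<comment> \<open>Successive approximation: \<open>u i\<close> is what is left of
      \<open>v\<close> after \<open>i\<close> corrections, and each correction comes from a ball of
      half the previous radius.\<close>
    have "\<exists>u. \<forall>i. (u i \<in> ?Y \<and> Np (u i) < \<tau> / 2 ^ i \<and> (i = 0 \<longrightarrow> u i = v)) \<and>
        u i - u (Suc i) \<in> ?V (\<kappa> * \<tau> / 2 ^ i)"
    proof (rule dependent_nat_choice)
      show "\<exists>u. u \<in> ?Y \<and> Np u < \<tau> / 2 ^ 0 \<and> (0 = (0::nat) \<longrightarrow> u = v)" using vY \<tau> by auto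
      fix u and i :: nat
      assume u: "u \<in> ?Y \<and> Np u < \<tau> / 2 ^ i \<and> (i = 0 \<longrightarrow> u = v)"
      then obtain x where x: "x \<in> ?V (\<kappa> * (\<tau> / 2 ^ i))" "Np (u - x) < \<tau> / 2 ^ Suc i"
        using approx[of u "\<tau> / 2 ^ i" "\<tau> / 2 ^ Suc i"] \<tau>0 by auto
      moreover have "x \<in> ?Y" using x(1) psum_ball_subset by blast
      ultimately show "\<exists>u'. (u' \<in> ?Y \<and> Np u' < \<tau> / 2 ^ Suc i \<and> (Suc i = 0 \<longrightarrow> u' = v)) \<and>
          u - u' \<in> ?V (\<kappa> * \<tau> / 2 ^ i)"
        using u closed_span_diff by (intro exI[of _ "u - x"]) simp
    qed
    then obtain u where u: "\<And>i. u i \<in> ?Y" "\<And>i. Np (u i) < \<tau> / 2 ^ i" "u 0 = v"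
      "\<And>i. u i - u (Suc i) \<in> ?V (\<kappa> * \<tau> / 2 ^ i)" by blast
    define T where "T i = \<kappa> * \<tau> / 2 ^ i" for i :: nat
    have "\<exists>A. \<forall>i. qsums smul N (A i) b (u i - u (Suc i)) \<and>
        (\<forall>n. Np (psum (A i) b n) \<le> T i \<and> Np (psum (A i) z n) \<le> T i)"
      using u(4) unfolding psum_ball_def T_def by (intro choice) blast
    then obtain A where A: "\<And>i. qsums smul N (A i) b (u i - u (Suc i))"
      "\<And>i n. Np (psum (A i) b n) \<le> T i" "\<And>i n. Np (psum (A i) z n) \<le> T i" by blast
    \<comment> \<open>The p-th powers of the coefficients decay like \<open>(1 / 2) ^ i\<close>,
      hence the coefficients themselves like \<open>q ^ i\<close>, and they can be summed in the
      scalar field.\<close>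
    have summ: "summable (\<lambda>i. A i k)" for k
    proof (rule summable_comparison_test')
      define q :: real where "q = (1 / 2) powr (1 / p)"
      have q: "0 \<le> q" "q < 1" using p_pos powr_less_mono2[of "1 / p" "1 / 2" 1] by (auto simp: q_def)
      have bk: "Np (b k) > 0" using basic_sequence_nonzero[OF basic] by (simp add: Np_pos_iff)
      show "summable (\<lambda>i. (2 * \<kappa> * \<tau> / Np (b k)) powr (1 / p) * q ^ i)"
        using q by (intro summable_mult summable_geometric) auto
      fix i :: nat
      have "smul (A i k) (b k) = psum (A i) b (Suc k) - psum (A i) b k" by simp
      then have "Np (smul (A i k) (b k)) \<le> 2 * T i"
        using Np_diff[of "psum (A i) b (Suc k)" "psum (A i) b k"] A(2)[of i "Suc k"] A(2)[of i k] by simp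
      then have "norm (A i k) powr p \<le> (2 * \<kappa> * \<tau> / Np (b k)) * (1 / 2) ^ i"
        using bk by (simp add: Np_scale T_def field_simps)
      then have "(norm (A i k) powr p) powr (1 / p) \<le> ((2 * \<kappa> * \<tau> / Np (b k)) * (1 / 2) ^ i) powr (1 / p)"
        using p_pos by (intro powr_mono2) auto
      also have "\<dots> = (2 * \<kappa> * \<tau> / Np (b k)) powr (1 / p) * ((1 / 2) ^ i) powr (1 / p)"
        using \<kappa> \<tau>0 by (subst powr_mult) auto
      also have "((1 / 2) ^ i) powr (1 / p) = q ^ i"
        unfolding q_def by (simp add: powr_realpow[symmetric] powr_powr mult.commute)
      finally show "norm (A i k) \<le> (2 * \<kappa> * \<tau> / Np (b k)) powr (1 / p) * q ^ i"
        using p_pos by (simp add: powr_powr)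
    qed
    define a' where "a' k = (\<Sum>i. A i k)" for k
    \<comment> \<open>\<open>R I\<close> holds the coefficients of all corrections from the
      \<open>I\<close>-th on; its partial sums are bounded by a geometric tail, in \<open>b\<close>
      as well as in \<open>z\<close>.\<close>
    define R where "R I k = a' k - (\<Sum>i<I. A i k)" for I k
    have R_null: "(\<lambda>J. Np (psum (R J) x n)) \<longlonglongrightarrow> 0" for x n
    proof (rule tendsto_sandwich[OF _ _ tendsto_const])
      have "(\<lambda>J. norm (R J k) powr p) \<longlonglongrightarrow> 0" for k
      proof (rule tendsto_powr_zero[OF p_pos])
        have "(\<lambda>J. a' k - (\<Sum>i<J. A i k)) \<longlonglongrightarrow> a' k - a' k"
          using summable_LIMSEQ[OF summ[of k]] unfolding a'_def by (intro tendsto_diff tendsto_const)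
        then show "(\<lambda>J. norm (R J k)) \<longlonglongrightarrow> 0" unfolding R_def by (auto intro: tendsto_norm_zero)
      qed auto
      then have "(\<lambda>J. \<Sum>k<n. norm (R J k) powr p * Np (x k)) \<longlonglongrightarrow> (\<Sum>k<n. 0 * Np (x k))"
        by (intro tendsto_sum tendsto_mult tendsto_const)
      then show "(\<lambda>J. \<Sum>k<n. norm (R J k) powr p * Np (x k)) \<longlonglongrightarrow> 0" by simp
      show "\<forall>\<^sub>F J in sequentially. Np (psum (R J) x n) \<le> (\<Sum>k<n. norm (R J k) powr p * Np (x k))"
        using Np_sum[of "\<lambda>k. smul (R _ k) (x k)" "{..<n}"] by (intro always_eventually allI) (simp add: Np_scale)
    qed auto
    have R_le: "Np (psum (R I) x n) \<le> 2 * \<kappa> * \<tau> / 2 ^ I"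
      if x: "\<And>i n. Np (psum (A i) x n) \<le> T i" for x I n
    proof (rule tendsto_lowerbound[where F = sequentially])
      show "(\<lambda>J. Np (psum (R J) x n) + 2 * \<kappa> * \<tau> / 2 ^ I) \<longlonglongrightarrow> 2 * \<kappa> * \<tau> / 2 ^ I"
        using tendsto_add[OF R_null tendsto_const] by simp
      have "Np (psum (R I) x n) \<le> Np (psum (R J) x n) + 2 * \<kappa> * \<tau> / 2 ^ I" if J: "I \<le> J" for J
      proof -
        have "R I k = R J k + (\<Sum>i=I..<J. A i k)" for k
          unfolding R_def using sum.atLeastLessThan_concat[of 0 I J "\<lambda>i. A i k"] J
          by (simp add: atLeast0LessThan algebra_simps)
        then have "psum (R I) x n = psum (R J) x n + (\<Sum>k<n. \<Sum>i=I..<J. smul (A i k) (x k))"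
          by (simp add: scale_left_distrib sum.distrib scale_sum_left)
        also have "(\<Sum>k<n. \<Sum>i=I..<J. smul (A i k) (x k)) = (\<Sum>i=I..<J. psum (A i) x n)"
          by (rule sum.swap)
        finally have "Np (psum (R I) x n) \<le> Np (psum (R J) x n) + Np (\<Sum>i=I..<J. psum (A i) x n)"
          by (simp only: Np_add)
        also have "Np (\<Sum>i=I..<J. psum (A i) x n) \<le> (\<Sum>i=I..<J. T i)"
          by (rule order_trans[OF Np_sum]) (intro sum_mono x)
        also have "\<dots> \<le> 2 * (\<kappa> * \<tau>) / 2 ^ I"
          unfolding T_def using \<kappa> \<tau>0 by (intro sum_half_powers_le) simp
        finally show ?thesis by simp
      qed
      then show "\<forall>\<^sub>F J in sequentially. Np (psum (R I) x n) \<le> Np (psum (R J) x n) + 2 * \<kappa> * \<tau> / 2 ^ I"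
        by (intro eventually_sequentiallyI[of I])
    qed auto
    have "qsums smul N a' b v"
      unfolding qsums_iff
    proof (rule LIMSEQ_I)
      fix e :: real assume e: "e > 0"
      have "(\<lambda>I. (2 * \<kappa> * \<tau> + \<tau>) * (1 / 2) ^ I) \<longlonglongrightarrow> (2 * \<kappa> * \<tau> + \<tau>) * 0"
        by (intro tendsto_mult tendsto_const LIMSEQ_realpow_zero) auto
      then have "\<forall>\<^sub>F I in sequentially. (2 * \<kappa> * \<tau> + \<tau>) * (1 / 2) ^ I < e / 2"
        using e by (intro order_tendstoD) auto
      then obtain I where I: "(2 * \<kappa> * \<tau> + \<tau>) * (1 / 2) ^ I < e / 2" by (auto simp: eventually_sequentially)
      let ?c = "\<lambda>k. \<Sum>i<I. A i k"
      have "(\<Sum>i<I. u i - u (Suc i)) = v - u I"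
        using sum_lessThan_telescope'[of u I] u(3) by simp
      then have "qsums smul N ?c b (v - u I)"
        using qsums_sum[of I A b "\<lambda>i. u i - u (Suc i)"] A(1) by simp
      then obtain M where M: "\<And>n. n \<ge> M \<Longrightarrow> Np (psum ?c b n - (v - u I)) < e / 2"
        unfolding qsums_iff using order_tendstoD(2)[of _ 0 sequentially "e/2"] e
        by (auto simp: eventually_sequentially)
      have "Np (psum a' b n - v) < e" if "n \<ge> M" for n
      proof -
        have "psum a' b n = psum ?c b n + psum (R I) b n"
          by (simp add: R_def scale_left_diff_distrib sum_subtractf)
        then have "psum a' b n - v = (psum ?c b n - (v - u I)) + (psum (R I) b n - u I)" by simp
        then have "Np (psum a' b n - v) \<le> Np (psum ?c b n - (v - u I)) + (Np (psum (R I) b n) + Np (u I))"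
          using Np_add[of "psum ?c b n - (v - u I)" "psum (R I) b n - u I"]
            Np_diff[of "psum (R I) b n" "u I"] by (simp only:)
        moreover have "Np (psum (R I) b n) + Np (u I) \<le> (2 * \<kappa> * \<tau> + \<tau>) * (1 / 2) ^ I"
          using R_le[of b I n, OF A(2)] u(2)[of I] by (simp add: field_simps)
        ultimately show ?thesis using M[OF that] I by linarith
      qed
      then show "\<exists>M. \<forall>n\<ge>M. norm (Np (psum a' b n - v) - 0) < e" by auto
    qed
    \<comment> \<open>Uniqueness of the expansion identifies the constructed coefficients with the
      given ones, so the estimate for \<open>R 0\<close> is the estimate wanted.\<close>
    then have "a' = a" using basic_sequence_coeffs_unique[OF basic] a by blast
    then have "R 0 = a" by (auto simp: R_def)
    then show ?thesis using R_le[of b 0 n, OF A(2)] R_le[of z 0 n, OF A(3)] by simp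
  qed
  \<comment> \<open>The estimate is available for every \<tau> strictly above \<open>Np v\<close>;
    this lets \<tau> decrease to \<open>Np v\<close>.\<close>
  have le: "x \<le> 2 * \<kappa> * y" if "\<And>t. y < t \<Longrightarrow> x \<le> 2 * \<kappa> * t" for x y :: real
  proof (rule field_le_epsilon)
    fix e :: real assume "e > 0"
    then have "x \<le> 2 * \<kappa> * (y + e / (2 * \<kappa>))" using \<kappa> by (intro that) simp
    also have "\<dots> = 2 * \<kappa> * y + e" using \<kappa> by (simp add: distrib_left)
    finally show "x \<le> 2 * \<kappa> * y + e" .
  qed
  show ?thesis
    by (rule that[of "2 * \<kappa>"]) (use \<kappa> bound le in auto)
qed

text \<open>Continuity of the coordinate functionals: a single term is the difference of two
  consecutive partial sums.\<close>

lemma basic_sequence_coeff_bounded: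
  assumes basic: "basic_sequence smul N b"
  obtains C where "C > 0" "\<And>a v k. qsums smul N a b v \<Longrightarrow> norm (a k) powr p * Np (b k) \<le> C * Np v"
proof -
  obtain C where C: "C > 0" "\<And>a v n. qsums smul N a b v \<Longrightarrow> Np (psum a b n) \<le> C * Np v"
    using basic_sequence_psum_bounded[OF basic, of b] by auto
  show ?thesis
  proof (rule that[of "2 * C"])
    fix a v k assume a: "qsums smul N a b v"
    have "smul (a k) (b k) = psum a b (Suc k) - psum a b k" by simp
    then have "Np (smul (a k) (b k)) \<le> 2 * (C * Np v)"
      using Np_diff[of "psum a b (Suc k)" "psum a b k"] C(2)[OF a, of "Suc k"] C(2)[OF a, of k] by simp
    then show "norm (a k) powr p * Np (b k) \<le> 2 * C * Np v" by (simp add: Np_scale)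
  qed (use C in simp)
qed

text \<open>The operator keeps the coefficients and replaces \<open>b\<close> by \<open>z\<close>.
  Uniqueness of the expansion makes it well defined, and the bound on the partial sums in
  \<open>z\<close> makes it bounded; \<open>z\<close> may be any sequence.\<close>

lemma dominates_of_conv:
  assumes basic: "basic_sequence smul N b" and conv: "\<And>a. conv a b \<Longrightarrow> conv a z"
  shows "dominates smul N b z"
proof -
  let ?Y = "closed_span smul N b"
  obtain C where C: "C > 0" "\<And>a v n. qsums smul N a b v \<Longrightarrow> Np (psum a z n) \<le> C * Np v"
    using basic_sequence_psum_bounded[OF basic, of z] conv by metis
  define T where "T v = (THE w. \<exists>a. qsums smul N a b v \<and> qsums smul N a z w)" for v
  have T: "T v = w" if "qsums smul N a b v" "qsums smul N a z w" for a v w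
    unfolding T_def
  proof (rule the_equality)
    show "\<exists>a. qsums smul N a b v \<and> qsums smul N a z w" using that by blast
    show "w' = w" if "\<exists>a. qsums smul N a b v \<and> qsums smul N a z w'" for w'
      using that basic_sequence_coeffs_unique[OF basic] \<open>qsums smul N a b v\<close> \<open>qsums smul N a z w\<close>
        qsums_unique by metis
  qed
  have ex: "\<exists>a. qsums smul N a b v \<and> qsums smul N a z (T v)" if v: "v \<in> ?Y" for v
  proof -
    obtain a where a: "qsums smul N a b v" using basic_sequence_qsums_exists[OF basic v] by blast
    then obtain w where "qsums smul N a z w" using conv by blast
    then show ?thesis using a T by blast
  qed
  have "T v \<in> closed_span smul N z" if v: "v \<in> ?Y" for v
    using ex[OF v] qsums_in_closed_span by blast
  moreover have "T (u + v) = T u + T v" if uv: "u \<in> ?Y" "v \<in> ?Y" for u v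
    using ex[OF uv(1)] ex[OF uv(2)] qsums_add T by blast
  moreover have "T (smul c u) = smul c (T u)" if u: "u \<in> ?Y" for u c
    using ex[OF u] qsums_scale T by blast
  moreover have "N (T v) \<le> C powr (1 / p) * N v" if v: "v \<in> ?Y" for v
  proof -
    obtain a where a: "qsums smul N a b v" "qsums smul N a z (T v)" using ex[OF v] by blast
    have "Np (T v) \<le> C * Np v"
      by (rule Np_limit_le[OF a(2)[unfolded qsums_iff]]) (use C(2)[OF a(1)] in auto)
    then have "Np (T v) powr (1 / p) \<le> (C * Np v) powr (1 / p)"
      using p_pos by (intro powr_mono2) auto
    then show ?thesis using C(1) by (simp add: N_eq_Np[symmetric] powr_mult)
  qed
  moreover have "T (b j) = z j" for j
  proof (rule T)
    have *: "psum (\<lambda>i. if i = j then 1 else 0) x (Suc j) = x j" for x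
      by (simp add: if_distrib[of "\<lambda>c. smul c _"] cong: if_cong)
    show "qsums smul N (\<lambda>i. if i = j then 1 else 0) b (b j)"
      using qsums_finite[of "Suc j" "\<lambda>i. if i = j then 1 else 0" b] unfolding * by simp
    show "qsums smul N (\<lambda>i. if i = j then 1 else 0) z (z j)"
      using qsums_finite[of "Suc j" "\<lambda>i. if i = j then 1 else 0" z] unfolding * by simp
  qed
  ultimately show ?thesis
    unfolding dominates_def by (intro exI[of _ T] conjI ballI allI exI[of _ "C powr (1 / p)"]) auto
qed

end

section \<open>Unconditional and subsymmetric sequences\<close>

lemma obtain_block:
  fixes r :: "nat \<Rightarrow> nat"
  assumes "strict_mono r" "r 0 = 0"
  obtains l where "r l \<le> j" "j < r (Suc l)"
proof -
  define l where "l = (LEAST l. j < r (Suc l))"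
  have "j < r (Suc j)" using strict_mono_imp_increasing[OF assms(1), of "Suc j"] by simp
  then have "j < r (Suc l)" unfolding l_def by (rule LeastI)
  moreover have "r l \<le> j"
  proof (cases l)
    case (Suc k)
    then show ?thesis using not_less_Least[of k "\<lambda>l. j < r (Suc l)"] unfolding l_def by simp
  qed (use assms in simp)
  ultimately show ?thesis using that by blast
qed

lemma block_unique:
  fixes r :: "nat \<Rightarrow> nat"
  assumes "strict_mono r" "r l \<le> j" "j < r (Suc l)" "r k \<le> j" "j < r (Suc k)"
  shows "k = l"
proof (rule ccontr)
  assume "k \<noteq> l"
  then have "r (Suc k) \<le> r l \<or> r (Suc l) \<le> r k"
    using assms(1) by (metis Suc_leI linorder_neqE_nat strict_mono_less_eq)
  then show False using assms by auto
qed

lemma bij_of_blocks: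
  fixes r :: "nat \<Rightarrow> nat"
  assumes r: "strict_mono r" "r 0 = 0"
    and h: "\<And>l. bij_betw (h l) {r l..<r (Suc l)} {r l..<r (Suc l)}"
  obtains \<sigma> where "bij \<sigma>" "\<And>l j. r l \<le> j \<Longrightarrow> j < r (Suc l) \<Longrightarrow> \<sigma> j = h l j"
proof -
  define \<sigma> where "\<sigma> j = h (THE l. r l \<le> j \<and> j < r (Suc l)) j" for j
  have \<sigma>: "\<sigma> j = h l j" if "r l \<le> j" "j < r (Suc l)" for l j
  proof -
    have "(THE l. r l \<le> j \<and> j < r (Suc l)) = l"
      using that block_unique[OF r(1)] by (intro the_equality) auto
    then show ?thesis by (simp add: \<sigma>_def)
  qed
  have UN: "(\<Union>l. {r l..<r (Suc l)}) = UNIV"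
  proof (rule UNIV_eq_I[symmetric])
    fix j
    obtain l where "r l \<le> j" "j < r (Suc l)" by (rule obtain_block[OF r])
    then show "j \<in> (\<Union>l. {r l..<r (Suc l)})" by auto
  qed
  have "bij_betw \<sigma> (\<Union>l. {r l..<r (Suc l)}) (\<Union>l. {r l..<r (Suc l)})"
  proof (rule bij_betw_UNION_disjoint)
    show "disjoint_family_on (\<lambda>l. {r l..<r (Suc l)}) UNIV"
      unfolding disjoint_family_on_def
    proof (intro ballI impI)
      fix l k :: nat assume "l \<noteq> k"
      then show "{r l..<r (Suc l)} \<inter> {r k..<r (Suc k)} = {}"
        using block_unique[OF r(1), of l _ k] by (auto simp: set_eq_iff)
    qed
    show "bij_betw \<sigma> {r l..<r (Suc l)} {r l..<r (Suc l)}" for l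
      using h[of l] \<sigma>[of l] by (subst bij_betw_cong[of _ _ "h l"]) auto
  qed
  then show ?thesis using that \<sigma> UN by simp
qed

lemma bij_prefix:
  fixes m n :: nat
  assumes "G \<subseteq> {m..<n}"
  obtains h where "bij_betw h {m..<n} {m..<n}" "bij_betw h {m..<m + card G} G"
proof -
  have fin: "finite G" using assms finite_subset by blast
  have le: "m + card G \<le> n \<or> G = {}"
    using card_mono[OF _ assms] assms by (cases "m \<le> n") auto
  then have sub: "{m..<m + card G} \<subseteq> {m..<n}" by auto
  obtain f where f: "bij_betw f {m..<m + card G} G"
    using finite_same_card_bij[of "{m..<m + card G}" G] fin by auto
  have "card ({m..<n} - {m..<m + card G}) = card ({m..<n} - G)"
    using sub assms fin by (simp add: card_Diff_subset)
  then obtain g where g: "bij_betw g ({m..<n} - {m..<m + card G}) ({m..<n} - G)"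
    using finite_same_card_bij[of "{m..<n} - {m..<m + card G}" "{m..<n} - G"] by auto
  let ?h = "\<lambda>x. if x \<in> {m..<m + card G} then f x else g x"
  have "bij_betw ?h ({m..<m + card G} \<union> ({m..<n} - {m..<m + card G})) (G \<union> ({m..<n} - G))"
    by (rule bij_betw_disjoint_Un[OF f g]) auto
  moreover have "bij_betw ?h {m..<m + card G} G"
    using f by (subst bij_betw_cong[of _ _ f]) auto
  moreover have "{m..<m + card G} \<union> ({m..<n} - {m..<m + card G}) = {m..<n}" "G \<union> ({m..<n} - G) = {m..<n}"
    using sub assms by blast+
  ultimately show ?thesis using that[of ?h] by (simp only:)
qed

context p_banach_space
begin

text \<open>Unconditionality is given only as basicness of the permuted sequences, so the limit has
  some expansion along \<open>b \<circ> \<sigma>\<close>, and its coefficients remain to be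
  identified with the permuted ones.\<close>

lemma conv_permute:
  assumes basic: "basic_sequence smul N b" and uncond: "unconditional_seq smul N b"
    and \<sigma>: "bij \<sigma>" and a: "conv a b"
  shows "conv (a \<circ> \<sigma>) (b \<circ> \<sigma>)"
proof -
  obtain v where v: "qsums smul N a b v" using a by blast
  have basic': "basic_sequence smul N (b \<circ> \<sigma>)" using uncond \<sigma> by (simp add: unconditional_seq_def)
  have "range (b \<circ> \<sigma>) = range b" using \<sigma> by (metis bij_is_surj image_comp)
  then have "closed_span smul N (b \<circ> \<sigma>) = closed_span smul N b" by (simp add: closed_span_def)
  then obtain c where c: "qsums smul N c (b \<circ> \<sigma>) v"
    using basic_sequence_qsums_exists[OF basic', of v] qsums_in_closed_span[OF v] by auto
  obtain C where C: "C > 0" "\<And>a v k. qsums smul N a (b \<circ> \<sigma>) v \<Longrightarrow>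
      norm (a k) powr p * Np ((b \<circ> \<sigma>) k) \<le> C * Np v"
    using basic_sequence_coeff_bounded[OF basic'] by blast
  have "c k = a (\<sigma> k)" for k
  proof -
    have fin: "qsums smul N (\<lambda>i. if \<sigma> i < n then a (\<sigma> i) else 0) (b \<circ> \<sigma>) (psum a b n)" for n
    proof -
      have inj: "inj \<sigma>" and surj: "surj \<sigma>" using \<sigma> by (auto simp: bij_def)
      have "finite (\<sigma> -` {..<n})" using inj by (simp add: finite_vimageI)
      then obtain M where M: "\<sigma> -` {..<n} \<subseteq> {..<M}" using finite_nat_bounded by auto
      have inM: "i < M" if "\<sigma> i < n" for i
        using M that by auto
      have "psum (\<lambda>i. if \<sigma> i < n then a (\<sigma> i) else 0) (b \<circ> \<sigma>) M
          = (\<Sum>i\<in>{i. \<sigma> i < n}. smul (a (\<sigma> i)) (b (\<sigma> i)))"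
        using inM by (intro sum.mono_neutral_cong_right) auto
      also have "\<dots> = psum a b n"
      proof (rule sum.reindex_bij_betw)
        show "bij_betw \<sigma> {i. \<sigma> i < n} {..<n}"
          unfolding bij_betw_def
        proof
          show "inj_on \<sigma> {i. \<sigma> i < n}" using inj by (rule inj_on_subset) simp
          show "\<sigma> ` {i. \<sigma> i < n} = {..<n}" using surj by (force simp: surj_def)
        qed
      qed
      finally show ?thesis
        using qsums_finite[of M "\<lambda>i. if \<sigma> i < n then a (\<sigma> i) else 0" "b \<circ> \<sigma>"] inM by force
    qed
    \<comment> \<open>In the permuted sequence, \<open>psum a b n\<close> has \<open>k\<close>-th
      coefficient \<open>a (\<sigma> k)\<close> as soon as \<open>\<sigma> k < n\<close>; continuity
      of the \<open>k\<close>-th coordinate carries this over to \<open>v\<close>.\<close>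
    have "\<forall>\<^sub>F n in sequentially. norm (c k - a (\<sigma> k)) powr p * Np (b (\<sigma> k)) \<le> C * Np (psum a b n - v)"
    proof (rule eventually_sequentiallyI[of "Suc (\<sigma> k)"])
      fix n assume "Suc (\<sigma> k) \<le> n"
      then show "norm (c k - a (\<sigma> k)) powr p * Np (b (\<sigma> k)) \<le> C * Np (psum a b n - v)"
        using C(2)[OF qsums_diff[OF c fin[of n]], of k] by (simp add: Np_minus_commute)
    qed
    moreover have "(\<lambda>n. C * Np (psum a b n - v)) \<longlonglongrightarrow> C * 0"
      using v unfolding qsums_iff by (intro tendsto_mult tendsto_const)
    ultimately have "norm (c k - a (\<sigma> k)) powr p * Np (b (\<sigma> k)) \<le> C * 0"
      by (intro tendsto_lowerbound[where F = sequentially]) auto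
    moreover have "Np (b (\<sigma> k)) > 0" using basic_sequence_nonzero[OF basic] by (simp add: Np_pos_iff)
    ultimately have "norm (c k - a (\<sigma> k)) powr p \<le> 0" by (simp add: mult_le_0_iff)
    then have "norm (c k - a (\<sigma> k)) powr p = 0" by (intro antisym) auto
    then show ?thesis by simp
  qed
  then have "c = a \<circ> \<sigma>" by auto
  then show ?thesis using c by blast
qed

text \<open>If the subseries over \<open>A\<close> diverged, moving \<open>A\<close> to the front within suitable blocks would give
  a divergent rearrangement.\<close>

lemma conv_subseries:
  assumes perm: "\<And>\<sigma>. bij \<sigma> \<Longrightarrow> conv (a \<circ> \<sigma>) (b \<circ> \<sigma>)"
  shows "conv (\<lambda>j. if j \<in> A then a j else 0) b"
proof (rule ccontr)
  let ?t = "\<lambda>j. smul (a j) (b j)"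
  assume "\<not> ?thesis"
  then obtain e where e: "e > 0" and large: "\<And>M. \<exists>m\<ge>M. \<exists>n\<ge>m. e \<le> Np (\<Sum>j=m..<n. smul (if j \<in> A then a j else 0) (b j))"
    unfolding conv_iff_Cauchy by (meson not_le)
  have "\<exists>n>M. \<exists>G\<subseteq>{M..<n}. e \<le> Np (sum ?t G)" for M
  proof -
    obtain m n where mn: "m \<ge> M" "n \<ge> m" "e \<le> Np (\<Sum>j=m..<n. smul (if j \<in> A then a j else 0) (b j))"
      using large by blast
    have "(\<Sum>j=m..<n. smul (if j \<in> A then a j else 0) (b j)) = sum ?t ({m..<n} \<inter> A)"
      by (intro sum.mono_neutral_cong_right) auto
    then have "e \<le> Np (sum ?t ({m..<n} \<inter> A))" using mn(3) by simp
    moreover from this have "M < n" using mn e by (cases "M < n") auto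
    ultimately show ?thesis using mn(1) by (intro exI[of _ n] conjI exI[of _ "{m..<n} \<inter> A"]) auto
  qed
  then have "\<exists>r. \<forall>l. (l = 0 \<longrightarrow> r l = 0) \<and> (r l < r (Suc l) \<and> (\<exists>G\<subseteq>{r l..<r (Suc l)}. e \<le> Np (sum ?t G)))"
    by (intro dependent_nat_choice) auto
  then obtain r where "\<forall>l. (l = 0 \<longrightarrow> r l = 0) \<and> (r l < r (Suc l) \<and> (\<exists>G\<subseteq>{r l..<r (Suc l)}. e \<le> Np (sum ?t G)))" ..
  then have r: "strict_mono r" "r 0 = 0" and G: "\<exists>G\<subseteq>{r l..<r (Suc l)}. e \<le> Np (sum ?t G)" for l
    by (auto simp: strict_mono_Suc_iff)
  have "\<exists>h. bij_betw h {r l..<r (Suc l)} {r l..<r (Suc l)} \<and>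
      (\<exists>k. r l + k \<le> r (Suc l) \<and> e \<le> Np (sum ?t (h ` {r l..<r l + k})))" for l
  proof -
    obtain G where G: "G \<subseteq> {r l..<r (Suc l)}" "e \<le> Np (sum ?t G)" using G by blast
    obtain h where h: "bij_betw h {r l..<r (Suc l)} {r l..<r (Suc l)}" "bij_betw h {r l..<r l + card G} G"
      using bij_prefix[OF G(1)] by blast
    have "r l \<le> r (Suc l)" using r by (simp add: strict_mono_less_eq)
    moreover have "card G \<le> r (Suc l) - r l" using card_mono[OF _ G(1)] by simp
    ultimately have "r l + card G \<le> r (Suc l)" by linarith
    then show ?thesis using h G(2) by (intro exI[of _ h] conjI exI[of _ "card G"]) (auto simp: bij_betw_def)
  qed
  then obtain h where h: "\<And>l. bij_betw (h l) {r l..<r (Suc l)} {r l..<r (Suc l)}"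
    and k: "\<And>l. \<exists>k. r l + k \<le> r (Suc l) \<and> e \<le> Np (sum ?t (h l ` {r l..<r l + k}))"
    by metis
  obtain \<sigma> where \<sigma>: "bij \<sigma>" "\<And>l j. r l \<le> j \<Longrightarrow> j < r (Suc l) \<Longrightarrow> \<sigma> j = h l j"
    using bij_of_blocks[OF r h] by blast
  obtain M where M: "\<And>m n. m \<ge> M \<Longrightarrow> n \<ge> m \<Longrightarrow> Np (\<Sum>j=m..<n. smul ((a \<circ> \<sigma>) j) ((b \<circ> \<sigma>) j)) < e"
    using perm[OF \<sigma>(1)] e unfolding conv_iff_Cauchy by blast
  obtain k where k: "r M + k \<le> r (Suc M)" "e \<le> Np (sum ?t (h M ` {r M..<r M + k}))" using k by blast
  have "inj_on (h M) {r M..<r M + k}"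
    using h[of M] k(1) by (auto simp: bij_betw_def intro: inj_on_subset)
  then have "sum ?t (h M ` {r M..<r M + k}) = (\<Sum>j=r M..<r M + k. ?t (h M j))"
    by (simp add: sum.reindex)
  also have "\<dots> = (\<Sum>j=r M..<r M + k. smul ((a \<circ> \<sigma>) j) ((b \<circ> \<sigma>) j))"
    using \<sigma>(2)[of M] k(1) by (intro sum.cong) auto
  finally have "e \<le> Np (\<Sum>j=r M..<r M + k. smul ((a \<circ> \<sigma>) j) ((b \<circ> \<sigma>) j))" using k(2) by simp
  moreover have "r M \<ge> M" using strict_mono_imp_increasing[OF r(1)] by simp
  ultimately show False using M[of "r M" "r M + k"] by simp
qed

end

lemma frequently_large:
  fixes f :: "nat \<Rightarrow> real"
  assumes "\<And>K. \<exists>k. K < f k"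
  shows "\<exists>m>M. K \<le> f m"
proof (rule ccontr)
  assume "\<not> ?thesis"
  then have *: "f m < K" if "m > M" for m using that by (meson not_le)
  have "f k \<le> \<bar>K\<bar> + (\<Sum>i\<le>M. \<bar>f i\<bar>)" for k
  proof (cases "k \<le> M")
    case True
    then have "\<bar>f k\<bar> \<le> (\<Sum>i\<le>M. \<bar>f i\<bar>)" by (intro member_le_sum) auto
    then show ?thesis by linarith
  next
    case False
    have "0 \<le> (\<Sum>i\<le>M. \<bar>f i\<bar>)" by (intro sum_nonneg) auto
    then show ?thesis using *[of k] False by linarith
  qed
  then show False using assms by (meson not_le)
qed

context p_banach_space
begin

section \<open>Norm bounds and differences of subsymmetric sequences\<close>

lemma exists_scalar: "0 \<le> t \<Longrightarrow> \<exists>c :: 'f. norm c powr p = t"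
  using p_pos by (intro exI[of _ "of_real (t powr (1 / p))"]) (simp add: powr_powr)

lemma subsymmetric_conv_subseq:
  "subsymmetric_seq smul N B \<Longrightarrow> strict_mono \<phi> \<Longrightarrow> conv a (B \<circ> \<phi>) \<longleftrightarrow> conv a B"
  unfolding subsymmetric_seq_def equivalent_seqs_def by blast

text \<open>If the norms were unbounded, a subsequence could outgrow \<open>B\<close> by factors
  \<open>2 ^ k\<close>. Suitable coefficients would then make the series over \<open>B\<close>
  absolutely convergent while the terms over the subsequence stay large, against equivalence with
  the subsequence.\<close>

lemma subsymmetric_bounded:
  assumes B: "subsymmetric_seq smul N B"
  obtains K where "\<And>k. Np (B k) \<le> K"
proof -
  have nz: "Np (B k) > 0" for k
    using basic_sequence_nonzero B by (simp add: subsymmetric_seq_def Np_pos_iff)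
  have "\<exists>K. \<forall>k. Np (B k) \<le> K"
  proof (rule ccontr)
    assume "\<nexists>K. \<forall>k. Np (B k) \<le> K"
    then have "\<exists>k. K < Np (B k)" for K by (meson not_le)
    then have "\<exists>m>M. 2 ^ k * Np (B k) \<le> Np (B m)" for k M by (rule frequently_large)
    then obtain \<phi> where \<phi>: "strict_mono \<phi>" "\<And>k. 2 ^ k * Np (B k) \<le> Np (B (\<phi> k))"
      using strict_mono_choice[of "\<lambda>k m. 2 ^ k * Np (B k) \<le> Np (B m)"] by blast
    have "\<exists>a. \<forall>k. norm (a k :: 'f) powr p = 1 / (2 ^ k * Np (B k))"
      by (intro choice allI exists_scalar) simp
    then obtain a :: "nat \<Rightarrow> 'f" where a: "\<And>k. norm (a k) powr p = 1 / (2 ^ k * Np (B k))" by blast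
    have "Np (smul (a k) (B k)) = (1 / 2) ^ k" for k
      using nz[of k] by (simp add: Np_scale a Np_pos_iff power_one_over)
    then have "conv a B" by (intro conv_of_summable) (simp add: summable_geometric)
    then have "conv a (B \<circ> \<phi>)" using subsymmetric_conv_subseq[OF B \<phi>(1)] by blast
    then have "(\<lambda>k. Np (smul (a k) (B (\<phi> k)))) \<longlonglongrightarrow> 0" using conv_terms_null by fastforce
    moreover have "1 \<le> Np (smul (a k) (B (\<phi> k)))" for k
      using \<phi>(2)[of k] nz[of k] by (simp add: Np_scale a field_simps)
    ultimately have "(1::real) \<le> 0" by (intro tendsto_lowerbound[where F = sequentially]) auto
    then show False by simp
  qed
  then show ?thesis using that by blast
qed

text \<open>The argument for the upper bound with the roles exchanged: coefficients that normalise
  the terms of \<open>B\<close> give an absolutely convergent series over a rapidly decreasing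
  subsequence.\<close>

lemma subsymmetric_bounded_below:
  assumes B: "subsymmetric_seq smul N B"
  obtains c where "c > 0" "\<And>k. c \<le> Np (B k)"
proof -
  have nz: "Np (B k) > 0" for k
    using basic_sequence_nonzero B by (simp add: subsymmetric_seq_def Np_pos_iff)
  have "\<exists>K. \<forall>k. inverse (Np (B k)) \<le> K"
  proof (rule ccontr)
    assume "\<nexists>K. \<forall>k. inverse (Np (B k)) \<le> K"
    then have "\<exists>k. K < inverse (Np (B k))" for K by (meson not_le)
    then have "\<exists>m>M. 2 ^ k * inverse (Np (B k)) \<le> inverse (Np (B m))" for k M by (rule frequently_large)
    then obtain \<phi> where \<phi>: "strict_mono \<phi>" "\<And>k. 2 ^ k * inverse (Np (B k)) \<le> inverse (Np (B (\<phi> k)))"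
      using strict_mono_choice[of "\<lambda>k m. 2 ^ k * inverse (Np (B k)) \<le> inverse (Np (B m))"] by blast
    have "\<exists>a. \<forall>k. norm (a k :: 'f) powr p = inverse (Np (B k))"
      by (intro choice allI exists_scalar) simp
    then obtain a :: "nat \<Rightarrow> 'f" where a: "\<And>k. norm (a k) powr p = inverse (Np (B k))" by blast
    have "summable (\<lambda>k. Np (smul (a k) ((B \<circ> \<phi>) k)))"
    proof (rule summable_comparison_test')
      show "summable (\<lambda>k. (1 / 2 :: real) ^ k)" by (simp add: summable_geometric)
      show "norm (Np (smul (a k) ((B \<circ> \<phi>) k))) \<le> (1 / 2) ^ k" if "0 \<le> k" for k
        using \<phi>(2)[of k] nz[of k] nz[of "\<phi> k"] by (simp add: Np_scale a field_simps)
    qed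
    then have "conv a (B \<circ> \<phi>)" by (rule conv_of_summable)
    then have "conv a B" using subsymmetric_conv_subseq[OF B \<phi>(1)] by blast
    then have "(\<lambda>k. Np (smul (a k) (B k))) \<longlonglongrightarrow> 0" by (rule conv_terms_null)
    moreover have "Np (smul (a k) (B k)) = 1" for k
      using nz[of k] by (simp add: Np_scale a Np_pos_iff)
    ultimately have "(\<lambda>k::nat. 1::real) \<longlonglongrightarrow> 0" by simp
    then show False by (simp add: LIMSEQ_const_iff)
  qed
  then obtain K where K: "\<And>k. inverse (Np (B k)) \<le> K" by blast
  have "K > 0" using K[of 0] nz[of 0] by (meson inverse_positive_iff_positive less_le_trans)
  then show ?thesis using K nz by (intro that[of "inverse K"]) (auto simp: inverse_le_imp_le)
qed

text \<open>Reads the \<open>k\<close>-th coordinate off the expansion of the difference. The scalar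
  \<open>c\<close> is included so that the estimate applies to the terms of a series.\<close>

lemma basic_sequence_difference_lower:
  assumes basic: "basic_sequence smul N b"
  obtains C where "C > 0" "\<And>c k l. k \<noteq> l \<Longrightarrow> norm c powr p * Np (b k) \<le> C * Np (smul c (b k - b l))"
proof -
  obtain C where C: "C > 0" "\<And>a v k. qsums smul N a b v \<Longrightarrow> norm (a k) powr p * Np (b k) \<le> C * Np v"
    using basic_sequence_coeff_bounded[OF basic] by blast
  have "norm c powr p * Np (b k) \<le> C * Np (smul c (b k - b l))" if kl: "k \<noteq> l" for c k l
  proof -
    let ?a = "\<lambda>j. (if j = k then c else 0) - (if j = l then c else 0)"
    have *: "psum ?a b (Suc (max k l)) = smul c (b k - b l)"
      by (simp add: scale_left_diff_distrib scale_right_diff_distrib sum_subtractf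
          if_distrib[of "\<lambda>c. smul c _"] less_Suc_eq_le cong: if_cong)
    have "qsums smul N ?a b (smul c (b k - b l))"
      unfolding *[symmetric] by (rule qsums_finite) auto
    from C(2)[OF this, of k] show ?thesis using kl by simp
  qed
  then show ?thesis using that C(1) by blast
qed

text \<open>A series over the differences is the difference of two series over subsequences of
  \<open>B\<close>, which gives one direction. Conversely, it is an alternating series over
  \<open>B \<circ> \<phi>\<close>, from which unconditionality extracts the positive half.\<close>

lemma subsymmetric_differences:
  assumes B: "subsymmetric_seq smul N B" and \<phi>: "strict_mono \<phi>"
  shows "equivalent_seqs smul N B (\<lambda>i. B (\<phi> (2 * i)) - B (\<phi> (2 * i + 1)))"
  unfolding equivalent_seqs_def
proof (intro allI iffI)
  let ?x = "\<lambda>i. B (\<phi> (2 * i)) - B (\<phi> (2 * i + 1))"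
  have basic: "basic_sequence smul N B" and uncond: "unconditional_seq smul N B"
    using B by (auto simp: subsymmetric_seq_def)
  have mono: "strict_mono (\<lambda>i. \<phi> (2 * i))" "strict_mono (\<lambda>i. \<phi> (2 * i + 1))"
    using \<phi> by (auto simp: strict_mono_def)
  fix a
  show "conv a ?x" if "conv a B"
    using conv_diff_vectors[of a "B \<circ> (\<lambda>i. \<phi> (2 * i))" "B \<circ> (\<lambda>i. \<phi> (2 * i + 1))"]
      subsymmetric_conv_subseq[OF B] mono that by (simp add: o_def)
  assume ax: "conv a ?x"
  then obtain v where v: "qsums smul N a ?x v" by blast
  obtain C where C: "C > 0" "\<And>c k l. k \<noteq> l \<Longrightarrow> norm c powr p * Np (B k) \<le> C * Np (smul c (B k - B l))"
    using basic_sequence_difference_lower[OF basic] by blast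
  \<comment> \<open>The even partial sums of this alternating series are the partial sums over the
    differences; the odd ones contain one extra term, and that term tends to zero because it is
    bounded by the term of the difference.\<close>
  define c where "c j = (if even j then a (j div 2) else - a (j div 2))" for j
  let ?e = "\<lambda>n. Np (smul (a n) (B (\<phi> (2 * n))))"
  have even: "psum c (B \<circ> \<phi>) (2 * n) = psum a ?x n" for n
    by (induction n) (auto simp: c_def scale_right_diff_distrib scale_minus_left algebra_simps)
  have "qsums smul N c (B \<circ> \<phi>) v"
    unfolding qsums_iff
  proof (rule tendsto_sandwich[OF _ _ tendsto_const])
    have e: "?e \<longlonglongrightarrow> 0"
    proof (rule tendsto_sandwich[OF _ _ tendsto_const])
      show "(\<lambda>n. C * Np (smul (a n) (?x n))) \<longlonglongrightarrow> 0"
        using tendsto_mult_left[OF conv_terms_null[OF ax], of C] by simp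
      have "\<phi> (2 * n) \<noteq> \<phi> (2 * n + 1)" for n
        using \<phi> by (metis less_add_one less_irrefl strict_mono_less)
      then show "\<forall>\<^sub>F n in sequentially. ?e n \<le> C * Np (smul (a n) (?x n))"
        using C(2) by (intro always_eventually allI) (simp add: Np_scale)
    qed auto
    have half: "filterlim (\<lambda>n::nat. n div 2) sequentially sequentially"
      by (rule filterlim_at_top_div_const_nat) simp
    have "(\<lambda>n. Np (psum a ?x n - v) + ?e n) \<longlonglongrightarrow> 0"
      using tendsto_add[OF v[unfolded qsums_iff] e] by simp
    from filterlim_compose[OF this half]
    show "(\<lambda>n. Np (psum a ?x (n div 2) - v) + ?e (n div 2)) \<longlonglongrightarrow> 0" .
    have "Np (psum c (B \<circ> \<phi>) n - v) \<le> Np (psum a ?x (n div 2) - v) + ?e (n div 2)" for n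
    proof (cases "even n")
      case True
      then obtain m where m: "n = 2 * m" by blast
      show ?thesis unfolding m even by simp
    next
      case False
      then obtain m where m: "n = Suc (2 * m)" using oddE by (metis Suc_eq_plus1)
      have "psum c (B \<circ> \<phi>) n = psum a ?x m + smul (a m) (B (\<phi> (2 * m)))"
        unfolding m sum.lessThan_Suc even by (simp add: c_def)
      then have "psum c (B \<circ> \<phi>) n - v = (psum a ?x m - v) + smul (a m) (B (\<phi> (2 * m)))" by simp
      then have "Np (psum c (B \<circ> \<phi>) n - v) \<le> Np (psum a ?x m - v) + ?e m"
        by (simp only: Np_add)
      then show ?thesis unfolding m by simp
    qed
    then show "\<forall>\<^sub>F n in sequentially. Np (psum c (B \<circ> \<phi>) n - v) \<le> Np (psum a ?x (n div 2) - v) + ?e (n div 2)"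
      by (intro always_eventually allI)
  qed auto
  then have "conv (spread \<phi> c) B" using conv_spread[OF \<phi>] by blast
  \<comment> \<open>Unconditionality allows the terms with a minus sign to be dropped.\<close>
  then have "conv (\<lambda>j. if j \<in> range (\<lambda>i. \<phi> (2 * i)) then spread \<phi> c j else 0) B"
    using conv_subseries conv_permute[OF basic uncond] by blast
  moreover have "(\<lambda>j. if j \<in> range (\<lambda>i. \<phi> (2 * i)) then spread \<phi> c j else 0) = spread (\<lambda>i. \<phi> (2 * i)) a"
  proof
    fix j
    show "(if j \<in> range (\<lambda>i. \<phi> (2 * i)) then spread \<phi> c j else 0) = spread (\<lambda>i. \<phi> (2 * i)) a j"
    proof (cases "j \<in> range (\<lambda>i. \<phi> (2 * i))")
      case True
      then obtain i where i: "j = \<phi> (2 * i)" by blast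
      have "spread (\<lambda>i. \<phi> (2 * i)) a j = a i" unfolding i by (rule spread_apply[OF mono(1)])
      moreover have "spread \<phi> c j = c (2 * i)" unfolding i by (rule spread_apply[OF \<phi>])
      ultimately show ?thesis using True by (simp add: c_def)
    qed (simp add: spread_def)
  qed
  ultimately have "conv (spread (\<lambda>i. \<phi> (2 * i)) a) B" by simp
  then have "conv a (B \<circ> (\<lambda>i. \<phi> (2 * i)))" using conv_spread[OF mono(1)] by blast
  then show "conv a B" using subsymmetric_conv_subseq[OF B mono(1)] by blast
qed

lemma equivalent_subsymmetric_subseq:
  assumes "subsymmetric_seq smul N B" "equivalent_seqs smul N B y" "strict_mono \<phi>"
  shows "equivalent_seqs smul N B (y \<circ> \<phi>)"
  using equivalent_subseq[OF assms(2,3)] subsymmetric_conv_subseq[OF assms(1,3)]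
  unfolding equivalent_seqs_def by blast

lemma subsymmetric_transfer:
  assumes B: "subsymmetric_seq smul N B" and eq: "equivalent_seqs smul N B y"
    and y: "basic_sequence smul N y" "unconditional_seq smul N y"
  shows "subsymmetric_seq smul N y"
  unfolding subsymmetric_seq_def
  using y equivalent_subsymmetric_subseq[OF B eq] eq equivalent_sym equivalent_trans by blast

end

section \<open>Subsymmetric bases\<close>

text \<open>The invariance of the quasi-norm is stated for increasing maps on all indices, whereas
  the maps that occur are prescribed on finitely many; beyond these the extension runs above all
  prescribed values.\<close>

lemma strict_mono_extend:
  fixes f :: "nat \<Rightarrow> nat"
  assumes "\<And>i j. i < j \<Longrightarrow> j < n \<Longrightarrow> f i < f j"
  obtains \<psi> where "strict_mono \<psi>" "\<And>i. i < n \<Longrightarrow> \<psi> i = f i"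
proof -
  define M where "M = Suc (\<Sum>k<n. f k)"
  have M: "f k < M" if "k < n" for k
  proof -
    have "f k \<le> (\<Sum>k<n. f k)" using that by (intro member_le_sum) auto
    then show ?thesis by (simp add: M_def)
  qed
  define \<psi> where "\<psi> i = (if i < n then f i else M + i)" for i
  have "strict_mono \<psi>"
    unfolding strict_mono_def \<psi>_def using assms M by (auto simp: trans_less_add1)
  then show ?thesis using that by (simp add: \<psi>_def)
qed

lemma strict_mono_enumerate_finite:
  fixes G :: "nat set"
  assumes "finite G"
  obtains \<phi> where "strict_mono \<phi>" "\<phi> ` {..<card G} = G"
proof -
  have "\<exists>\<phi>. strict_mono \<phi> \<and> \<phi> ` {..<card G} = G" using assms
  proof (induction rule: finite_linorder_max_induct)
    case empty
    then show ?case by (intro exI[of _ id]) (auto simp: strict_mono_def)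
  next
    case (insert b A)
    then obtain \<phi> where \<phi>: "strict_mono \<phi>" "\<phi> ` {..<card A} = A" by blast
    have card: "card (insert b A) = Suc (card A)" using insert by (subst card_insert_disjoint) auto
    have lt: "\<phi> i < b" if "i < card A" for i using \<phi>(2) insert that by blast
    obtain \<psi> where \<psi>: "strict_mono \<psi>" "\<And>i. i < Suc (card A) \<Longrightarrow> \<psi> i = (if i < card A then \<phi> i else b)"
      by (rule strict_mono_extend[of "Suc (card A)" "\<lambda>i. if i < card A then \<phi> i else b"])
        (use lt \<phi>(1) in \<open>auto simp: strict_mono_less\<close>)
    have "\<psi> ` {..<card (insert b A)} = insert (\<psi> (card A)) (\<psi> ` {..<card A})"
      unfolding card lessThan_Suc by simp
    also have "\<psi> ` {..<card A} = \<phi> ` {..<card A}" using \<psi>(2) by (intro image_cong) auto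
    finally show ?case using \<psi> \<phi>(2) by auto
  qed
  then show ?thesis using that by blast
qed

locale subsymmetric_basis = p_banach_space smul N p
  for smul :: "'f::{real_normed_field, euclidean_space} \<Rightarrow> 'a::ab_group_add \<Rightarrow> 'a" and N p +
  fixes s :: "nat \<Rightarrow> 'a"
  assumes basis: "schauder_basis_of smul N s UNIV"
    and subsymmetric_norm: "subsymmetric_qnorm smul N s"
begin

abbreviation co :: "nat \<Rightarrow> 'a \<Rightarrow> 'f" where "co \<equiv> coord smul N s"

lemma ex1_qsums: "\<exists>!a. qsums smul N a s v"
  using basis by (simp add: schauder_basis_of_def)

lemma qsums_coord: "qsums smul N (\<lambda>j. co j v) s v"
  unfolding coord_def using theI'[OF ex1_qsums] by simp

lemma coord_eqI: "qsums smul N a s v \<Longrightarrow> co j v = a j"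
  using qsums_coord[of v] ex1_qsums[of v] by metis

lemma coord_diff: "co j (u - v) = co j u - co j v"
  by (rule coord_eqI[OF qsums_diff[OF qsums_coord qsums_coord]])

lemma qsums_finite_set:
  assumes "finite F"
  shows "qsums smul N (\<lambda>j. if j \<in> F then c j else 0) s (\<Sum>j\<in>F. smul (c j) (s j))"
proof -
  obtain n where n: "F \<subseteq> {..<n}" using finite_nat_bounded assms by blast
  have "psum (\<lambda>j. if j \<in> F then c j else 0) s n = (\<Sum>j\<in>F. smul (c j) (s j))"
    using n by (intro sum.mono_neutral_cong_right) auto
  moreover have "qsums smul N (\<lambda>j. if j \<in> F then c j else 0) s (psum (\<lambda>j. if j \<in> F then c j else 0) s n)"
    using n by (intro qsums_finite) auto
  ultimately show ?thesis by simp
qed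

lemma coord_finite_sum:
  "finite F \<Longrightarrow> co i (\<Sum>j\<in>F. smul (c j) (s j)) = (if i \<in> F then c i else 0)"
  using coord_eqI[OF qsums_finite_set] by blast

section \<open>Isometries: sign changes and order-preserving displacements\<close>

lemma Np_isometry:
  assumes "qsums smul N a s x" "\<And>j. norm (\<epsilon> j :: 'f) = 1" "strict_mono \<phi>"
  obtains y where "qsums smul N (\<lambda>j. \<epsilon> j * a j) (s \<circ> \<phi>) y" "Np y = Np x"
proof -
  obtain y where "qsums smul N (\<lambda>j. \<epsilon> j * co j x) (s \<circ> \<phi>) y" "N x = N y"
    using subsymmetric_norm assms(2,3) unfolding subsymmetric_qnorm_def by blast
  moreover have "(\<lambda>j. co j x) = a" using coord_eqI[OF assms(1)] by blast
  ultimately show ?thesis using that by (simp add: Np_def fun_eq_iff)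
qed

lemma Np_psum_isometry:
  assumes "\<And>j. norm (\<epsilon> j :: 'f) = 1" "strict_mono \<phi>"
  shows "Np (\<Sum>j<n. smul (\<epsilon> j * a j) (s (\<phi> j))) = Np (psum a s n)"
proof -
  have eq: "psum (\<lambda>j. if j < n then a j else 0) s n = psum a s n" by simp
  have "qsums smul N (\<lambda>j. if j < n then a j else 0) s (psum a s n)"
    unfolding eq[symmetric] by (rule qsums_finite) auto
  then obtain y where y: "qsums smul N (\<lambda>j. \<epsilon> j * (if j < n then a j else 0)) (s \<circ> \<phi>) y"
    "Np y = Np (psum a s n)"
    using Np_isometry assms by blast
  have "qsums smul N (\<lambda>j. \<epsilon> j * (if j < n then a j else 0)) (s \<circ> \<phi>)
      (psum (\<lambda>j. \<epsilon> j * (if j < n then a j else 0)) (s \<circ> \<phi>) n)"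
    by (rule qsums_finite) auto
  from qsums_unique[OF y(1) this] y(2) show ?thesis by simp
qed

text \<open>Enumerate \<open>F\<close> in the order of the positions \<open>g\<close>. The positions
  \<open>g\<close> and the positions \<open>h\<close> are then both images of an initial segment
  under increasing maps, so both sums have the norm of one sum over the first \<open>card F\<close>
  basis vectors. Gaps between positions are therefore invisible to the quasi-norm.\<close>

lemma Np_order_isometry:
  assumes fin: "finite F" and inj: "inj_on g F"
    and ord: "\<And>i j. i \<in> F \<Longrightarrow> j \<in> F \<Longrightarrow> g i < g j \<Longrightarrow> h i < (h j :: nat)"
    and \<epsilon>: "\<And>i. i \<in> F \<Longrightarrow> norm (\<epsilon> i :: 'f) = 1"
  shows "Np (\<Sum>i\<in>F. smul (\<epsilon> i * c i) (s (h i))) = Np (\<Sum>i\<in>F. smul (c i) (s (g i)))"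
proof -
  define n where "n = card F"
  have n: "card (g ` F) = n" using card_image[OF inj] by (simp add: n_def)
  obtain \<phi> where \<phi>: "strict_mono \<phi>" "\<phi> ` {..<n} = g ` F"
    using strict_mono_enumerate_finite[of "g ` F"] fin n by auto
  define t where "t = inv_into F g \<circ> \<phi>"
  have "bij_betw \<phi> {..<n} (g ` F)"
    using \<phi> strict_mono_imp_inj_on[OF \<phi>(1)] by (auto simp: bij_betw_def intro: inj_on_subset)
  moreover have "bij_betw (inv_into F g) (g ` F) F" using inj by (simp add: bij_betw_inv_into inj_on_imp_bij_betw)
  ultimately have t: "bij_betw t {..<n} F" unfolding t_def by (rule bij_betw_trans)
  have tF: "t k \<in> F" if "k < n" for k using t that by (auto simp: bij_betw_def)
  have gt: "g (t k) = \<phi> k" if "k < n" for k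
    unfolding t_def using \<phi>(2) that by (auto intro!: f_inv_into_f)
  obtain \<psi> where \<psi>: "strict_mono \<psi>" "\<And>k. k < n \<Longrightarrow> \<psi> k = h (t k)"
  proof (rule strict_mono_extend[of n "\<lambda>k. h (t k)"])
    fix i j :: nat assume ij: "i < j" "j < n"
    then have "g (t i) < g (t j)" using gt \<phi>(1) by (simp add: strict_mono_less)
    then show "h (t i) < h (t j)" using ord tF ij by simp
  qed blast
  define \<delta> where "\<delta> k = (if k < n then \<epsilon> (t k) else 1)" for k
  have \<delta>: "norm (\<delta> k) = 1" for k using \<epsilon> tF by (simp add: \<delta>_def)
  have "(\<Sum>i\<in>F. smul (\<epsilon> i * c i) (s (h i))) = (\<Sum>k<n. smul (\<epsilon> (t k) * c (t k)) (s (h (t k))))"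
    by (rule sum.reindex_bij_betw[OF t, symmetric])
  also have "\<dots> = (\<Sum>k<n. smul (\<delta> k * c (t k)) (s (\<psi> k)))"
    using \<psi>(2) by (intro sum.cong) (auto simp: \<delta>_def)
  finally have "Np (\<Sum>i\<in>F. smul (\<epsilon> i * c i) (s (h i))) = Np (psum (\<lambda>k. c (t k)) s n)"
    using Np_psum_isometry[OF \<delta> \<psi>(1)] by simp
  also have "\<dots> = Np (\<Sum>k<n. smul (1 * c (t k)) (s (\<phi> k)))"
    by (rule Np_psum_isometry[symmetric, OF _ \<phi>(1)]) simp
  also have "(\<Sum>k<n. smul (1 * c (t k)) (s (\<phi> k))) = (\<Sum>k<n. smul (c (t k)) (s (g (t k))))"
    using gt by (intro sum.cong) auto
  also have "\<dots> = (\<Sum>i\<in>F. smul (c i) (s (g i)))"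
    by (rule sum.reindex_bij_betw[OF t])
  finally show ?thesis .
qed

lemma Np_order_isometry':
  assumes "finite F" "inj_on g F"
    and "\<And>i j. i \<in> F \<Longrightarrow> j \<in> F \<Longrightarrow> g i < g j \<Longrightarrow> h i < (h j :: nat)"
  shows "Np (\<Sum>i\<in>F. smul (c i) (s (h i))) = Np (\<Sum>i\<in>F. smul (c i) (s (g i)))"
  using Np_order_isometry[OF assms, where \<epsilon> = "\<lambda>_. 1" and c = c] by simp

lemma Np_s: "Np (s j) = Np (s 0)"
  using Np_order_isometry'[of "{()}" "\<lambda>_. 0" "\<lambda>_. j" "\<lambda>_. 1"] by simp

lemma s_nonzero: "s j \<noteq> 0"
proof
  assume "s j = 0"
  then have "qsums smul N (\<lambda>i. if i \<in> {j} then 1 else 0) s 0"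
    using qsums_finite_set[of "{j}" "\<lambda>_. 1"] by simp
  moreover have "qsums smul N (\<lambda>i. 0) s 0" using qsums_finite_set[of "{}"] by simp
  ultimately have "(\<lambda>i. if i \<in> {j} then 1 else 0) = (\<lambda>i. 0 :: 'f)" using ex1_qsums[of 0] by blast
  then show False by (metis insertI1 zero_neq_one)
qed

lemma Np_s_pos: "Np (s 0) > 0"
  using s_nonzero by (simp add: Np_pos_iff)

lemma Np_smul_s: "Np (smul c (s j)) = norm c powr p * Np (s 0)"
  using Np_s[of j] by (simp only: Np_scale)

text \<open>The restriction is the average of \<open>x\<close> and its image under the sign change
  off \<open>A\<close>; the constant 2 comes from subadditivity, the factor 1/2 being estimated by
  1.\<close>

lemma qsums_restrict:
  assumes "qsums smul N a s x"
  obtains w where "qsums smul N (\<lambda>j. if j \<in> A then a j else 0) s w" "Np w \<le> 2 * Np x"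
proof -
  obtain y where y: "qsums smul N (\<lambda>j. (if j \<in> A then 1 else -1) * a j) (s \<circ> id) y" "Np y = Np x"
    by (rule Np_isometry[OF assms, of "\<lambda>j. if j \<in> A then 1 else -1" id]) (auto simp: strict_mono_def)
  then have "qsums smul N (\<lambda>j. (1/2) * (a j + (if j \<in> A then 1 else -1) * a j)) s (smul (1/2) (x + y))"
    by (intro qsums_scale qsums_add assms) simp
  moreover have "(\<lambda>j. (1/2) * (a j + (if j \<in> A then 1 else -1) * a j)) = (\<lambda>j. if j \<in> A then a j else 0)"
    by (auto simp: fun_eq_iff)
  moreover have "Np (smul (1/2) (x + y)) \<le> 2 * Np x"
  proof -
    have "norm (1/2 :: 'f) powr p \<le> 1" using p_pos by (intro powr_le1) (auto simp: norm_divide)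
    then have "Np (smul (1/2) (x + y)) \<le> 1 * Np (x + y)"
      unfolding Np_scale by (intro mult_right_mono) auto
    also have "\<dots> \<le> 2 * Np x" using Np_add[of x y] y(2) by simp
    finally show ?thesis .
  qed
  ultimately show ?thesis using that by metis
qed

text \<open>Restriction to a single coordinate; sign invariance thus gives an explicit bound,
  uniform in \<open>j\<close>, without the Baire argument.\<close>

lemma coord_bound: "norm (co j v) powr p * Np (s 0) \<le> 2 * Np v"
proof -
  obtain w where w: "qsums smul N (\<lambda>i. if i \<in> {j} then co i v else 0) s w" "Np w \<le> 2 * Np v"
    using qsums_restrict[OF qsums_coord] by blast
  have "w = smul (co j v) (s j)"
    using qsums_unique[OF w(1)] qsums_finite_set[of "{j}" "\<lambda>i. co i v"] by simp
  then show ?thesis using w(2) by (simp add: Np_smul_s)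
qed

lemma Np_subsum_le:
  assumes "finite F" "G \<subseteq> F"
  shows "Np (\<Sum>j\<in>G. smul (c j) (s j)) \<le> 2 * Np (\<Sum>j\<in>F. smul (c j) (s j))"
proof -
  obtain w where w: "qsums smul N (\<lambda>j. if j \<in> G then (if j \<in> F then c j else 0) else 0) s w"
    "Np w \<le> 2 * Np (\<Sum>j\<in>F. smul (c j) (s j))"
    using qsums_restrict[OF qsums_finite_set[OF assms(1)]] by blast
  have "(\<lambda>j. if j \<in> G then (if j \<in> F then c j else 0) else 0) = (\<lambda>j. if j \<in> G then c j else 0)"
    using assms(2) by (auto simp: fun_eq_iff)
  then have "w = (\<Sum>j\<in>G. smul (c j) (s j))"
    using qsums_unique[OF w(1)] qsums_finite_set[of G c] finite_subset[OF assms(2,1)] by metis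
  then show ?thesis using w(2) by simp
qed

text \<open>The constant that results from solving \<open>M \<le> q * (2 * X + M)\<close> for
  \<open>M\<close>, with \<open>q = (1/2) powr p\<close>; this inequality is met in
  \<open>Np_real_multiplier\<close>.\<close>

definition lattice_const :: real where
  "lattice_const = 2 * (1/2) powr p / (1 - (1/2) powr p)"

lemma half_powr_p: "0 < (1/2::real) powr p" "(1/2::real) powr p < 1"
  using p_pos powr_less_mono2[of p "1/2" 1] by auto

lemma lattice_const_pos: "lattice_const > 0"
  using half_powr_p by (simp add: lattice_const_def)

text \<open>Convexity is not available for \<open>p < 1\<close>: instead, the first binary digit of the multiplier is
  split off, which expresses the supremum over all multipliers through itself.\<close>

lemma Np_real_multiplier:
  assumes fin: "finite F" and \<theta>: "\<And>j. 0 \<le> \<theta> j \<and> \<theta> j \<le> 1"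
  shows "Np (\<Sum>j\<in>F. smul (of_real (\<theta> j) * c j) (s j)) \<le> lattice_const * Np (\<Sum>j\<in>F. smul (c j) (s j))"
proof -
  let ?L = "{\<mu> :: nat \<Rightarrow> real. \<forall>j. 0 \<le> \<mu> j \<and> \<mu> j \<le> 1}"
  let ?v = "\<lambda>\<mu> :: nat \<Rightarrow> real. Np (\<Sum>j\<in>F. smul (of_real (\<mu> j) * c j) (s j))"
  let ?X = "Np (\<Sum>j\<in>F. smul (c j) (s j))"
  define q where "q = (1/2::real) powr p"
  have q: "0 < q" "q < 1" using half_powr_p by (auto simp: q_def)
  \<comment> \<open>The supremum must be known to be finite before it can be subtracted from both
    sides of the inequality that it satisfies.\<close>
  have bdd: "bdd_above (?v ` ?L)"
  proof (rule bdd_aboveI2)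
    fix \<mu> assume \<mu>: "\<mu> \<in> ?L"
    have "?v \<mu> \<le> (\<Sum>j\<in>F. Np (smul (of_real (\<mu> j) * c j) (s j)))" by (rule Np_sum)
    also have "\<dots> \<le> (\<Sum>j\<in>F. Np (smul (c j) (s j)))"
    proof (rule sum_mono)
      fix j
      have "norm (of_real (\<mu> j) * c j) powr p \<le> norm (c j) powr p"
        using \<mu> p_pos by (intro powr_mono2) (auto simp: norm_mult mult_left_le_one_le)
      then show "Np (smul (of_real (\<mu> j) * c j) (s j)) \<le> Np (smul (c j) (s j))"
        by (simp add: Np_scale mult_right_mono)
    qed
    finally show "?v \<mu> \<le> (\<Sum>j\<in>F. Np (smul (c j) (s j)))" .
  qed
  define M where "M = (SUP \<mu>\<in>?L. ?v \<mu>)"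
  have le_M: "?v \<mu> \<le> M" if "\<mu> \<in> ?L" for \<mu> unfolding M_def by (rule cSUP_upper[OF that bdd])
  have "?v \<mu> \<le> q * (2 * ?X + M)" if \<mu>: "\<mu> \<in> ?L" for \<mu>
  proof -
    \<comment> \<open>\<open>A\<close> collects the indices whose first binary digit is 1, and
      \<open>\<mu>'\<close> consists of the remaining digits: \<open>\<mu>\<close> is half of the
      indicator of \<open>A\<close> plus half of \<open>\<mu>'\<close>, which is again an admissible
      multiplier.\<close>
    define A where "A = {j \<in> F. \<mu> j \<ge> 1/2}"
    define \<mu>' where "\<mu>' j = (if j \<in> F then (if \<mu> j \<ge> 1/2 then 2 * \<mu> j - 1 else 2 * \<mu> j) else 0)" for j
    have \<mu>': "\<mu>' \<in> ?L" using \<mu> by (auto simp: \<mu>'_def)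
    have "(\<Sum>j\<in>F. smul (of_real (\<mu> j) * c j) (s j))
      = (\<Sum>j\<in>F. smul (1/2) ((if j \<in> A then smul (c j) (s j) else 0) + smul (of_real (\<mu>' j) * c j) (s j)))"
    proof (rule sum.cong)
      fix j assume "j \<in> F"
      have "\<mu> j = (1/2) * ((if j \<in> A then 1 else 0) + \<mu>' j)"
        using \<open>j \<in> F\<close> by (auto simp: A_def \<mu>'_def)
      then have "(of_real (\<mu> j) :: 'f) = of_real ((1/2) * ((if j \<in> A then 1 else 0) + \<mu>' j))"
        by (rule arg_cong)
      also have "\<dots> = (1/2) * ((if j \<in> A then 1 else 0) + of_real (\<mu>' j))" by simp
      finally have "of_real (\<mu> j) * c j = (1/2) * ((if j \<in> A then 1 else 0) + of_real (\<mu>' j)) * c j"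
        by (rule arg_cong)
      then have eq: "of_real (\<mu> j) * c j = (1/2) * ((if j \<in> A then c j else 0) + of_real (\<mu>' j) * c j)"
        by (cases "j \<in> A") (simp_all only: mult.assoc distrib_right if_True if_False mult_zero_left mult_1_left)
      then show "smul (of_real (\<mu> j) * c j) (s j)
        = smul (1/2) ((if j \<in> A then smul (c j) (s j) else 0) + smul (of_real (\<mu>' j) * c j) (s j))"
        by (cases "j \<in> A")
          (simp_all only: eq scale_scale[symmetric] scale_left_distrib if_True if_False scale_zero_left)
    qed simp
    also have "\<dots> = smul (1/2) ((\<Sum>j\<in>A. smul (c j) (s j)) + (\<Sum>j\<in>F. smul (of_real (\<mu>' j) * c j) (s j)))"
    proof -
      have "(\<Sum>j\<in>F. if j \<in> A then smul (c j) (s j) else 0) = (\<Sum>j\<in>A. smul (c j) (s j))"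
        using fin by (intro sum.mono_neutral_cong_right) (auto simp: A_def)
      then show ?thesis by (simp add: scale_sum_right[symmetric] sum.distrib)
    qed
    finally have "?v \<mu> = q * Np ((\<Sum>j\<in>A. smul (c j) (s j)) + (\<Sum>j\<in>F. smul (of_real (\<mu>' j) * c j) (s j)))"
      by (simp only: Np_scale q_def) (simp add: norm_divide)
    also have "\<dots> \<le> q * (2 * ?X + M)"
    proof (rule mult_left_mono)
      have "Np (\<Sum>j\<in>A. smul (c j) (s j)) \<le> 2 * ?X" using fin by (intro Np_subsum_le) (auto simp: A_def)
      then show "Np ((\<Sum>j\<in>A. smul (c j) (s j)) + (\<Sum>j\<in>F. smul (of_real (\<mu>' j) * c j) (s j))) \<le> 2 * ?X + M"
        using Np_add[of "\<Sum>j\<in>A. smul (c j) (s j)" "\<Sum>j\<in>F. smul (of_real (\<mu>' j) * c j) (s j)"] le_M[OF \<mu>']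
        by linarith
    qed (use q in simp)
    finally show ?thesis .
  qed
  moreover have "?L \<noteq> {}" by (auto intro: exI[of _ "\<lambda>_. 0"])
  ultimately have "(SUP \<mu>\<in>?L. ?v \<mu>) \<le> q * (2 * ?X + M)" by (rule cSUP_least[rotated])
  then have "M \<le> q * (2 * ?X + M)" by (simp only: M_def[symmetric])
  then have "M * (1 - q) \<le> 2 * q * ?X" by (simp add: algebra_simps)
  then have "M \<le> lattice_const * ?X"
    using q by (simp add: lattice_const_def q_def[symmetric] pos_le_divide_eq)
  then show ?thesis using le_M[of \<theta>] \<theta> by auto
qed

text \<open>Each \<open>d i\<close> is \<open>c i\<close> times a real factor in [0,1] times a
  scalar of modulus one; the latter is removed by sign invariance and the former by
  \<open>Np_real_multiplier\<close>.\<close>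

lemma Np_lattice:
  assumes fin: "finite F" and inj: "inj_on g F"
    and le: "\<And>i. i \<in> F \<Longrightarrow> norm (d i) \<le> norm (c i)"
  shows "Np (\<Sum>i\<in>F. smul (d i) (s (g i))) \<le> lattice_const * Np (\<Sum>i\<in>F. smul (c i) (s (g i)))"
proof -
  define \<theta> where "\<theta> i = (if i \<in> F \<and> d i \<noteq> 0 then norm (d i) / norm (c i) else 0)" for i
  define \<epsilon> where "\<epsilon> i = (if d i = 0 \<or> c i = 0 then 1 else d i * of_real (norm (c i)) / (c i * of_real (norm (d i))))" for i
  have \<theta>: "0 \<le> \<theta> i \<and> \<theta> i \<le> 1" for i
    using le[of i] by (auto simp: \<theta>_def divide_le_eq_1)
  have \<epsilon>: "norm (\<epsilon> i) = 1" for i by (simp add: \<epsilon>_def norm_mult norm_divide)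
  have d: "d i = \<epsilon> i * (of_real (\<theta> i) * c i)" if "i \<in> F" for i
    using le[OF that] that by (auto simp: \<epsilon>_def \<theta>_def)
  let ?h = "inv_into F g"
  have re: "(\<Sum>i\<in>F. smul (e i) (s (g i))) = (\<Sum>j\<in>g ` F. smul (e (?h j)) (s j))" for e
    using inj by (simp add: sum.reindex)
  have "Np (\<Sum>i\<in>F. smul (d i) (s (g i))) = Np (\<Sum>i\<in>F. smul (\<epsilon> i * (of_real (\<theta> i) * c i)) (s (g i)))"
    using d by (intro arg_cong[of _ _ Np] sum.cong) auto
  also have "\<dots> = Np (\<Sum>i\<in>F. smul (of_real (\<theta> i) * c i) (s (g i)))"
    by (rule Np_order_isometry[OF fin inj]) (use \<epsilon> in auto)
  also have "\<dots> \<le> lattice_const * Np (\<Sum>i\<in>F. smul (c i) (s (g i)))"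
    unfolding re using fin \<theta> by (intro Np_real_multiplier) auto
  finally show ?thesis .
qed

lemma Np_lattice_blocks:
  assumes fin: "finite K" "\<And>k. finite (A k)" and inj: "inj_on (\<lambda>(k, j). g k j) (Sigma K A)"
    and le: "\<And>k j. k \<in> K \<Longrightarrow> j \<in> A k \<Longrightarrow> norm (d k j) \<le> norm (c k j)"
  shows "Np (\<Sum>k\<in>K. \<Sum>j\<in>A k. smul (d k j) (s (g k j)))
    \<le> lattice_const * Np (\<Sum>k\<in>K. \<Sum>j\<in>A k. smul (c k j) (s (g k j)))"
proof -
  have "Np (\<Sum>i\<in>Sigma K A. smul (case_prod d i) (s (case_prod g i)))
    \<le> lattice_const * Np (\<Sum>i\<in>Sigma K A. smul (case_prod c i) (s (case_prod g i)))"
    using fin inj le by (intro Np_lattice) (auto simp: case_prod_unfold)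
  then show ?thesis using fin by (simp add: sum.Sigma case_prod_unfold)
qed

lemma Np_isometry_blocks:
  assumes fin: "finite K" "\<And>k. finite (A k)" and inj: "inj_on (\<lambda>(k, j). g k j) (Sigma K A)"
    and ord: "\<And>k j k' j'. k \<in> K \<Longrightarrow> j \<in> A k \<Longrightarrow> k' \<in> K \<Longrightarrow> j' \<in> A k' \<Longrightarrow> g k j < g k' j' \<Longrightarrow> h k j < h k' j'"
    and \<epsilon>: "\<And>k j. k \<in> K \<Longrightarrow> j \<in> A k \<Longrightarrow> norm (\<epsilon> k j :: 'f) = 1"
  shows "Np (\<Sum>k\<in>K. \<Sum>j\<in>A k. smul (\<epsilon> k j * c k j) (s (h k j)))
    = Np (\<Sum>k\<in>K. \<Sum>j\<in>A k. smul (c k j) (s (g k j)))"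
proof -
  have "Np (\<Sum>i\<in>Sigma K A. smul (case_prod \<epsilon> i * case_prod c i) (s (case_prod h i)))
    = Np (\<Sum>i\<in>Sigma K A. smul (case_prod c i) (s (case_prod g i)))"
    using fin inj ord \<epsilon> by (intro Np_order_isometry) (auto simp: case_prod_unfold)
  then show ?thesis using fin by (simp add: sum.Sigma case_prod_unfold)
qed

section \<open>Sequences with disjoint supports\<close>

lemma coord_indexed_sum:
  assumes "finite F" "inj_on g F" "i \<in> F"
  shows "co (g i) (\<Sum>i\<in>F. smul (c i) (s (g i))) = c i"
proof -
  have "(\<Sum>i\<in>F. smul (c i) (s (g i))) = (\<Sum>j\<in>g ` F. smul (c (inv_into F g j)) (s j))"
    using assms(2) by (simp add: sum.reindex)
  then show ?thesis using assms by (simp add: coord_finite_sum)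
qed

lemma coord_indexed_sum_other:
  assumes "finite F" "inj_on g F" "m \<notin> g ` F"
  shows "co m (\<Sum>i\<in>F. smul (c i) (s (g i))) = 0"
proof -
  have "(\<Sum>i\<in>F. smul (c i) (s (g i))) = (\<Sum>j\<in>g ` F. smul (c (inv_into F g j)) (s j))"
    using assms(2) by (simp add: sum.reindex)
  then show ?thesis using assms by (simp add: coord_finite_sum)
qed

lemma span_range_psum:
  assumes "w \<in> span (range y)"
  obtains a m where "w = psum a y m" "\<And>k. k \<ge> m \<Longrightarrow> a k = 0"
proof -
  have "\<exists>a m. w = psum a y m \<and> (\<forall>k\<ge>m. a k = 0)" using assms
  proof (induction rule: span_induct_alt)
    case base
    show ?case by (intro exI[of _ "\<lambda>_. 0"] exI[of _ 0]) simp
  next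
    case (step c x w)
    then obtain k a m where x: "x = y k" and w: "w = psum a y m" "\<forall>k\<ge>m. a k = 0" by blast
    let ?M = "max (Suc k) m" and ?b = "\<lambda>j. (if j = k then c else 0) + a j"
    have "psum a y ?M = psum a y m" using w(2) by (intro sum.mono_neutral_right) auto
    moreover have "psum (\<lambda>j. if j = k then c else 0) y ?M = smul c (y k)"
      by (simp add: if_distrib[of "\<lambda>c. smul c _"] less_max_iff_disj cong: if_cong)
    ultimately have "smul c x + w = psum ?b y ?M"
      by (simp add: x w(1) scale_left_distrib sum.distrib)
    then show ?case using w(2) by (intro exI[of _ ?b] exI[of _ ?M]) auto
  qed
  then show ?thesis using that by blast
qed

text \<open>Only disjointness of the supports is asked for, not that they follow one another, so
  that the result also covers permuted sequences. Switching off the coefficients of late blocks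
  costs \<open>lattice_const\<close>, which bounds the partial sum projections uniformly.\<close>

lemma blocks_basic_sequence:
  assumes fin: "\<And>k. finite (A k)" and inj: "inj_on (\<lambda>(k, j). g k j) (Sigma UNIV A)"
    and nz: "\<And>k. y k \<noteq> 0" and y: "\<And>k. y k = (\<Sum>j\<in>A k. smul (c k j) (s (g k j)))"
  shows "basic_sequence smul N y"
proof -
  let ?Y = "closed_span smul N y" and ?C = lattice_const
  have "\<exists>j\<in>A k. c k j \<noteq> 0" for k
  proof (rule ccontr)
    assume "\<not> ?thesis"
    then have "y k = 0" unfolding y by (intro sum.neutral) auto
    then show False using nz by blast
  qed
  then obtain i where i: "\<And>k. i k \<in> A k" "\<And>k. c k (i k) \<noteq> 0" by metis
  have psum_y: "psum a y n = (\<Sum>k<n. \<Sum>j\<in>A k. smul (a k * c k j) (s (g k j)))" for a n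
    by (simp add: y scale_sum_right)
  have injn: "inj_on (\<lambda>(k, j). g k j) (Sigma K A)" for K
    using inj by (rule inj_on_subset) auto
  have psum_y': "psum a y n = (\<Sum>kj\<in>Sigma {..<n} A. smul (a (fst kj) * c (fst kj) (snd kj)) (s ((\<lambda>(k, j). g k j) kj)))" for a n
    unfolding psum_y using fin by (simp add: sum.Sigma case_prod_unfold)
  \<comment> \<open>The coefficient of the \<open>k\<close>-th vector is recovered from one fixed
    nonzero entry of that vector.\<close>
  define f where "f k v = co (g k (i k)) v / c k (i k)" for k v
  have f_diff: "f k (u - v) = f k u - f k v" for k u v by (simp add: f_def coord_diff diff_divide_distrib)
  have f_psum: "f k (psum a y n) = (if k < n then a k else 0)" for k a n
  proof (cases "k < n")
    case True
    have "co (g k (i k)) (psum a y n) = a k * c k (i k)"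
      unfolding psum_y' using coord_indexed_sum[of "Sigma {..<n} A" "\<lambda>(k, j). g k j" "(k, i k)"
          "\<lambda>kj. a (fst kj) * c (fst kj) (snd kj)"] fin injn True i by simp
    then show ?thesis using True i by (simp add: f_def)
  next
    case False
    have "g k (i k) \<notin> (\<lambda>(k, j). g k j) ` Sigma {..<n} A"
    proof
      assume "g k (i k) \<in> (\<lambda>(k, j). g k j) ` Sigma {..<n} A"
      then obtain k' j' where kj': "k' < n" "j' \<in> A k'" "g k (i k) = g k' j'" by auto
      then have "(k, i k) = (k', j')" using inj_onD[OF inj, of "(k, i k)" "(k', j')"] i by auto
      then show False using kj'(1) False by simp
    qed
    then have "co (g k (i k)) (psum a y n) = 0"
      unfolding psum_y' using fin injn by (intro coord_indexed_sum_other) auto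
    then show ?thesis using False by (simp add: f_def)
  qed
  have f_bound: "\<exists>L\<ge>0. \<forall>v. norm (f k v) powr p \<le> L * Np v" for k
  proof (intro exI conjI allI)
    let ?L = "2 / (Np (s 0) * norm (c k (i k)) powr p)"
    have pos: "norm (c k (i k)) powr p > 0" using i by simp
    show "0 \<le> ?L" by simp
    fix v
    have "norm (f k v) powr p = norm (co (g k (i k)) v) powr p / norm (c k (i k)) powr p"
      by (simp add: f_def norm_divide powr_divide)
    then show "norm (f k v) powr p \<le> ?L * Np v"
      using coord_bound[of "g k (i k)" v] pos Np_s_pos by (simp add: field_simps)
  qed
  then obtain L where L: "\<And>k. L k \<ge> 0" "\<And>k v. norm (f k v) powr p \<le> L k * Np v" by metis
  define P where "P n v = psum (\<lambda>k. f k v) y n" for n v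
  have P_diff: "P n (u - v) = P n u - P n v" for n u v
    by (simp add: P_def f_diff scale_left_diff_distrib sum_subtractf)
  \<comment> \<open>A crude bound for \<open>P n\<close> that depends on \<open>n\<close>. It only
    provides the continuity needed to extend the uniform bound from the span to its closure.\<close>
  define K where "K n = (\<Sum>k<n. L k * Np (y k))" for n
  have K: "K n \<ge> 0" for n unfolding K_def using L by (intro sum_nonneg) auto
  have P_bound: "Np (P n v) \<le> K n * Np v" for n v
  proof -
    have "Np (P n v) \<le> (\<Sum>k<n. norm (f k v) powr p * Np (y k))"
      unfolding P_def by (rule order_trans[OF Np_sum]) (simp add: Np_scale)
    also have "\<dots> \<le> (\<Sum>k<n. L k * Np v * Np (y k))"
      using L by (intro sum_mono mult_right_mono) auto
    finally show ?thesis by (simp add: K_def sum_distrib_left mult_ac)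
  qed
  have P_psum: "P n (psum a y m) = psum a y n" if "\<And>k. k \<ge> m \<Longrightarrow> a k = 0" for n a m
    unfolding P_def f_psum using that by (intro sum.cong) auto
  have psum_ext: "psum a y n = psum a y m" if "\<And>k. k \<ge> m \<Longrightarrow> a k = 0" "n \<ge> m" for a n m
    using that by (intro sum.mono_neutral_right) auto
  have P_span: "Np (P n w) \<le> ?C * Np w" if w: "w \<in> span (range y)" for n w
  proof -
    obtain a m where a: "w = psum a y m" "\<And>k. k \<ge> m \<Longrightarrow> a k = 0" using span_range_psum[OF w] by blast
    have "psum a y n = (\<Sum>k<max n m. \<Sum>j\<in>A k. smul (if k < n then a k * c k j else 0) (s (g k j)))"
      unfolding psum_y by (intro sum.mono_neutral_cong_left) (auto simp: fin)
    also have "Np \<dots> \<le> ?C * Np (psum a y (max n m))"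
      unfolding psum_y using fin injn by (intro Np_lattice_blocks) auto
    finally show ?thesis using P_psum[OF a(2)] psum_ext[of m a "max n m", OF a(2)] a(1) by simp
  qed
  have P_closed: "Np (P n v) \<le> ?C * Np v" if v: "v \<in> ?Y" for n v
  proof (rule field_le_epsilon)
    fix e :: real assume e: "e > 0"
    let ?D = "K n + ?C + 1"
    have D: "?D > 0" using K[of n] lattice_const_pos by linarith
    then obtain w where w: "w \<in> span (range y)" "Np (v - w) < e / ?D"
      using v e unfolding closed_span_iff by (meson divide_pos_pos)
    have "Np (P n v) \<le> Np (P n w) + Np (P n (v - w))"
      using Np_le_diff[of "P n v" "P n w"] by (simp add: P_diff)
    also have "\<dots> \<le> ?C * Np w + K n * Np (v - w)" by (intro add_mono P_span P_bound w)
    also have "\<dots> \<le> ?C * (Np v + Np (v - w)) + K n * Np (v - w)"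
      using Np_le_diff[of w v] lattice_const_pos by (simp add: Np_minus_commute)
    also have "\<dots> = ?C * Np v + (K n + ?C) * Np (v - w)" by (simp add: algebra_simps)
    also have "(K n + ?C) * Np (v - w) \<le> ?D * Np (v - w)" by (intro mult_right_mono) auto
    also have "?D * Np (v - w) \<le> e" using w(2) D by (simp add: field_simps)
    finally show "Np (P n v) \<le> ?C * Np v + e" by simp
  qed
  have conv: "qsums smul N (\<lambda>k. f k v) y v" if v: "v \<in> ?Y" for v
    unfolding qsums_iff
  proof (rule LIMSEQ_I)
    fix e :: real assume e: "e > 0"
    have C: "?C + 1 > 0" using lattice_const_pos by simp
    then obtain w where w: "w \<in> span (range y)" "Np (v - w) < e / (?C + 1)"
      using v e unfolding closed_span_iff by (meson divide_pos_pos)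
    obtain a m where a: "w = psum a y m" "\<And>k. k \<ge> m \<Longrightarrow> a k = 0" using span_range_psum[OF w(1)] by blast
    have vw: "v - w \<in> ?Y" using closed_span_diff[OF v span_in_closed_span[OF w(1)]] .
    have "Np (P n v - v) < e" if "n \<ge> m" for n
    proof -
      have "P n w = w" using P_psum[OF a(2)] psum_ext[OF a(2) that] a(1) by simp
      then have "P n v - v = P n (v - w) - (v - w)" by (simp add: P_diff)
      then have "Np (P n v - v) \<le> Np (P n (v - w)) + Np (v - w)" by (simp only: Np_diff)
      also have "\<dots> \<le> (?C + 1) * Np (v - w)" using P_closed[OF vw, of n] by (simp add: distrib_right)
      also have "\<dots> < e" using w(2) C by (simp add: field_simps)
      finally show ?thesis .
    qed
    then show "\<exists>M. \<forall>n\<ge>M. norm (Np (psum (\<lambda>k. f k v) y n - v) - 0) < e" unfolding P_def by auto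
  qed
  have unique: "a = (\<lambda>k. f k v)" if a: "qsums smul N a y v" for a v
  proof
    fix k
    have "\<forall>\<^sub>F n in sequentially. norm (a k - f k v) powr p \<le> L k * Np (psum a y n - v)"
    proof (rule eventually_sequentiallyI[of "Suc k"])
      fix n assume "Suc k \<le> n"
      then have "a k - f k v = f k (psum a y n - v)" by (simp add: f_diff f_psum)
      then show "norm (a k - f k v) powr p \<le> L k * Np (psum a y n - v)" using L(2) by simp
    qed
    moreover have "(\<lambda>n. L k * Np (psum a y n - v)) \<longlonglongrightarrow> L k * 0"
      using a unfolding qsums_iff by (intro tendsto_mult tendsto_const)
    ultimately have "norm (a k - f k v) powr p \<le> L k * 0"
      by (intro tendsto_lowerbound[where F = sequentially]) auto
    then have "norm (a k - f k v) powr p = 0" by (intro antisym) auto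
    then show "a k = f k v" by simp
  qed
  have "range y \<subseteq> ?Y" using span_in_closed_span span_base by blast
  then show ?thesis
    unfolding basic_sequence_def schauder_basis_of_def using conv unique by blast
qed

text \<open>A permutation only relabels the disjoint supports.\<close>

lemma blocks_unconditional:
  assumes fin: "\<And>k. finite (A k)" and inj: "inj_on (\<lambda>(k, j). g k j) (Sigma UNIV A)"
    and nz: "\<And>k. y k \<noteq> 0" and y: "\<And>k. y k = (\<Sum>j\<in>A k. smul (c k j) (s (g k j)))"
  shows "unconditional_seq smul N y"
  unfolding unconditional_seq_def
proof (intro allI impI)
  fix \<sigma> :: "nat \<Rightarrow> nat" assume \<sigma>: "bij \<sigma>"
  show "basic_sequence smul N (y \<circ> \<sigma>)"
  proof (rule blocks_basic_sequence[where A = "A \<circ> \<sigma>" and g = "g \<circ> \<sigma>" and c = "c \<circ> \<sigma>"])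
    show "inj_on (\<lambda>(k, j). (g \<circ> \<sigma>) k j) (Sigma UNIV (A \<circ> \<sigma>))"
    proof (rule inj_onI, clarsimp)
      fix k j k' j' assume "j \<in> A (\<sigma> k)" "j' \<in> A (\<sigma> k')" "g (\<sigma> k) j = g (\<sigma> k') j'"
      then have "(\<sigma> k, j) = (\<sigma> k', j')" using inj_onD[OF inj, of "(\<sigma> k, j)" "(\<sigma> k', j')"] by auto
      then show "k = k' \<and> j = j'" using \<sigma> by (auto simp: bij_def dest: injD)
    qed
  qed (use fin nz y in auto)
qed

text \<open>The gap \<open>q k + k < q (Suc k)\<close> makes the \<open>k\<close>-th block longer
  than \<open>k\<close>, so that every place in the sorted coefficient lists is eventually
  occupied.\<close>

lemma subsymmetric_equivalent_blocks:
  assumes B: "subsymmetric_seq smul N B"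
  obtains c q \<delta> M where "strict_mono q" "\<And>k. q k + k < q (Suc k)" "\<delta> > 0"
    "\<And>k. \<delta> \<le> Np (\<Sum>j=q k..<q (Suc k). smul (c k j) (s j))"
    "\<And>k. Np (\<Sum>j=q k..<q (Suc k). smul (c k j) (s j)) \<le> M"
    "equivalent_seqs smul N B (\<lambda>k. \<Sum>j=q k..<q (Suc k). smul (c k j) (s j))"
proof -
  obtain K where K: "\<And>k. Np (B k) \<le> K" using subsymmetric_bounded[OF B] by blast
  obtain l where l: "l > 0" "\<And>k. l \<le> Np (B k)" using subsymmetric_bounded_below[OF B] by blast
  have co_le: "norm (co j (B k)) \<le> (2 * K / Np (s 0)) powr (1 / p)" for j k
  proof -
    have "norm (co j (B k)) powr p * Np (s 0) \<le> 2 * K"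
      using coord_bound[of j "B k"] K[of k] by linarith
    then have "norm (co j (B k)) powr p \<le> 2 * K / Np (s 0)"
      using Np_s_pos by (simp add: field_simps)
    then have "(norm (co j (B k)) powr p) powr (1 / p) \<le> (2 * K / Np (s 0)) powr (1 / p)"
      using p_pos by (intro powr_mono2) auto
    then show ?thesis using p_pos by (simp add: powr_powr)
  qed
  \<comment> \<open>Diagonal argument: the coordinates are uniformly bounded and the scalar field
    has finite dimension.\<close>
  obtain \<phi> :: "nat \<Rightarrow> nat" where \<phi>: "strict_mono \<phi>" "\<And>j. \<exists>l. (\<lambda>n. co j (B (\<phi> n))) \<longlonglongrightarrow> l"
    by (rule function_convergent_subsequence[of "UNIV :: nat set" "\<lambda>k j. co j (B k)"
          "(2 * K / Np (s 0)) powr (1 / p)"]) (use co_le in auto)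
  define x where "x i = B (\<phi> (2 * i)) - B (\<phi> (2 * i + 1))" for i
  have eq_x: "equivalent_seqs smul N B x"
    using subsymmetric_differences[OF B \<phi>(1)] by (simp add: x_def[abs_def])
  have co_null: "(\<lambda>i. co j (x i)) \<longlonglongrightarrow> 0" for j
  proof -
    obtain l where l: "(\<lambda>n. co j (B (\<phi> n))) \<longlonglongrightarrow> l" using \<phi>(2) by blast
    have "(\<lambda>i. co j (B (\<phi> (2 * i)))) \<longlonglongrightarrow> l" "(\<lambda>i. co j (B (\<phi> (2 * i + 1)))) \<longlonglongrightarrow> l"
      using LIMSEQ_subseq_LIMSEQ[OF l, of "\<lambda>i. 2 * i"] LIMSEQ_subseq_LIMSEQ[OF l, of "\<lambda>i. 2 * i + 1"]
      by (auto simp: o_def strict_mono_def)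
    from tendsto_diff[OF this] show ?thesis by (simp add: x_def coord_diff)
  qed
  obtain C where C: "C > 0" "\<And>c k l. k \<noteq> l \<Longrightarrow> norm c powr p * Np (B k) \<le> C * Np (smul c (B k - B l))"
    using basic_sequence_difference_lower[of B] B unfolding subsymmetric_seq_def by blast
  define \<delta> where "\<delta> = l / C"
  have \<delta>: "\<delta> > 0" using l C by (simp add: \<delta>_def)
  have x_lower: "\<delta> \<le> Np (x i)" for i
  proof -
    have "\<phi> (2 * i) \<noteq> \<phi> (2 * i + 1)"
      using \<phi>(1) by (metis less_add_one less_irrefl strict_mono_less)
    then have "Np (B (\<phi> (2 * i))) \<le> C * Np (x i)" using C(2)[of _ _ 1] by (simp add: x_def)
    then show ?thesis using l(2)[of "\<phi> (2 * i)"] C(1) by (simp add: \<delta>_def field_simps)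
  qed
  have x_upper: "Np (x i) \<le> 2 * K" for i
    using Np_diff[of "B (\<phi> (2 * i))" "B (\<phi> (2 * i + 1))"] K[of "\<phi> (2 * i)"] K[of "\<phi> (2 * i + 1)"]
    by (simp add: x_def)
  let ?h = "\<lambda>P i. psum (\<lambda>j. co j (x i)) s P"
  have head: "(\<lambda>i. Np (?h P i)) \<longlonglongrightarrow> 0" for P
  proof (rule tendsto_sandwich[OF _ _ tendsto_const])
    have "(\<lambda>i. norm (co j (x i)) powr p) \<longlonglongrightarrow> 0" for j
      by (rule tendsto_powr_zero[OF p_pos]) (use co_null[of j] in \<open>auto intro: tendsto_norm_zero\<close>)
    then have "(\<lambda>i. \<Sum>j<P. norm (co j (x i)) powr p * Np (s 0)) \<longlonglongrightarrow> (\<Sum>j<P. 0 * Np (s 0))"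
      by (intro tendsto_sum tendsto_mult tendsto_const)
    then show "(\<lambda>i. \<Sum>j<P. norm (co j (x i)) powr p * Np (s 0)) \<longlonglongrightarrow> 0" by simp
    show "\<forall>\<^sub>F i in sequentially. Np (?h P i) \<le> (\<Sum>j<P. norm (co j (x i)) powr p * Np (s 0))"
      by (intro always_eventually allI order_trans[OF Np_sum]) (simp add: Np_smul_s)
  qed auto
  \<comment> \<open>The two errors at stage \<open>k\<close> add up to \<open>2 * e k\<close>. This
    is summable, as the perturbation principle requires, and at most \<open>\<delta> / 2\<close>, so
    the blocks retain the lower bound \<open>\<delta> / 2\<close>.\<close>
  define e where "e k = \<delta> / 4 * (1 / 2) ^ k" for k :: nat
  have e: "e k > 0" for k using \<delta> by (simp add: e_def)
  \<comment> \<open>A state consists of an index into \<open>x\<close> and a bound below which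
    positions are used up. The next vector is one that is negligible below the old bound, and the
    new bound is one beyond which that vector is negligible.\<close>
  have "\<exists>st :: nat \<Rightarrow> nat \<times> nat. \<forall>k. True \<and> (fst (st k) < fst (st (Suc k)) \<and> snd (st k) + k < snd (st (Suc k)) \<and>
      Np (?h (snd (st k)) (fst (st (Suc k)))) < e k \<and>
      Np (?h (snd (st (Suc k))) (fst (st (Suc k))) - x (fst (st (Suc k)))) < e k)"
  proof (rule dependent_nat_choice)
    fix st :: "nat \<times> nat" and k :: nat
    obtain i P where st: "st = (i, P)" by (cases st)
    have "\<forall>\<^sub>F i' in sequentially. Np (?h P i') < e k" using head[of P] e[of k] by (rule order_tendstoD)
    then have "\<forall>\<^sub>F i' in sequentially. Np (?h P i') < e k \<and> i < i'"
      using eventually_gt_at_top[of i] by (rule eventually_conj)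
    then obtain i' where i': "Np (?h P i') < e k" "i < i'" by (auto simp: eventually_sequentially)
    have "(\<lambda>P'. Np (?h P' i' - x i')) \<longlonglongrightarrow> 0" using qsums_coord[of "x i'"] unfolding qsums_iff .
    then have "\<forall>\<^sub>F P' in sequentially. Np (?h P' i' - x i') < e k" using e[of k] by (rule order_tendstoD)
    then have "\<forall>\<^sub>F P' in sequentially. Np (?h P' i' - x i') < e k \<and> P + k < P'"
      using eventually_gt_at_top[of "P + k"] by (rule eventually_conj)
    then obtain P' where "Np (?h P' i' - x i') < e k" "P + k < P'" by (auto simp: eventually_sequentially)
    then show "\<exists>st'. True \<and> (fst st < fst st' \<and> snd st + k < snd st' \<and> Np (?h (snd st) (fst st')) < e k \<and>
        Np (?h (snd st') (fst st') - x (fst st')) < e k)"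
      using i' st by (intro exI[of _ "(i', P')"]) simp
  qed simp
  then obtain st :: "nat \<Rightarrow> nat \<times> nat" where st: "\<And>k. fst (st k) < fst (st (Suc k))"
    "\<And>k. snd (st k) + k < snd (st (Suc k))" "\<And>k. Np (?h (snd (st k)) (fst (st (Suc k)))) < e k"
    "\<And>k. Np (?h (snd (st (Suc k))) (fst (st (Suc k))) - x (fst (st (Suc k)))) < e k"
    by blast
  \<comment> \<open>Block \<open>k\<close> lies between the bounds of states \<open>k\<close> and
    \<open>Suc k\<close> and is cut from the vector of state \<open>Suc k\<close>; the initial state
    contributes only its bound.\<close>
  define \<psi> where "\<psi> k = fst (st (Suc k))" for k
  define q where "q k = snd (st k)" for k
  have \<psi>: "strict_mono \<psi>" using st(1) by (simp add: \<psi>_def strict_mono_Suc_iff)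
  have q_step: "q k + k < q (Suc k)" for k using st(2) by (simp add: q_def)
  have q: "strict_mono q" using q_step by (auto simp: strict_mono_Suc_iff intro: le_less_trans[OF le_add1])
  define y where "y k = (\<Sum>j=q k..<q (Suc k). smul (co j (x (\<psi> k))) (s j))" for k
  have close: "Np (x (\<psi> k) - y k) \<le> 2 * e k" for k
  proof -
    have "y k = ?h (q (Suc k)) (\<psi> k) - ?h (q k) (\<psi> k)"
      unfolding y_def using q by (intro psum_diff[symmetric]) (simp add: strict_mono_less_eq)
    then have "x (\<psi> k) - y k = ?h (q k) (\<psi> k) - (?h (q (Suc k)) (\<psi> k) - x (\<psi> k))" by simp
    then have "Np (x (\<psi> k) - y k) \<le> Np (?h (q k) (\<psi> k)) + Np (?h (q (Suc k)) (\<psi> k) - x (\<psi> k))"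
      by (simp only: Np_diff)
    then show ?thesis using st(3,4)[of k] by (simp add: q_def \<psi>_def)
  qed
  have e_le: "2 * e k \<le> \<delta> / 2" for k
    using \<delta> by (simp add: e_def mult_le_cancel_left1 power_le_one)
  show ?thesis
  proof (rule that[of q "\<delta> / 2" "\<lambda>k j. co j (x (\<psi> k))" "2 * K + \<delta> / 2"])
    fix k
    show "\<delta> / 2 \<le> Np (\<Sum>j=q k..<q (Suc k). smul (co j (x (\<psi> k))) (s j))"
      using Np_le_diff[of "x (\<psi> k)" "y k"] close[of k] e_le[of k] x_lower[of "\<psi> k"]
      unfolding y_def by linarith
    show "Np (\<Sum>j=q k..<q (Suc k). smul (co j (x (\<psi> k))) (s j)) \<le> 2 * K + \<delta> / 2"
      using Np_le_diff[of "y k" "x (\<psi> k)"] close[of k] e_le[of k] x_upper[of "\<psi> k"]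
      unfolding y_def[symmetric] by (simp add: Np_minus_commute)
  next
    have "summable (\<lambda>k. Np ((x \<circ> \<psi>) k - y k))"
    proof (rule summable_comparison_test')
      show "summable (\<lambda>k. 2 * e k)" unfolding e_def by (intro summable_mult summable_geometric) simp
      show "norm (Np ((x \<circ> \<psi>) k - y k)) \<le> 2 * e k" if "0 \<le> k" for k using close[of k] by simp
    qed
    then have "equivalent_seqs smul N (x \<circ> \<psi>) y"
      using \<delta> x_lower by (intro equivalent_perturb[of \<delta>]) auto
    then have "equivalent_seqs smul N B y"
      using equivalent_trans[OF equivalent_subsymmetric_subseq[OF B eq_x \<psi>]] by blast
    then show "equivalent_seqs smul N B (\<lambda>k. \<Sum>j=q k..<q (Suc k). smul (co j (x (\<psi> k))) (s j))"
      by (simp add: y_def[abs_def])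
  qed (use q q_step \<delta> in auto)
qed

end

section \<open>Seeds from sorted blocks\<close>

lemma obtain_decreasing_enumeration:
  fixes f :: "nat \<Rightarrow> real"
  assumes "finite F"
  obtains g where "bij_betw g {..<card F} F" "\<And>i j. i \<le> j \<Longrightarrow> j < card F \<Longrightarrow> f (g j) \<le> f (g i)"
proof -
  define xs where "xs = sort_key (\<lambda>j. - f j) (sorted_list_of_set F)"
  have xs: "distinct xs" "set xs = F" "sorted (map (\<lambda>j. - f j) xs)"
    using assms by (auto simp: xs_def)
  have len: "length xs = card F" using xs(1,2) distinct_card by force
  show ?thesis
  proof (rule that[of "(!) xs"])
    show "bij_betw ((!) xs) {..<card F} F" using xs len by (intro bij_betw_nth) auto
    show "f (xs ! j) \<le> f (xs ! i)" if "i \<le> j" "j < card F" for i j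
      using sorted_nth_mono[OF xs(3) that(1)] that len by simp
  qed
qed

text \<open>Encoding the relation by values 0 and 1 lets a single diagonal argument treat
  coefficients and order together: a convergent sequence of zeros and ones is eventually
  constant.\<close>

lemma convergent_pattern_subsequence:
  fixes \<alpha> :: "nat \<Rightarrow> nat \<Rightarrow> real" and R :: "nat \<Rightarrow> nat \<Rightarrow> nat \<Rightarrow> bool"
  assumes "\<And>k j. \<bar>\<alpha> k j\<bar> \<le> K"
  obtains \<psi> a lt where "strict_mono \<psi>" "\<And>j. (\<lambda>k. \<alpha> (\<psi> k) j) \<longlonglongrightarrow> a j"
    "\<And>i j. \<forall>\<^sub>F k in sequentially. R (\<psi> k) i j = lt i j"
proof -
  define f where "f k x = (case x of Inl j \<Rightarrow> \<alpha> k j | Inr (i, j) \<Rightarrow> of_bool (R k i j))" for k x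
  have "norm (f k x) \<le> max K 1" for k x
    using assms by (auto simp: f_def le_max_iff_disj split: sum.split)
  then obtain \<psi> where \<psi>: "strict_mono \<psi>" "\<And>x. \<exists>l. (\<lambda>k. f (\<psi> k) x) \<longlonglongrightarrow> l"
    by (rule function_convergent_subsequence[of UNIV f "max K 1", rotated]) auto
  then obtain l where l: "\<And>x. (\<lambda>k. f (\<psi> k) x) \<longlonglongrightarrow> l x" by metis
  show ?thesis
  proof (rule that[of \<psi> "\<lambda>j. l (Inl j)" "\<lambda>i j. l (Inr (i, j)) > 1/2"])
    show "(\<lambda>k. \<alpha> (\<psi> k) j) \<longlonglongrightarrow> l (Inl j)" for j using l[of "Inl j"] by (simp add: f_def)
    show "\<forall>\<^sub>F k in sequentially. R (\<psi> k) i j = (l (Inr (i, j)) > 1/2)" for i j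
    proof (cases "l (Inr (i, j)) > 1/2")
      case True
      have "\<forall>\<^sub>F k in sequentially. f (\<psi> k) (Inr (i, j)) > 1/2" by (rule order_tendstoD(1)[OF l True])
      then show ?thesis by eventually_elim (use True in \<open>auto simp: f_def of_bool_def split: if_splits\<close>)
    next
      case False
      then have "\<forall>\<^sub>F k in sequentially. f (\<psi> k) (Inr (i, j)) < 1" by (intro order_tendstoD(2)[OF l]) simp
      then show ?thesis by eventually_elim (use False in \<open>auto simp: f_def of_bool_def split: if_splits\<close>)
    qed
  qed (use \<psi> in simp)
qed

text \<open>The zero-based place at which \<open>n\<close> is inserted when it joins the indices
  below \<open>n\<close> arranged in the order \<open>lt\<close>.\<close>

definition rank_positioning :: "(nat \<Rightarrow> nat \<Rightarrow> bool) \<Rightarrow> nat \<Rightarrow> nat" where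
  "rank_positioning lt n = card {i. i < n \<and> lt i n}"

lemma positioning_rank: "positioning (rank_positioning lt)"
  unfolding positioning_def rank_positioning_def
proof
  fix n show "card {i. i < n \<and> lt i n} \<le> n" using card_mono[of "{..<n}" "{i. i < n \<and> lt i n}"] by auto
qed

context
  fixes lt :: "nat \<Rightarrow> nat \<Rightarrow> bool"
  assumes irrefl: "\<And>i. \<not> lt i i" and trans: "\<And>i j k. lt i j \<Longrightarrow> lt j k \<Longrightarrow> lt i k"
    and total: "\<And>i j. i \<noteq> j \<Longrightarrow> lt i j \<or> lt j i"
begin

lemma card_less_lt: "lt i j \<Longrightarrow> i < n \<Longrightarrow> card {k. k < n \<and> lt k i} < card {k. k < n \<and> lt k j}"
proof (rule psubset_card_mono)
  assume "lt i j" "i < n"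
  then have "{k. k < n \<and> lt k i} \<subseteq> {k. k < n \<and> lt k j}" "i \<in> {k. k < n \<and> lt k j}"
    using trans by auto
  moreover have "i \<notin> {k. k < n \<and> lt k i}" using irrefl by simp
  ultimately show "{k. k < n \<and> lt k i} \<subset> {k. k < n \<and> lt k j}" by blast
qed simp

text \<open>Inserting \<open>n\<close> raises by one exactly the ranks of the indices that follow
  it, which is the recursion of \<open>position_perm\<close>. Hence the permutations arrange every
  initial segment in the order \<open>lt\<close>.\<close>

lemma position_perm_rank:
  "j < n \<Longrightarrow> position_perm (rank_positioning lt) n j = card {i. i < n \<and> lt i j}"
proof (induction n)
  case (Suc n)
  show ?case
  proof (cases "j = n")
    case True
    have "{i. i < Suc n \<and> lt i n} = {i. i < n \<and> lt i n}" using irrefl by (auto simp: less_Suc_eq)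
    then show ?thesis using True by (simp add: rank_positioning_def)
  next
    case False
    then have j: "j < n" using Suc.prems by simp
    show ?thesis
    proof (cases "lt j n")
      case True
      then have "\<not> lt n j" using irrefl trans by blast
      then have "{i. i < Suc n \<and> lt i j} = {i. i < n \<and> lt i j}" by (auto simp: less_Suc_eq)
      then show ?thesis using Suc.IH[OF j] card_less_lt[OF True j] False by (simp add: rank_positioning_def)
    next
      case nlt: False
      then have lt: "lt n j" using total False by blast
      then have "{i. i < Suc n \<and> lt i j} = insert n {i. i < n \<and> lt i j}" by (auto simp: less_Suc_eq)
      then have "card {i. i < Suc n \<and> lt i j} = Suc (card {i. i < n \<and> lt i j})" by simp
      moreover have "card {i. i < n \<and> lt i n} \<le> card {i. i < n \<and> lt i j}"
        using trans lt by (intro card_mono) auto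
      ultimately show ?thesis using Suc.IH[OF j] False by (simp add: rank_positioning_def)
    qed
  qed
qed simp

lemma position_perm_rank_mono:
  "i < n \<Longrightarrow> j < n \<Longrightarrow> lt i j \<Longrightarrow> position_perm (rank_positioning lt) n i < position_perm (rank_positioning lt) n j"
  by (simp add: position_perm_rank card_less_lt)

lemma position_perm_rank_less:
  assumes "j < n" shows "position_perm (rank_positioning lt) n j < n"
proof -
  have "card {i. i < n \<and> lt i j} < card {..<n}"
    using assms irrefl by (intro psubset_card_mono) auto
  then show ?thesis using assms by (simp add: position_perm_rank)
qed

lemma position_perm_rank_inj: "inj_on (position_perm (rank_positioning lt) n) {..<n}"
  using total position_perm_rank_mono by (intro inj_onI) (metis lessThan_iff less_irrefl)

end

text \<open>
  The \<open>k\<close>-th block has the coefficients \<open>\<gamma> k 0, \<gamma> k 1, \<dots>\<close>, sorted by absolute value, at the positions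
  \<open>g k 0, g k 1, \<dots>\<close>; \<open>a\<close> and \<open>lt\<close> are the limits of the absolute values and of the order of the positions.
\<close>

locale sorted_blocks = subsymmetric_basis smul N p s
  for smul :: "'f::{real_normed_field, euclidean_space} \<Rightarrow> 'a::ab_group_add \<Rightarrow> 'a" and N p s +
  fixes B :: "nat \<Rightarrow> 'a" and n :: "nat \<Rightarrow> nat" and g :: "nat \<Rightarrow> nat \<Rightarrow> nat"
    and \<gamma> :: "nat \<Rightarrow> nat \<Rightarrow> 'f" and a :: "nat \<Rightarrow> real" and lt :: "nat \<Rightarrow> nat \<Rightarrow> bool"
    and \<delta> M :: real
  assumes subsymmetric_B: "subsymmetric_seq smul N B"
    and n_large: "\<And>k. k < n k"
    and g_inj: "\<And>k. inj_on (g k) {..<n k}"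
    and g_blocks: "\<And>k k' j j'. k < k' \<Longrightarrow> j < n k \<Longrightarrow> j' < n k' \<Longrightarrow> g k j < g k' j'"
    and \<gamma>_decreasing: "\<And>k i j. i \<le> j \<Longrightarrow> j < n k \<Longrightarrow> norm (\<gamma> k j) \<le> norm (\<gamma> k i)"
    and \<delta>_pos: "\<delta> > 0"
    and y_lower: "\<And>k. \<delta> \<le> Np (\<Sum>j<n k. smul (\<gamma> k j) (s (g k j)))"
    and y_upper: "\<And>k. Np (\<Sum>j<n k. smul (\<gamma> k j) (s (g k j))) \<le> M"
    and equivalent_y: "equivalent_seqs smul N B (\<lambda>k. \<Sum>j<n k. smul (\<gamma> k j) (s (g k j)))"
    and \<gamma>_limit: "\<And>j. (\<lambda>k. norm (\<gamma> k j)) \<longlonglongrightarrow> a j"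
    and pattern: "\<And>i j. \<forall>\<^sub>F k in sequentially. (g k i < g k j) = lt i j"
begin

abbreviation y :: "nat \<Rightarrow> 'a" where
  "y k \<equiv> \<Sum>j<n k. smul (\<gamma> k j) (s (g k j))"

abbreviation tail :: "nat \<Rightarrow> nat \<Rightarrow> real" where
  "tail k m \<equiv> Np (\<Sum>j=m..<n k. smul (\<gamma> k j) (s (g k j)))"

definition d :: "nat \<Rightarrow> nat" where "d = rank_positioning lt"

lemma eventually_n: "\<forall>\<^sub>F k in sequentially. m \<le> n k"
  by (rule eventually_sequentiallyI[of m]) (meson le_trans less_imp_le n_large)

lemma eventually_pattern: "\<forall>\<^sub>F k in sequentially. \<forall>i<m. \<forall>j<m. (g k i < g k j) = lt i j"
proof -
  have "\<forall>\<^sub>F k in sequentially. \<forall>ij\<in>{..<m} \<times> {..<m}. (g k (fst ij) < g k (snd ij)) = lt (fst ij) (snd ij)"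
    by (intro eventually_ball_finite ballI pattern) auto
  then show ?thesis by eventually_elim auto
qed

lemma a_nonneg: "0 \<le> a j"
  by (rule tendsto_lowerbound[OF \<gamma>_limit]) auto

lemma a_decseq: "decseq a"
proof (rule decseq_SucI)
  fix j
  have "\<forall>\<^sub>F k in sequentially. norm (\<gamma> k (Suc j)) \<le> norm (\<gamma> k j)"
    using eventually_n[of "Suc (Suc j)"] by eventually_elim (simp add: \<gamma>_decreasing)
  then show "a (Suc j) \<le> a j" by (intro tendsto_le[OF _ \<gamma>_limit \<gamma>_limit]) auto
qed

lemma lt_irrefl: "\<not> lt i i"
  using eventually_happens[OF pattern[of i i]] by simp

lemma lt_trans: assumes "lt i j" "lt j k" shows "lt i k"
proof -
  have "\<forall>\<^sub>F l in sequentially. lt i k" using pattern[of i j] pattern[of j k] pattern[of i k]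
    by eventually_elim (use assms in auto)
  then show ?thesis by simp
qed

text \<open>The two positions are distinct once the block is long enough to contain both indices, so
  one of the two comparisons holds in late blocks.\<close>

lemma lt_total: assumes "i \<noteq> j" shows "lt i j \<or> lt j i"
proof -
  have "\<forall>\<^sub>F l in sequentially. lt i j \<or> lt j i"
    using pattern[of i j] pattern[of j i] eventually_n[of "Suc (max i j)"]
  proof eventually_elim
    case (elim l)
    then have "i < n l" "j < n l" by auto
    then have "g l i \<noteq> g l j" using assms inj_onD[OF g_inj, of l i j] by auto
    then show ?case using elim by linarith
  qed
  then show ?thesis by simp
qed

lemma perm_mono: "i < m \<Longrightarrow> j < m \<Longrightarrow> lt i j \<Longrightarrow> position_perm d m i < position_perm d m j"
  unfolding d_def by (rule position_perm_rank_mono) (use lt_irrefl lt_trans lt_total in blast)+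

lemma perm_less: "j < m \<Longrightarrow> position_perm d m j < m"
  unfolding d_def by (rule position_perm_rank_less) (use lt_irrefl lt_trans lt_total in blast)+

lemma perm_inj: "inj_on (position_perm d m) {..<m}"
  unfolding d_def by (rule position_perm_rank_inj) (use lt_irrefl lt_trans lt_total in blast)+

lemma positioning_d: "positioning d"
  unfolding d_def by (rule positioning_rank)

lemma g_inj_all: "inj_on (\<lambda>(k, j). g k j) (Sigma K (\<lambda>k. {..<n k}))"
proof (rule inj_onI, clarsimp)
  fix k j k' j' assume *: "j < n k" "j' < n k'" "g k j = g k' j'"
  have "k = k'"
  proof (rule ccontr)
    assume "k \<noteq> k'"
    then consider "k < k'" | "k' < k" by linarith
    then show False using g_blocks[of k k' j j'] g_blocks[of k' k j' j] * by cases auto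
  qed
  then show "k = k' \<and> j = j'" using * g_inj[of k] by (auto dest: inj_onD)
qed

text \<open>Multiplication by phases is isometric on sums of basis vectors and replaces coefficients
  by their absolute values, for which alone a limit is available. The value at 0 is set to 1 to keep
  the modulus.\<close>

definition phase :: "'f \<Rightarrow> 'f" where
  "phase c = (if c = 0 then 1 else of_real (norm c) / c)"

lemma norm_phase: "norm (phase c) = 1"
  by (simp add: phase_def norm_divide)

lemma phase_mult: "phase c * c = of_real (norm c)"
  by (simp add: phase_def)

section \<open>Tails of the blocks and the limit seed\<close>

lemma tail_mono:
  assumes "m \<le> m'" shows "tail k m' \<le> lattice_const * tail k m"
proof -
  have "(\<Sum>j=m'..<n k. smul (\<gamma> k j) (s (g k j))) = (\<Sum>j=m..<n k. smul (if m' \<le> j then \<gamma> k j else 0) (s (g k j)))"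
    using assms by (intro sum.mono_neutral_cong_left) auto
  moreover have "inj_on (g k) {m..<n k}" using g_inj by (rule inj_on_subset) auto
  ultimately show ?thesis by (simp only:) (intro Np_lattice, auto)
qed

lemma tail_0: "tail k 0 = Np (y k)"
  by (simp add: atLeast0LessThan)

lemma tail_le: "tail k m \<le> lattice_const * M"
proof -
  have "tail k m \<le> lattice_const * tail k 0" by (rule tail_mono) simp
  also have "\<dots> \<le> lattice_const * M"
    using y_upper[of k] lattice_const_pos by (simp only: tail_0 mult_le_cancel_left_pos)
  finally show ?thesis .
qed

text \<open>In late blocks the first \<open>l\<close> positions are ordered as in \<open>lt\<close>,
  so they can be moved isometrically to those of the permutation, with phases removed. Cutting the
  tail at \<open>l\<close> costs \<open>lattice_const\<close>, and the coefficients then converge to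
  those of \<open>a\<close> with \<open>m\<close> and \<open>l\<close> fixed.\<close>

lemma limit_tail_le:
  assumes ev: "\<forall>\<^sub>F k in sequentially. tail k m \<le> e" and m: "m \<le> l"
  shows "Np (\<Sum>j=m..<l. smul (of_real (a j)) (s (position_perm d l j))) \<le> lattice_const * e"
proof (rule Np_limit_le)
  let ?X = "\<lambda>k. \<Sum>j=m..<l. smul (of_real (norm (\<gamma> k j))) (s (position_perm d l j))"
  show "(\<lambda>k. Np (?X k - (\<Sum>j=m..<l. smul (of_real (a j)) (s (position_perm d l j))))) \<longlonglongrightarrow> 0"
  proof (rule tendsto_sandwich[OF _ _ tendsto_const])
    have "(\<lambda>k. norm (of_real (norm (\<gamma> k j)) - of_real (a j) :: 'f) powr p) \<longlonglongrightarrow> 0" for j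
    proof (rule tendsto_powr_zero[OF p_pos])
      have "(\<lambda>k. (of_real (norm (\<gamma> k j)) :: 'f) - of_real (a j)) \<longlonglongrightarrow> of_real (a j) - of_real (a j)"
        by (intro tendsto_intros \<gamma>_limit)
      then show "(\<lambda>k. norm (of_real (norm (\<gamma> k j)) - of_real (a j) :: 'f)) \<longlonglongrightarrow> 0"
        by (intro tendsto_norm_zero) simp
    qed auto
    then have "(\<lambda>k. \<Sum>j=m..<l. norm (of_real (norm (\<gamma> k j)) - of_real (a j) :: 'f) powr p * Np (s 0))
        \<longlonglongrightarrow> (\<Sum>j=m..<l. 0 * Np (s 0))" by (intro tendsto_sum tendsto_mult tendsto_const)
    then show "(\<lambda>k. \<Sum>j=m..<l. norm (of_real (norm (\<gamma> k j)) - of_real (a j) :: 'f) powr p * Np (s 0)) \<longlonglongrightarrow> 0"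
      by simp
    show "\<forall>\<^sub>F k in sequentially. Np (?X k - (\<Sum>j=m..<l. smul (of_real (a j)) (s (position_perm d l j))))
        \<le> (\<Sum>j=m..<l. norm (of_real (norm (\<gamma> k j)) - of_real (a j) :: 'f) powr p * Np (s 0))"
    proof (intro always_eventually allI)
      fix k
      have "?X k - (\<Sum>j=m..<l. smul (of_real (a j)) (s (position_perm d l j)))
        = (\<Sum>j=m..<l. smul (of_real (norm (\<gamma> k j)) - of_real (a j)) (s (position_perm d l j)))"
        by (simp add: sum_subtractf scale_left_diff_distrib)
      then show "Np (?X k - (\<Sum>j=m..<l. smul (of_real (a j)) (s (position_perm d l j))))
        \<le> (\<Sum>j=m..<l. norm (of_real (norm (\<gamma> k j)) - of_real (a j) :: 'f) powr p * Np (s 0))"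
        by (simp only:) (rule order_trans[OF Np_sum], simp only: Np_smul_s order_refl)
    qed
  qed auto
  show "\<forall>\<^sub>F k in sequentially. Np (?X k) \<le> lattice_const * e"
    using ev eventually_n[of l] eventually_pattern[of l]
  proof eventually_elim
    case (elim k)
    have inj: "inj_on (g k) {m..<n k}" using g_inj by (rule inj_on_subset) auto
    have "?X k = (\<Sum>j=m..<l. smul (phase (\<gamma> k j) * \<gamma> k j) (s (position_perm d l j)))"
      by (simp only: phase_mult)
    also have "Np \<dots> = Np (\<Sum>j=m..<l. smul (\<gamma> k j) (s (g k j)))"
    proof (rule Np_order_isometry)
      show "inj_on (g k) {m..<l}" using inj by (rule inj_on_subset) (use elim in auto)
      show "position_perm d l i < position_perm d l j"
        if "i \<in> {m..<l}" "j \<in> {m..<l}" "g k i < g k j" for i j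
        using that elim by (intro perm_mono) auto
    qed (auto simp: norm_phase)
    also have "(\<Sum>j=m..<l. smul (\<gamma> k j) (s (g k j))) = (\<Sum>j=m..<n k. smul (if j < l then \<gamma> k j else 0) (s (g k j)))"
      using elim by (intro sum.mono_neutral_cong_left) auto
    also have "Np \<dots> \<le> lattice_const * tail k m" using inj by (intro Np_lattice) auto
    also have "\<dots> \<le> lattice_const * e" using elim lattice_const_pos by simp
    finally show ?case .
  qed
qed

end

context subsymmetric_basis
begin

text \<open>The order condition compares positions across blocks as well, so every finite segment
  keeps its norm whatever the outer coefficients are.\<close>

lemma blocks_equivalent:
  assumes fin: "\<And>k. finite (A k)" and inj: "inj_on (\<lambda>(k, j). g k j) (Sigma UNIV A)"
    and ord: "\<And>k j k' j'. j \<in> A k \<Longrightarrow> j' \<in> A k' \<Longrightarrow> g k j < g k' j' \<Longrightarrow> h k j < h k' j'"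
    and \<epsilon>: "\<And>k j. norm (\<epsilon> k j :: 'f) = 1"
  shows "equivalent_seqs smul N (\<lambda>k. \<Sum>j\<in>A k. smul (\<epsilon> k j * c k j) (s (h k j)))
    (\<lambda>k. \<Sum>j\<in>A k. smul (c k j) (s (g k j)))"
proof (rule equivalent_of_Np_eq)
  fix b :: "nat \<Rightarrow> 'f" and m l
  have "Np (\<Sum>k=m..<l. smul (b k) (\<Sum>j\<in>A k. smul (\<epsilon> k j * c k j) (s (h k j))))
      = Np (\<Sum>k=m..<l. \<Sum>j\<in>A k. smul (\<epsilon> k j * (b k * c k j)) (s (h k j)))"
    by (simp add: scale_sum_right mult.left_commute)
  also have "\<dots> = Np (\<Sum>k=m..<l. \<Sum>j\<in>A k. smul (b k * c k j) (s (g k j)))"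
  proof (rule Np_isometry_blocks)
    show "inj_on (\<lambda>(k, j). g k j) (Sigma {m..<l} A)" using inj by (rule inj_on_subset) auto
  qed (use fin ord \<epsilon> in auto)
  finally show "Np (\<Sum>k=m..<l. smul (b k) (\<Sum>j\<in>A k. smul (\<epsilon> k j * c k j) (s (h k j))))
      = Np (\<Sum>k=m..<l. smul (b k) (\<Sum>j\<in>A k. smul (c k j) (s (g k j))))"
    by (simp add: scale_sum_right)
qed

end

context sorted_blocks
begin

lemma y_subseq: "strict_mono \<psi> \<Longrightarrow> equivalent_seqs smul N B (\<lambda>l. y (\<psi> l))"
  using equivalent_subsymmetric_subseq[OF subsymmetric_B equivalent_y] by (simp add: o_def)

lemma g_inj_subseq:
  fixes \<psi> :: "nat \<Rightarrow> nat"
  assumes "strict_mono \<psi>"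
  shows "inj_on (\<lambda>(l, j). g (\<psi> l) j) (Sigma K (\<lambda>l. {..<n (\<psi> l)}))"
proof (rule inj_onI, clarsimp)
  fix l j l' j' assume "j < n (\<psi> l)" "j' < n (\<psi> l')" "g (\<psi> l) j = g (\<psi> l') j'"
  then have "(\<psi> l, j) = (\<psi> l', j')"
    using inj_onD[OF g_inj_all[of UNIV], of "(\<psi> l, j)" "(\<psi> l', j')"] by simp
  then show "l = l' \<and> j = j'" using strict_mono_imp_inj_on[OF assms] by (auto dest: injD)
qed

text \<open>The positions occurring in \<open>seed_seq\<close>, written as a doubly indexed family
  so that the results on disjoint supports apply.\<close>

definition shift :: "(nat \<Rightarrow> nat) \<Rightarrow> nat \<Rightarrow> nat \<Rightarrow> nat" where
  "shift \<nu> l j = (\<Sum>i<l. \<nu> i) + position_perm d (\<nu> l) j"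

lemma shift_less:
  assumes "l < l'" "j < \<nu> l" shows "shift \<nu> l j < shift \<nu> l' j'"
proof -
  have "shift \<nu> l j < (\<Sum>i<Suc l. \<nu> i)" using perm_less[OF assms(2)] by (simp add: shift_def)
  also have "\<dots> \<le> (\<Sum>i<l'. \<nu> i)" using assms(1) by (intro sum_mono2) auto
  finally show ?thesis by (simp add: shift_def)
qed

lemma shift_inj: "inj_on (\<lambda>(l, j). shift \<nu> l j) (Sigma UNIV (\<lambda>l. {..<\<nu> l}))"
proof (rule inj_onI, clarsimp)
  fix l j l' j' assume *: "j < \<nu> l" "j' < \<nu> l'" "shift \<nu> l j = shift \<nu> l' j'"
  have "l = l'"
  proof (rule ccontr)
    assume "l \<noteq> l'"
    then consider "l < l'" | "l' < l" by linarith
    then show False using shift_less[of l l' j \<nu> j'] shift_less[of l' l j' \<nu> j] * by cases auto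
  qed
  then show "l = l' \<and> j = j'" using * perm_inj[of "\<nu> l"] by (auto simp: shift_def dest: inj_onD)
qed

text \<open>Subsymmetry of the generated sequence is not derived from the seed but inherited from
  \<open>B\<close> through equivalence. Each of its terms is nonzero because it carries the
  coefficient \<open>b 0\<close>.\<close>

lemma generated_by_seedI:
  fixes b :: "nat \<Rightarrow> real"
  assumes E: "seed_E_inf smul N s (\<lambda>j. of_real (b j)) d = 0" and b: "b 0 \<noteq> 0"
    and \<nu>: "strict_mono \<nu>" "\<And>l. 1 \<le> \<nu> l"
    and eq: "equivalent_seqs smul N B (seed_seq smul s (\<lambda>j. of_real (b j)) d \<nu>)"
  shows "generated_by_seed smul N s (\<lambda>j. of_real (b j)) d B"
proof -
  let ?f = "\<lambda>j. of_real (b j) :: 'f" and ?w = "seed_seq smul s (\<lambda>j. of_real (b j)) d \<nu>"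
  have w: "?w l = (\<Sum>j\<in>{..<\<nu> l}. smul (?f j) (s (shift \<nu> l j)))" for l
    by (simp add: seed_seq_def shift_def)
  have nz: "?w l \<noteq> 0" for l
  proof
    assume 0: "?w l = 0"
    have "inj_on (shift \<nu> l) {..<\<nu> l}" using perm_inj[of "\<nu> l"] by (auto simp: inj_on_def shift_def)
    then have "co (shift \<nu> l 0) (?w l) = ?f 0"
      unfolding w by (rule coord_indexed_sum[rotated]) (use \<nu>(2)[of l] in auto)
    moreover have "co (shift \<nu> l 0) 0 = 0" using coord_finite_sum[of "{}"] by simp
    ultimately show False using 0 b by simp
  qed
  have "subsymmetric_seq smul N ?w"
  proof (rule subsymmetric_transfer[OF subsymmetric_B eq])
    show "basic_sequence smul N ?w"
      by (rule blocks_basic_sequence[OF _ shift_inj nz w]) simp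
    show "unconditional_seq smul N ?w"
      by (rule blocks_unconditional[OF _ shift_inj nz w]) simp
  qed
  moreover have "?f \<noteq> (\<lambda>_. 0)" using b by (metis of_real_eq_0_iff)
  moreover have "basic_sequence smul N B" using subsymmetric_B by (simp add: subsymmetric_seq_def)
  ultimately show ?thesis
    unfolding generated_by_seed_def using positioning_d E \<nu> eq by blast
qed

lemma seed_diff:
  assumes "m \<le> l"
  shows "seed_vec smul s f e l l - seed_vec smul s f e m l = (\<Sum>j=m..<l. smul (f j) (s (position_perm e l j)))"
  unfolding seed_vec_def using assms
  by (metis atLeast0LessThan diff_add_eq sum_diff_nat_ivl le0 lessThan_atLeast0)

text \<open>One bound on the tails beyond \<open>m\<close>, valid in late blocks, bounds the
  differences defining E_m for all lengths simultaneously.\<close>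

lemma small_tails_E_inf:
  assumes small: "\<And>e. e > 0 \<Longrightarrow> \<exists>m. \<forall>\<^sub>F k in sequentially. tail k m \<le> e"
  shows "seed_E_inf smul N s (\<lambda>j. of_real (a j)) d = 0"
proof -
  let ?f = "\<lambda>j. of_real (a j) :: 'f"
  have "seed_E_inf smul N s ?f d \<le> 0 + ennreal e" if e: "e > 0" for e
  proof -
    obtain m where m: "\<forall>\<^sub>F k in sequentially. tail k m \<le> e powr p / lattice_const"
      using small[of "e powr p / lattice_const"] e lattice_const_pos by auto
    have "seed_E smul N s ?f d m \<le> ennreal e"
      unfolding seed_E_def
    proof (rule SUP_least)
      fix l assume "l \<in> {n. m \<le> n \<and> 1 \<le> n}"
      then have l: "m \<le> l" by simp
      have "Np (seed_vec smul s ?f d l l - seed_vec smul s ?f d m l) \<le> e powr p"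
        using limit_tail_le[OF m l] lattice_const_pos by (simp add: seed_diff[OF l])
      then have "N (seed_vec smul s ?f d l l - seed_vec smul s ?f d m l) \<le> e"
        using e by (simp add: Np_le_iff)
      then show "ennreal (N (seed_vec smul s ?f d l l - seed_vec smul s ?f d m l)) \<le> ennreal e"
        by (rule ennreal_leI)
    qed
    moreover have "seed_E_inf smul N s ?f d \<le> seed_E smul N s ?f d m"
      unfolding seed_E_inf_def by (rule INF_lower) simp
    ultimately show ?thesis by simp
  qed
  then have "seed_E_inf smul N s ?f d \<le> 0" by (rule ennreal_le_epsilon)
  then show ?thesis by simp
qed

text \<open>First the lengths \<open>\<nu> l\<close> are chosen so that tails beyond them are
  eventually below \<open>(1/2) ^ l\<close>; then the block \<open>\<psi> l\<close> is chosen late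
  enough for its first \<open>\<nu> l\<close> entries to have the limiting order and nearly the
  limiting absolute values. The total error is summable.\<close>

lemma small_tails_generated:
  assumes small: "\<And>e. e > 0 \<Longrightarrow> \<exists>m. \<forall>\<^sub>F k in sequentially. tail k m \<le> e"
  shows "generated_by_seed smul N s (\<lambda>j. of_real (a j)) d B"
proof -
  let ?f = "\<lambda>j. of_real (a j) :: 'f"
  define P where "P l m \<longleftrightarrow> 1 \<le> m \<and> (\<forall>\<^sub>F k in sequentially. tail k m \<le> (1/2) ^ l)" for l m
  have "\<exists>m>K. P l m" for l K
  proof -
    obtain m where m: "\<forall>\<^sub>F k in sequentially. tail k m \<le> (1/2) ^ l / lattice_const"
      using small[of "(1/2) ^ l / lattice_const"] lattice_const_pos by auto
    have "\<forall>\<^sub>F k in sequentially. tail k (max m (Suc K)) \<le> (1/2) ^ l" using m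
    proof eventually_elim
      case (elim k)
      have "tail k (max m (Suc K)) \<le> lattice_const * tail k m" by (rule tail_mono) simp
      also have "\<dots> \<le> (1/2) ^ l" using elim lattice_const_pos by (simp add: field_simps)
      finally show ?case .
    qed
    then show ?thesis unfolding P_def by (intro exI[of _ "max m (Suc K)"]) auto
  qed
  then obtain \<nu> where "strict_mono \<nu>" "\<And>l. P l (\<nu> l)" using strict_mono_choice[of P] by blast
  then have \<nu>: "strict_mono \<nu>" "\<And>l. 1 \<le> \<nu> l"
    "\<And>l. \<forall>\<^sub>F k in sequentially. tail k (\<nu> l) \<le> (1/2) ^ l"
    unfolding P_def by blast+
  let ?r = "\<lambda>k m. Np (\<Sum>j<m. smul (of_real (norm (\<gamma> k j)) - ?f j) (s (g k j)))"
  have r_null: "(\<lambda>k. ?r k m) \<longlonglongrightarrow> 0" for m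
  proof (rule tendsto_sandwich[OF _ _ tendsto_const])
    have "(\<lambda>k. norm (of_real (norm (\<gamma> k j)) - ?f j) powr p) \<longlonglongrightarrow> 0" for j
    proof (rule tendsto_powr_zero[OF p_pos])
      have "(\<lambda>k. (of_real (norm (\<gamma> k j)) :: 'f) - ?f j) \<longlonglongrightarrow> ?f j - ?f j"
        by (intro tendsto_intros \<gamma>_limit)
      then show "(\<lambda>k. norm (of_real (norm (\<gamma> k j)) - ?f j)) \<longlonglongrightarrow> 0" by (intro tendsto_norm_zero) simp
    qed auto
    then have "(\<lambda>k. \<Sum>j<m. norm (of_real (norm (\<gamma> k j)) - ?f j) powr p * Np (s 0)) \<longlonglongrightarrow> (\<Sum>j<m. 0 * Np (s 0))"
      by (intro tendsto_sum tendsto_mult tendsto_const)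
    then show "(\<lambda>k. \<Sum>j<m. norm (of_real (norm (\<gamma> k j)) - ?f j) powr p * Np (s 0)) \<longlonglongrightarrow> 0" by simp
    show "\<forall>\<^sub>F k in sequentially. ?r k m \<le> (\<Sum>j<m. norm (of_real (norm (\<gamma> k j)) - ?f j) powr p * Np (s 0))"
      by (intro always_eventually allI order_trans[OF Np_sum]) (simp only: Np_smul_s order_refl)
  qed auto
  \<comment> \<open>The demands on the block chosen for length \<open>\<nu> l\<close>: small tail,
    sufficient length, limiting order and almost limiting coefficients on the first
    \<open>\<nu> l\<close> places.\<close>
  define Q where "Q l k \<longleftrightarrow> tail k (\<nu> l) \<le> (1/2) ^ l \<and> \<nu> l \<le> n k \<and>
      (\<forall>i<\<nu> l. \<forall>j<\<nu> l. (g k i < g k j) = lt i j) \<and> ?r k (\<nu> l) \<le> (1/2) ^ l" for l k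
  have "\<exists>k>K. Q l k" for l K
  proof -
    have "\<forall>\<^sub>F k in sequentially. ?r k (\<nu> l) < (1/2) ^ l" using r_null by (rule order_tendstoD) simp
    then have "\<forall>\<^sub>F k in sequentially. Q l k \<and> K < k"
      using \<nu>(3)[of l] eventually_n[of "\<nu> l"] eventually_pattern[of "\<nu> l"] eventually_gt_at_top[of K]
      unfolding Q_def by eventually_elim (use less_imp_le in blast)
    then show ?thesis using eventually_happens by fastforce
  qed
  then obtain \<psi> where \<psi>: "strict_mono \<psi>" and Q: "\<And>l. Q l (\<psi> l)" using strict_mono_choice[of Q] by blast
  \<comment> \<open>\<open>x\<close> is an intermediate sequence with the phases removed, isometric
    to the chosen blocks; \<open>w\<close> has the coefficients of the seed but still the positions
    of the blocks.\<close>
  define x where "x l = (\<Sum>j<n (\<psi> l). smul (of_real (norm (\<gamma> (\<psi> l) j))) (s (g (\<psi> l) j)))" for l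
  define w where "w l = (\<Sum>j<\<nu> l. smul (?f j) (s (g (\<psi> l) j)))" for l
  have x_phase: "x l = (\<Sum>j<n (\<psi> l). smul (phase (\<gamma> (\<psi> l) j) * \<gamma> (\<psi> l) j) (s (g (\<psi> l) j)))" for l
    unfolding x_def phase_mult ..
  have "Np (x l) = Np (y (\<psi> l))" for l
    unfolding x_phase by (rule Np_order_isometry) (use g_inj norm_phase in auto)
  then have x_lower: "\<delta> \<le> Np (x l)" for l using y_lower[of "\<psi> l"] by simp
  have close: "Np (x l - w l) \<le> 2 * (1/2) ^ l" for l
  proof -
    have le: "\<nu> l \<le> n (\<psi> l)" using Q unfolding Q_def by blast
    let ?t = "\<lambda>j. smul (of_real (norm (\<gamma> (\<psi> l) j))) (s (g (\<psi> l) j))"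
    have "x l = (\<Sum>j<\<nu> l. ?t j) + (\<Sum>j=\<nu> l..<n (\<psi> l). ?t j)"
      unfolding x_def using sum.atLeastLessThan_concat[of 0 "\<nu> l" "n (\<psi> l)" ?t] le by (simp add: atLeast0LessThan)
    then have "x l - w l = (\<Sum>j<\<nu> l. smul (of_real (norm (\<gamma> (\<psi> l) j)) - ?f j) (s (g (\<psi> l) j)))
        + (\<Sum>j=\<nu> l..<n (\<psi> l). ?t j)"
      by (simp add: w_def scale_left_diff_distrib sum_subtractf)
    then have "Np (x l - w l) \<le> ?r (\<psi> l) (\<nu> l) + Np (\<Sum>j=\<nu> l..<n (\<psi> l). ?t j)" by (simp only: Np_add)
    also have "(\<Sum>j=\<nu> l..<n (\<psi> l). ?t j)
        = (\<Sum>j=\<nu> l..<n (\<psi> l). smul (phase (\<gamma> (\<psi> l) j) * \<gamma> (\<psi> l) j) (s (g (\<psi> l) j)))"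
      unfolding phase_mult ..
    also have "Np \<dots> = tail (\<psi> l) (\<nu> l)"
    proof (rule Np_order_isometry)
      show "inj_on (g (\<psi> l)) {\<nu> l..<n (\<psi> l)}" using g_inj by (rule inj_on_subset) auto
    qed (auto simp: norm_phase)
    also have "?r (\<psi> l) (\<nu> l) + \<dots> \<le> 2 * (1/2) ^ l" using Q[of l] unfolding Q_def by linarith
    finally show ?thesis .
  qed
  have "equivalent_seqs smul N x (\<lambda>l. y (\<psi> l))"
    unfolding x_phase[abs_def]
    by (rule blocks_equivalent[where g = "\<lambda>l. g (\<psi> l)" and h = "\<lambda>l. g (\<psi> l)" and A = "\<lambda>l. {..<n (\<psi> l)}"
          and \<epsilon> = "\<lambda>l j. phase (\<gamma> (\<psi> l) j)" and c = "\<lambda>l. \<gamma> (\<psi> l)"])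
      (use g_inj_subseq[OF \<psi>] norm_phase in auto)
  then have "equivalent_seqs smul N B x"
    using equivalent_trans[OF y_subseq[OF \<psi>] equivalent_sym] by blast
  moreover have "equivalent_seqs smul N x w"
  proof (rule equivalent_perturb[OF \<delta>_pos x_lower])
    show "summable (\<lambda>l. Np (x l - w l))"
    proof (rule summable_comparison_test')
      show "summable (\<lambda>l. 2 * (1/2 :: real) ^ l)" by (intro summable_mult summable_geometric) simp
      show "norm (Np (x l - w l)) \<le> 2 * (1/2) ^ l" if "0 \<le> l" for l using close[of l] by simp
    qed
  qed
  moreover have "equivalent_seqs smul N (seed_seq smul s ?f d \<nu>) w"
  proof -
    have "equivalent_seqs smul N (\<lambda>l. \<Sum>j\<in>{..<\<nu> l}. smul (1 * ?f j) (s (shift \<nu> l j)))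
        (\<lambda>l. \<Sum>j\<in>{..<\<nu> l}. smul (?f j) (s (g (\<psi> l) j)))"
    proof (rule blocks_equivalent)
      have "\<nu> l \<le> n (\<psi> l)" for l using Q unfolding Q_def by blast
      then show "inj_on (\<lambda>(l, j). g (\<psi> l) j) (Sigma UNIV (\<lambda>l. {..<\<nu> l}))"
        by (intro inj_on_subset[OF g_inj_subseq[OF \<psi>, of UNIV]]) (auto intro: less_le_trans)
      fix l j l' j' assume j: "j \<in> {..<\<nu> l}" "j' \<in> {..<\<nu> l'}" and less: "g (\<psi> l) j < g (\<psi> l') j'"
      \<comment> \<open>Entries of different blocks are ordered by block index on both sides; within
        a block the pattern recorded in \<open>Q\<close> decides.\<close>
      consider "l < l'" | "l = l'" | "l' < l" by linarith
      then show "shift \<nu> l j < shift \<nu> l' j'"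
      proof cases
        case 1
        then show ?thesis using shift_less j by simp
      next
        case 2
        then have "lt j j'" using Q[of l] j less unfolding Q_def by auto
        then show ?thesis using 2 j perm_mono by (simp add: shift_def)
      next
        case 3
        then have "g (\<psi> l') j' < g (\<psi> l) j"
          using j \<open>\<And>l. \<nu> l \<le> n (\<psi> l)\<close> \<psi> by (intro g_blocks) (auto simp: strict_mono_less intro: less_le_trans)
        then show ?thesis using less by simp
      qed
    qed auto
    then show ?thesis by (simp add: seed_seq_def[abs_def] shift_def w_def[abs_def])
  qed
  ultimately have eq: "equivalent_seqs smul N B (seed_seq smul s ?f d \<nu>)"
    using equivalent_trans equivalent_sym by blast
  \<comment> \<open>If \<open>a 0\<close> vanished, so would all of \<open>a\<close> and every
    \<open>w l\<close>; then \<open>x l\<close> would tend to zero although it is bounded below by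
    \<delta>.\<close>
  have "a 0 \<noteq> 0"
  proof
    assume "a 0 = 0"
    then have "a j = 0" for j using a_nonneg[of j] decseqD[OF a_decseq, of 0 j] by simp
    then have "w l = 0" for l by (simp add: w_def)
    then have le: "\<delta> \<le> 2 * (1/2) ^ l" for l using x_lower[of l] close[of l] by simp
    have lim: "(\<lambda>l. 2 * (1/2 :: real) ^ l) \<longlonglongrightarrow> 2 * 0"
      by (intro tendsto_mult tendsto_const LIMSEQ_realpow_zero) auto
    have "\<delta> \<le> 2 * 0" by (rule tendsto_lowerbound[OF lim]) (use le in auto)
    then show False using \<delta>_pos by simp
  qed
  then show ?thesis using generated_by_seedI small_tails_E_inf[OF small] \<nu>(1,2) eq by blast
qed

end

section \<open>The case of a basis equivalent to that of c_0\<close>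

context subsymmetric_basis
begin

lemma Np_sum_s: "finite G \<Longrightarrow> Np (\<Sum>j\<in>G. s j) = Np (\<Sum>j<card G. s j)"
proof -
  assume "finite G"
  then obtain \<phi> where \<phi>: "strict_mono \<phi>" "\<phi> ` {..<card G} = G" by (rule strict_mono_enumerate_finite)
  have "inj_on \<phi> {..<card G}" using strict_mono_imp_inj_on[OF \<phi>(1)] by (rule inj_on_subset) (rule subset_UNIV)
  then have "(\<Sum>j\<in>G. s j) = (\<Sum>k<card G. smul (1 * 1) (s (\<phi> k)))"
    using \<phi>(2) sum.reindex[of \<phi> "{..<card G}" s] by simp
  also have "Np \<dots> = Np (psum (\<lambda>_. 1) s (card G))" by (rule Np_psum_isometry[OF _ \<phi>(1)]) simp
  finally show ?thesis by simp
qed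

text \<open>If the sums of the basis vectors are bounded, the basis is equivalent to the unit vector basis
  of \<open>c\<^sub>0\<close>, and so is every bounded block sequence that is bounded away from zero.\<close>

lemma blocks_equivalent_c0:
  assumes K: "\<And>m. Np (\<Sum>j<m. s j) \<le> K"
    and fin: "\<And>k. finite (A k)" and inj: "inj_on (\<lambda>(k, j). g k j) (Sigma UNIV A)"
    and y: "\<And>k. y k = (\<Sum>j\<in>A k. smul (c k j) (s (g k j)))"
    and c: "\<And>k j. j \<in> A k \<Longrightarrow> norm (c k j) powr p \<le> R"
    and \<delta>: "\<delta> > 0" "\<And>k. \<delta> \<le> Np (y k)"
  shows "conv b y \<longleftrightarrow> (\<lambda>k. norm (b k) powr p) \<longlonglongrightarrow> 0"
proof
  assume "conv b y"
  then have "(\<lambda>k. Np (smul (b k) (y k)) / \<delta>) \<longlonglongrightarrow> 0 / \<delta>"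
    using \<delta> by (intro tendsto_divide conv_terms_null) auto
  moreover have "\<forall>\<^sub>F k in sequentially. norm (b k) powr p \<le> Np (smul (b k) (y k)) / \<delta>"
    using \<delta> by (intro always_eventually allI) (simp add: Np_scale pos_le_divide_eq mult_left_mono)
  ultimately show "(\<lambda>k. norm (b k) powr p) \<longlonglongrightarrow> 0"
    by (intro tendsto_sandwich[of "\<lambda>_. 0" "\<lambda>k. norm (b k) powr p" sequentially "\<lambda>k. Np (smul (b k) (y k)) / \<delta>"])
      auto
next
  assume b: "(\<lambda>k. norm (b k) powr p) \<longlonglongrightarrow> 0"
  define K1 where "K1 = \<bar>K\<bar> + 1"
  define R1 where "R1 = \<bar>R\<bar> + 1"
  have K1: "K1 > 0" "Np (\<Sum>j<m. s j) \<le> K1" for m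
    using K[of m] unfolding K1_def by linarith+
  have R1: "R1 > 0" "j \<in> A k \<Longrightarrow> norm (c k j) powr p \<le> R1" for k j
    using c[of j k] unfolding R1_def by linarith+
  show "conv b y" unfolding conv_iff_Cauchy
  proof (intro allI impI)
    fix e :: real assume e: "e > 0"
    \<comment> \<open>All coefficients of the segment will be dominated by one scalar
      \<open>t\<close> with \<open>norm t powr p = \<tau>\<close>. The segment is then at most
      \<open>lattice_const\<close> times \<open>\<tau> * K1\<close>, and \<tau> makes this
      \<open>e / 2\<close>.\<close>
    define \<tau> where "\<tau> = e / (2 * lattice_const * K1)"
    have \<tau>: "\<tau> > 0" "lattice_const * (\<tau> * K1) = e / 2"
      using e K1(1) lattice_const_pos by (auto simp: \<tau>_def)
    have "\<forall>\<^sub>F k in sequentially. norm (b k) powr p < \<tau> / R1" using b \<tau> R1 by (intro order_tendstoD(2)) auto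
    then obtain L where L: "\<And>k. k \<ge> L \<Longrightarrow> norm (b k) powr p < \<tau> / R1"
      by (auto simp: eventually_sequentially)
    obtain t :: 'f where t: "norm t powr p = \<tau>" using exists_scalar[of \<tau>] \<tau> by auto
    have "Np (\<Sum>k=m..<l. smul (b k) (y k)) < e" if "m \<ge> L" for m l
    proof -
      have injm: "inj_on (\<lambda>(k, j). g k j) (Sigma {m..<l} A)" using inj by (rule inj_on_subset) auto
      have "(\<Sum>k=m..<l. smul (b k) (y k)) = (\<Sum>k=m..<l. \<Sum>j\<in>A k. smul (b k * c k j) (s (g k j)))"
        by (simp add: y scale_sum_right)
      also have "Np \<dots> \<le> lattice_const * Np (\<Sum>k=m..<l. \<Sum>j\<in>A k. smul t (s (g k j)))"
      proof (rule Np_lattice_blocks)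
        fix k j assume k: "k \<in> {m..<l}" and j: "j \<in> A k"
        have "norm (b k) powr p * norm (c k j) powr p \<le> \<tau> / R1 * R1"
          using L[of k] k that R1(2)[OF j] \<tau> R1(1) by (intro mult_mono) (auto intro: less_imp_le)
        then have "norm (b k) powr p * norm (c k j) powr p \<le> \<tau>" using R1(1) by simp
        then have "norm (b k * c k j) powr p \<le> norm t powr p" by (simp add: norm_mult powr_mult t)
        then show "norm (b k * c k j) \<le> norm t"
          using p_pos powr_less_mono2[of p "norm t" "norm (b k * c k j)"] by (meson norm_ge_zero not_le)
      qed (use fin injm in auto)
      also have "(\<Sum>k=m..<l. \<Sum>j\<in>A k. smul t (s (g k j)))
        = smul t (\<Sum>i\<in>(\<lambda>(k, j). g k j) ` Sigma {m..<l} A. s i)"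
        using fin injm by (simp add: sum.reindex scale_sum_right sum.Sigma case_prod_unfold)
      also have "Np \<dots> \<le> \<tau> * K1"
      proof -
        have "finite ((\<lambda>(k, j). g k j) ` Sigma {m..<l} A)" using fin by simp
        then show ?thesis
          unfolding Np_scale t by (subst Np_sum_s) (use K1 \<tau> in \<open>auto intro: mult_left_mono\<close>)
      qed
      finally show ?thesis using lattice_const_pos \<tau> e by (simp add: mult_left_mono)
    qed
    then show "\<exists>M. \<forall>m\<ge>M. \<forall>l\<ge>m. Np (\<Sum>k=m..<l. smul (b k) (y k)) < e" by blast
  qed
qed

end

context sorted_blocks
begin

lemma norm_\<gamma>_le: "j < n k \<Longrightarrow> norm (\<gamma> k j) powr p \<le> 2 * M / Np (s 0)"
proof -
  assume j: "j < n k"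
  have "co (g k j) (y k) = \<gamma> k j" by (rule coord_indexed_sum[OF _ g_inj]) (use j in auto)
  then have "norm (\<gamma> k j) powr p * Np (s 0) \<le> 2 * Np (y k)" using coord_bound by metis
  then have "norm (\<gamma> k j) powr p * Np (s 0) \<le> 2 * M" using y_upper[of k] by linarith
  then show ?thesis using Np_s_pos by (simp add: pos_le_divide_eq)
qed

text \<open>Taking \<open>m = 0\<close> in \<open>limit_tail_le\<close> bounds the sums with
  coefficients \<open>a j\<close> uniformly in their length; lowering these coefficients to the
  constant \<open>t\<close> costs \<open>lattice_const\<close> once more, and the norm of a sum of
  basis vectors depends only on how many there are.\<close>

lemma sums_bounded:
  assumes t: "t > 0" "\<And>j. t \<le> a j"
  obtains K where "\<And>m. Np (\<Sum>j<m. s j) \<le> K"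
proof -
  let ?C = lattice_const
  have "Np (\<Sum>j<m. s j) \<le> ?C * (?C * M) / t powr p" for m
  proof -
    have inj: "inj_on (position_perm d m) {..<m}" by (rule perm_inj)
    have "Np (\<Sum>j=0..<m. smul (of_real t) (s (position_perm d m j)))
      \<le> ?C * Np (\<Sum>j=0..<m. smul (of_real (a j)) (s (position_perm d m j)))"
      using t a_nonneg inj by (intro Np_lattice) (auto simp: atLeast0LessThan)
    also have "Np (\<Sum>j=0..<m. smul (of_real (a j)) (s (position_perm d m j))) \<le> ?C * M"
      by (rule limit_tail_le) (use y_upper in \<open>auto simp: tail_0\<close>)
    also have "(\<Sum>j=0..<m. smul (of_real t) (s (position_perm d m j)))
      = smul (of_real t) (\<Sum>i\<in>position_perm d m ` {..<m}. s i)"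
      using inj by (simp add: sum.reindex scale_sum_right atLeast0LessThan)
    finally have "t powr p * Np (\<Sum>i\<in>position_perm d m ` {..<m}. s i) \<le> ?C * (?C * M)"
      using t lattice_const_pos by (simp add: Np_scale)
    then have "t powr p * Np (\<Sum>j<m. s j) \<le> ?C * (?C * M)"
      by (subst (asm) Np_sum_s) (simp_all only: card_image[OF inj] card_lessThan finite_imageI finite_lessThan)
    then show ?thesis using t by (simp add: pos_le_divide_eq mult.commute)
  qed
  then show ?thesis using that by blast
qed

text \<open>The limit sequence cannot serve here, since coefficients at least \<open>t\<close> keep
  its E_infinity positive. With the seed (1,0,0,...) every generated term is a single basis vector
  and E_1 is zero; this sequence and \<open>B\<close> have the same convergent series as the unit
  vectors of c_0.\<close>

lemma c0_generated:
  assumes t: "t > 0" "\<And>j. t \<le> a j"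
  defines "b \<equiv> \<lambda>j::nat. if j = 0 then 1 else (0::real)"
  shows "generated_by_seed smul N s (\<lambda>j. of_real (b j)) d B"
proof (rule generated_by_seedI)
  let ?f = "\<lambda>j. of_real (b j) :: 'f" and ?w = "seed_seq smul s (\<lambda>j. of_real (b j)) d Suc"
  have "seed_E smul N s ?f d 1 = 0"
  proof -
    have "seed_vec smul s ?f d l l - seed_vec smul s ?f d 1 l = 0" if "1 \<le> l" for l
      unfolding seed_diff[OF that] by (intro sum.neutral) (auto simp: b_def)
    then have "seed_E smul N s ?f d 1 \<le> 0" unfolding seed_E_def by (intro SUP_least) simp
    then show ?thesis by simp
  qed
  moreover have "seed_E_inf smul N s ?f d \<le> seed_E smul N s ?f d 1"
    unfolding seed_E_inf_def by (rule INF_lower) simp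
  ultimately show "seed_E_inf smul N s ?f d = 0" by simp
  obtain K where K: "\<And>m. Np (\<Sum>j<m. s j) \<le> K" by (rule sums_bounded[OF t]) blast
  have "conv x y \<longleftrightarrow> (\<lambda>k. norm (x k) powr p) \<longlonglongrightarrow> 0" for x
    by (rule blocks_equivalent_c0[OF K _ g_inj_all refl norm_\<gamma>_le \<delta>_pos y_lower]) auto
  moreover have "conv x ?w \<longleftrightarrow> (\<lambda>k. norm (x k) powr p) \<longlonglongrightarrow> 0" for x
  proof (rule blocks_equivalent_c0[OF K _ shift_inj _ _ Np_s_pos])
    show w: "?w l = (\<Sum>j\<in>{..<Suc l}. smul (?f j) (s (shift Suc l j)))" for l
      by (simp add: seed_seq_def shift_def)
    show "norm (?f j) powr p \<le> 1" for j by (simp add: b_def)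
    have "(\<Sum>j\<in>{..<Suc l}. smul (?f j) (s (shift Suc l j))) = (\<Sum>j\<in>{0}. smul (?f j) (s (shift Suc l j)))" for l
      by (intro sum.mono_neutral_right) (auto simp: b_def)
    then have "?w l = s (shift Suc l 0)" for l unfolding w by (simp add: b_def)
    then show "Np (s 0) \<le> Np (?w l)" for l using Np_s[of "shift Suc l 0"] by simp
  qed simp
  ultimately have "equivalent_seqs smul N y ?w" by (simp add: equivalent_seqs_def)
  then show "equivalent_seqs smul N B ?w" by (rule equivalent_trans[OF equivalent_y])
qed (auto simp: b_def strict_mono_def)

section \<open>Uniformly null blocks and the final case distinction\<close>

lemma coord_supp_blocks:
  assumes "inj_on u F" "finite F"
  shows "coord_supp smul N s (\<Sum>j\<in>F. smul (c j) (s (u j))) \<subseteq> u ` F"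
proof
  fix m assume "m \<in> coord_supp smul N s (\<Sum>j\<in>F. smul (c j) (s (u j)))"
  then show "m \<in> u ` F" using coord_indexed_sum_other[OF assms(2,1), of m c] by (auto simp: coord_supp_def)
qed

lemma block_basic_y: "block_basic_sequence smul N s y"
  unfolding block_basic_sequence_def
proof (intro conjI allI ballI)
  fix k
  show "y k \<noteq> 0" using y_lower[of k] \<delta>_pos by (metis Np_pos_iff less_le_trans)
  fix i j assume "i \<in> coord_supp smul N s (y k)" "j \<in> coord_supp smul N s (y (Suc k))"
  then have "i \<in> g k ` {..<n k}" "j \<in> g (Suc k) ` {..<n (Suc k)}"
    using coord_supp_blocks[OF g_inj] by blast+
  then show "i < j" using g_blocks[of k "Suc k"] by auto
qed

text \<open>Pick \<open>m\<close> with \<open>a m\<close> small, then a late block whose coefficient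
  at \<open>m\<close> is small and whose tail beyond \<open>m\<close> is still large. By the
  sorting, all coefficients of that tail are small. Tails are restrictions of blocks, hence
  dominated by \<open>B\<close>.\<close>

lemma large_tails_blocks:
  assumes \<epsilon>: "\<epsilon> > 0" and large: "\<And>m. \<exists>\<^sub>F k in sequentially. \<epsilon> < tail k m"
    and null: "\<And>t. t > 0 \<Longrightarrow> \<exists>m. a m < t"
  obtains z where "block_basic_sequence smul N s z" "semi_normalized N z" "uniformly_null smul N s z"
    "dominates smul N B z"
proof -
  define P where "P l k \<longleftrightarrow> (\<exists>m<n k. \<epsilon> < tail k m \<and> norm (\<gamma> k m) < (1/2) ^ l)" for l k
  have "\<exists>k>K. P l k" for l K
  proof -
    obtain m where m: "a m < (1/2) ^ l" using null[of "(1/2) ^ l"] by auto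
    have ev: "\<forall>\<^sub>F k in sequentially. norm (\<gamma> k m) < (1/2) ^ l \<and> Suc m \<le> n k \<and> K < k"
      by (intro eventually_conj order_tendstoD(2)[OF \<gamma>_limit m] eventually_n eventually_gt_at_top)
    \<comment> \<open>Tails are large only for infinitely many \<open>k\<close>, whereas the other
      conditions hold for all late \<open>k\<close>; both can therefore be met together.\<close>
    have "\<exists>\<^sub>F k in sequentially. \<epsilon> < tail k m \<and> norm (\<gamma> k m) < (1/2) ^ l \<and> Suc m \<le> n k \<and> K < k"
      using frequently_eventually_frequently[OF large ev] .
    then obtain k where "\<epsilon> < tail k m \<and> norm (\<gamma> k m) < (1/2) ^ l \<and> Suc m \<le> n k \<and> K < k"
      using frequently_ex by blast
    then show ?thesis unfolding P_def by (intro exI[of _ k] conjI exI[of _ m]) auto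
  qed
  then obtain \<psi> where \<psi>: "strict_mono \<psi>" and P: "\<And>l. P l (\<psi> l)" using strict_mono_choice[of P] by blast
  have "\<exists>\<mu>. \<forall>l. \<mu> l < n (\<psi> l) \<and> \<epsilon> < tail (\<psi> l) (\<mu> l) \<and> norm (\<gamma> (\<psi> l) (\<mu> l)) < (1/2) ^ l"
    using P unfolding P_def by (intro choice) blast
  then obtain \<mu> where \<mu>: "\<And>l. \<mu> l < n (\<psi> l)" "\<And>l. \<epsilon> < tail (\<psi> l) (\<mu> l)"
    "\<And>l. norm (\<gamma> (\<psi> l) (\<mu> l)) < (1/2) ^ l"
    by blast
  define z where "z l = (\<Sum>j=\<mu> l..<n (\<psi> l). smul (\<gamma> (\<psi> l) j) (s (g (\<psi> l) j)))" for l
  have inj: "inj_on (g (\<psi> l)) {\<mu> l..<n (\<psi> l)}" for l using g_inj by (rule inj_on_subset) auto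
  have z_lower: "\<epsilon> < Np (z l)" for l using \<mu>(2) by (simp add: z_def)
  have z_upper: "Np (z l) \<le> lattice_const * M" for l unfolding z_def by (rule tail_le)
  have "block_basic_sequence smul N s z"
    unfolding block_basic_sequence_def
  proof (intro conjI allI ballI)
    fix l
    show "z l \<noteq> 0" using z_lower[of l] \<epsilon> by (metis Np_pos_iff less_trans)
    fix i j assume "i \<in> coord_supp smul N s (z l)" "j \<in> coord_supp smul N s (z (Suc l))"
    then have "i \<in> g (\<psi> l) ` {\<mu> l..<n (\<psi> l)}" "j \<in> g (\<psi> (Suc l)) ` {\<mu> (Suc l)..<n (\<psi> (Suc l))}"
      using coord_supp_blocks[OF inj] unfolding z_def by blast+
    then show "i < j" using g_blocks[of "\<psi> l" "\<psi> (Suc l)"] \<psi> by (auto simp: strict_mono_Suc_iff)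
  qed
  moreover have "semi_normalized N z"
    unfolding semi_normalized_def
  proof
    have "\<epsilon> powr (1 / p) \<le> N (z l)" for l
      using z_lower[of l] \<epsilon> p_pos by (subst N_eq_Np) (auto intro: powr_mono2)
    then have "\<epsilon> powr (1 / p) \<le> (INF l. N (z l))" by (intro cINF_greatest) auto
    moreover have "\<epsilon> powr (1 / p) > 0" using \<epsilon> by simp
    ultimately show "0 < (INF l. N (z l))" by linarith
    show "bdd_above (range (\<lambda>l. N (z l)))"
    proof (rule bdd_aboveI2)
      show "N (z l) \<le> (lattice_const * M) powr (1 / p)" for l
        using z_upper[of l] p_pos by (subst N_eq_Np) (auto intro: powr_mono2)
    qed
  qed
  moreover have "uniformly_null smul N s z"
    unfolding uniformly_null_def
  proof (rule tendsto_sandwich[OF _ _ tendsto_const])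
    have co: "norm (co i (z l)) \<le> (1/2) ^ l" for i l
    proof (cases "i \<in> g (\<psi> l) ` {\<mu> l..<n (\<psi> l)}")
      case True
      then obtain j where j: "i = g (\<psi> l) j" "\<mu> l \<le> j" "j < n (\<psi> l)" by auto
      have "co i (z l) = \<gamma> (\<psi> l) j"
        unfolding z_def j(1) by (rule coord_indexed_sum[OF _ inj]) (use j in auto)
      then show ?thesis using \<gamma>_decreasing[OF j(2,3)] \<mu>(3)[of l] by simp
    next
      case False
      then have "co i (z l) = 0" unfolding z_def by (intro coord_indexed_sum_other[OF _ inj]) auto
      then show ?thesis by simp
    qed
    show "\<forall>\<^sub>F l in sequentially. (SUP i. ennreal (norm (co i (z l)))) \<le> ennreal ((1/2) ^ l)"
      using co by (intro always_eventually allI SUP_least ennreal_leI)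
    have "(\<lambda>l. (1/2 :: real) ^ l) \<longlonglongrightarrow> 0" by (intro LIMSEQ_realpow_zero) auto
    then show "(\<lambda>l. ennreal ((1/2) ^ l)) \<longlonglongrightarrow> 0" using tendsto_ennrealI by fastforce
  qed auto
  moreover have "dominates smul N B z"
  proof (rule dominates_of_conv)
    show "basic_sequence smul N B" using subsymmetric_B by (simp add: subsymmetric_seq_def)
    fix b assume "conv b B"
    then have "conv b (\<lambda>l. y (\<psi> l))" using y_subseq[OF \<psi>] by (simp add: equivalent_seqs_def)
    then show "conv b z"
    proof (rule conv_transfer[where C = lattice_const])
      fix m l
      \<comment> \<open>Writing the tail as the full block with its leading coefficients replaced by
        zero makes it comparable with \<open>y (\<psi> k)\<close> term by term.\<close>
      have "z k = (\<Sum>j<n (\<psi> k). smul (if \<mu> k \<le> j then \<gamma> (\<psi> k) j else 0) (s (g (\<psi> k) j)))" for k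
        unfolding z_def by (intro sum.mono_neutral_cong_left) auto
      then have "Np (\<Sum>k=m..<l. smul (b k) (z k))
        = Np (\<Sum>k=m..<l. \<Sum>j<n (\<psi> k). smul (b k * (if \<mu> k \<le> j then \<gamma> (\<psi> k) j else 0)) (s (g (\<psi> k) j)))"
        by (simp add: scale_sum_right)
      also have "\<dots> \<le> lattice_const * Np (\<Sum>k=m..<l. \<Sum>j<n (\<psi> k). smul (b k * \<gamma> (\<psi> k) j) (s (g (\<psi> k) j)))"
        by (rule Np_lattice_blocks) (use g_inj_subseq[OF \<psi>] in auto)
      finally show "Np (\<Sum>k=m..<l. smul (b k) (z k)) \<le> lattice_const * Np (\<Sum>k=m..<l. smul (b k) (y (\<psi> k)))"
        by (simp add: scale_sum_right)
    qed
  qed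
  ultimately show ?thesis using that by blast
qed

lemma seed_or_blocks:
  "(\<exists>(b :: nat \<Rightarrow> real) e B'.
      positioning e \<and> (\<forall>j. 0 \<le> b j) \<and> decseq b \<and>
      seed_E_inf smul N s (\<lambda>j. of_real (b j)) e = 0 \<and>
      generated_by_seed smul N s (\<lambda>j. of_real (b j)) e B' \<and>
      equivalent_seqs smul N B B') \<or>
   ((\<exists>y. block_basic_sequence smul N s y \<and> equivalent_seqs smul N B y) \<and>
    (\<exists>z. block_basic_sequence smul N s z \<and> semi_normalized N z \<and>
         uniformly_null smul N s z \<and> dominates smul N B z))"
  (is "?seed \<or> ?blocks")
proof -
  \<comment> \<open>\<open>B\<close> itself is taken for \<open>B'\<close>, because being generated
    by a seed is already stated up to equivalence.\<close>
  have seedI: ?seed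
    if "\<And>j. 0 \<le> b j" "decseq b" "generated_by_seed smul N s (\<lambda>j. of_real (b j)) d B" for b
    using that positioning_d
    by (intro exI[of _ b] exI[of _ d] exI[of _ B]) (simp add: generated_by_seed_def equivalent_seqs_def)
  \<comment> \<open>The third case negates the first two: some \<epsilon> defeats every cut
    \<open>m\<close>, and the decreasing sequence \<open>a\<close> has limit zero.\<close>
  consider "\<And>e. e > 0 \<Longrightarrow> \<exists>m. \<forall>\<^sub>F k in sequentially. tail k m \<le> e"
    | t where "t > 0" "\<And>j. t \<le> a j"
    | \<epsilon> where "\<epsilon> > 0" "\<And>m. \<not> (\<forall>\<^sub>F k in sequentially. tail k m \<le> \<epsilon>)" "\<And>t. t > 0 \<Longrightarrow> \<exists>m. a m < t"
    by (meson not_le)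
  then show ?thesis
  proof cases
    case 1
    then show ?thesis using seedI a_nonneg a_decseq small_tails_generated by blast
  next
    case 2
    have "decseq (\<lambda>j::nat. if j = 0 then 1 else (0::real))" by (auto simp: decseq_def)
    then show ?thesis using seedI[OF _ _ c0_generated[OF 2]] by simp
  next
    case 3
    have freq: "\<exists>\<^sub>F k in sequentially. \<epsilon> < tail k m" for m
      using 3(2)[of m] by (simp add: not_eventually not_le)
    obtain z where "block_basic_sequence smul N s z" "semi_normalized N z" "uniformly_null smul N s z"
      "dominates smul N B z"
      by (rule large_tails_blocks[OF 3(1) freq 3(3)])
    then show ?thesis using block_basic_y equivalent_y by blast
  qed
qed

end

context subsymmetric_basis
begin

lemma obtain_sorted_blocks:
  assumes B: "subsymmetric_seq smul N B"
  obtains n g \<gamma> a lt \<delta> M where "sorted_blocks smul N p s B n g \<gamma> a lt \<delta> M"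
proof -
  obtain c q \<delta> M where q: "strict_mono q" "\<And>k. q k + k < q (Suc k)" and \<delta>: "\<delta> > 0"
    and lower: "\<And>k. \<delta> \<le> Np (\<Sum>j=q k..<q (Suc k). smul (c k j) (s j))"
    and upper: "\<And>k. Np (\<Sum>j=q k..<q (Suc k). smul (c k j) (s j)) \<le> M"
    and eq: "equivalent_seqs smul N B (\<lambda>k. \<Sum>j=q k..<q (Suc k). smul (c k j) (s j))"
    by (rule subsymmetric_equivalent_blocks[OF B]) (rule that)
  define n where "n k = q (Suc k) - q k" for k
  have "\<exists>u. bij_betw u {..<n k} {q k..<q (Suc k)} \<and>
      (\<forall>i j. i \<le> j \<longrightarrow> j < n k \<longrightarrow> norm (c k (u j)) \<le> norm (c k (u i)))" for k
  proof -
    obtain u where "bij_betw u {..<card {q k..<q (Suc k)}} {q k..<q (Suc k)}"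
      "\<And>i j. i \<le> j \<Longrightarrow> j < card {q k..<q (Suc k)} \<Longrightarrow> norm (c k (u j)) \<le> norm (c k (u i))"
      by (rule obtain_decreasing_enumeration[of "{q k..<q (Suc k)}" "\<lambda>j. norm (c k j)"]) auto
    then show ?thesis by (intro exI[of _ u]) (simp add: n_def)
  qed
  then obtain u where u: "\<And>k. bij_betw (u k) {..<n k} {q k..<q (Suc k)}"
    "\<And>k i j. i \<le> j \<Longrightarrow> j < n k \<Longrightarrow> norm (c k (u k j)) \<le> norm (c k (u k i))" by metis
  \<comment> \<open>Padding with zeros beyond the block length keeps the lists uniformly bounded at
    every index, as the diagonal argument requires.\<close>
  define \<gamma> where "\<gamma> k j = (if j < n k then c k (u k j) else 0)" for k j
  have sum_eq: "(\<Sum>j<n k. smul (\<gamma> k j) (s (u k j))) = (\<Sum>j=q k..<q (Suc k). smul (c k j) (s j))" for k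
    unfolding \<gamma>_def using sum.reindex_bij_betw[OF u(1), of "\<lambda>j. smul (c k j) (s j)" k] by simp
  have "norm (\<gamma> k j) \<le> (2 * M / Np (s 0)) powr (1 / p)" for k j
  proof (cases "j < n k")
    case True
    have "co (u k j) (\<Sum>j<n k. smul (\<gamma> k j) (s (u k j))) = \<gamma> k j"
      using True u(1)[of k] by (intro coord_indexed_sum) (auto simp: bij_betw_def)
    then have "norm (\<gamma> k j) powr p * Np (s 0) \<le> 2 * M"
      using coord_bound[of "u k j" "\<Sum>j<n k. smul (\<gamma> k j) (s (u k j))"] upper[of k] by (simp add: sum_eq)
    then have "norm (\<gamma> k j) powr p \<le> 2 * M / Np (s 0)" using Np_s_pos by (simp add: pos_le_divide_eq)
    then have "(norm (\<gamma> k j) powr p) powr (1 / p) \<le> (2 * M / Np (s 0)) powr (1 / p)"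
      using p_pos by (intro powr_mono2) auto
    then show ?thesis using p_pos by (simp add: powr_powr)
  qed (simp add: \<gamma>_def)
  then have bound: "\<bar>norm (\<gamma> k j)\<bar> \<le> (2 * M / Np (s 0)) powr (1 / p)" for k j by simp
  \<comment> \<open>For indices beyond the length of block \<open>k\<close> the value of
    \<open>u k\<close> is arbitrary; this does no harm, since every index lies inside all late
    blocks.\<close>
  obtain \<psi> a lt where \<psi>: "strict_mono \<psi>" "\<And>j. (\<lambda>k. norm (\<gamma> (\<psi> k) j)) \<longlonglongrightarrow> a j"
    "\<And>i j. \<forall>\<^sub>F k in sequentially. (u (\<psi> k) i < u (\<psi> k) j) = lt i j"
    by (rule convergent_pattern_subsequence[where \<alpha> = "\<lambda>k j. norm (\<gamma> k j)" and
          R = "\<lambda>k i j. u k i < u k j", OF bound]) (rule that)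
  have "sorted_blocks smul N p s B (\<lambda>k. n (\<psi> k)) (\<lambda>k. u (\<psi> k)) (\<lambda>k. \<gamma> (\<psi> k)) a lt \<delta> M"
  proof unfold_locales
    fix k k' i j j'
    \<comment> \<open>This is where the gaps forced in the gliding hump enter.\<close>
    have "k < n k" for k using q(2)[of k] by (simp add: n_def)
    then show "k < n (\<psi> k)" using strict_mono_imp_increasing[OF \<psi>(1), of k] by (meson le_less_trans)
    show "inj_on (u (\<psi> k)) {..<n (\<psi> k)}" using u(1) by (simp add: bij_betw_def)
    show "u (\<psi> k) j < u (\<psi> k') j'" if "k < k'" "j < n (\<psi> k)" "j' < n (\<psi> k')"
    proof -
      have "u (\<psi> k) j < q (Suc (\<psi> k))" using u(1)[of "\<psi> k"] that by (auto simp: bij_betw_def)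
      also have "\<dots> \<le> q (\<psi> k')" using that \<psi>(1) q(1) by (simp add: strict_mono_less_eq Suc_le_eq strict_mono_less)
      also have "\<dots> \<le> u (\<psi> k') j'" using u(1)[of "\<psi> k'"] that by (auto simp: bij_betw_def)
      finally show ?thesis .
    qed
    show "norm (\<gamma> (\<psi> k) j) \<le> norm (\<gamma> (\<psi> k) i)" if "i \<le> j" "j < n (\<psi> k)"
      using u(2)[OF that] that by (simp add: \<gamma>_def)
    show "equivalent_seqs smul N B (\<lambda>k. \<Sum>j<n (\<psi> k). smul (\<gamma> (\<psi> k) j) (s (u (\<psi> k) j)))"
      using equivalent_subsymmetric_subseq[OF B eq \<psi>(1)] by (simp add: o_def sum_eq)
  qed (use B \<delta> lower upper \<psi> sum_eq in auto)
  then show ?thesis using that by blast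
qed

end

theorem theorem2p13:
  fixes smul :: "'f::{real_normed_field, euclidean_space} \<Rightarrow> 'a::ab_group_add \<Rightarrow> 'a"
    and N :: "'a \<Rightarrow> real"
    and p :: real
    and s B :: "nat \<Rightarrow> 'a"
  assumes "quasi_banach_space smul N"
    and "schauder_basis_of smul N s UNIV"
    and "subsymmetric_seq smul N s"
    and "0 < p" and "p \<le> 1" and "is_p_norm p N"
    and "subsymmetric_qnorm smul N s"
    and "subsymmetric_seq smul N B"
  shows
    "(\<exists>(a :: nat \<Rightarrow> real) d B'.
        positioning d \<and> (\<forall>j. 0 \<le> a j) \<and> decseq a \<and>
        seed_E_inf smul N s (\<lambda>j. of_real (a j)) d = 0 \<and>
        generated_by_seed smul N s (\<lambda>j. of_real (a j)) d B' \<and>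
        equivalent_seqs smul N B B') \<or>
     ((\<exists>y. block_basic_sequence smul N s y \<and> equivalent_seqs smul N B y) \<and>
      (\<exists>z. block_basic_sequence smul N s z \<and> semi_normalized N z \<and>
           uniformly_null smul N s z \<and> dominates smul N B z))"

proof -
  interpret quasi_banach_space smul N by fact
  interpret subsymmetric_basis smul N p s
    by unfold_locales (use assms in auto)
  obtain n g \<gamma> a lt \<delta> M where "sorted_blocks smul N p s B n g \<gamma> a lt \<delta> M"
    using obtain_sorted_blocks assms(8) by blast
  then interpret sorted_blocks smul N p s B n g \<gamma> a lt \<delta> M .
  show ?thesis by (rule seed_or_blocks)
qed

end
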